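(* Let $(X_i,Y_i)$, $i=1,\dots,n$, be an i.i.d. sample from a pair $(X,Y)$ with $X\in\mathbb R^d$ having a continuous distribution $\mathbb Q$ with support $\mathcal X$, and with $E(Y|X)=\Psi_0(\alpha_0^TX)$ almost surely, where $\alpha_0\in\mathcal S_{d-1}$ and $\Psi_0$ is non-decreasing. Let $g_0(x)=\Psi_0(\alpha_0^Tx)$, and let $\hat g_n(x)=\hat\Psi_n(\hat\alpha_n^Tx)$ be the least squares estimator of $g_0$. Assume: (A1) $\mathcal X$ is a bounded convex subset of $\mathbb R^d$; (A2) there exists $K_0>0$ such that $|g_0(x)|\le K_0$ for all $x\in\mathcal X$; (A3) there exist $a_0>0$ and $M>0$ such that for all integers $s\ge2$ and all $x\in\mathcal X$, $\int|y|^s\,d\mathbb P_x(y)\le a_0\,s!\,M^{s-2}$, where $\mathbb P_x$ is the conditional distribution of $Y$ given $X=x$; (A4) there exist $\overline q>0$ and $\underline q>0$ such that for all $\alpha\in\mathcal S_{d-1}$ the variable $\alpha^TX$ has a density with respect to Lebesgue measure that is bounded from above by $\overline q$ and bounded from below by $\underline q$ on its support $\{\alpha^Tx:x\in\mathcal X\}$. Then $$\left(\int_{\mathcal X}(\hat g_n(x)-g_0(x))^2\,d\mathbb Q(x)\right)^{1/2}=O_p(n^{-1/3}).$$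
   Context: $\mathcal S_{d-1}$ is the Euclidean unit sphere of $\mathbb R^d$; $\mathcal M$ is the class of non-decreasing functions on $\mathbb R$. $(\hat\Psi_n,\hat\alpha_n)$ is a minimizer of $h_n(\Psi,\alpha)=\sum_{i=1}^n\{Y_i-\Psi(\alpha^TX_i)\}^2$ over $\mathcal M\times\mathcal S_{d-1}$ (such a minimizer exists); here $\hat\alpha_n$ is an arbitrary minimizer of $\alpha\mapsto\min_{\Psi\in\mathcal M}h_n(\Psi,\alpha)$ over $\mathcal S_{d-1}$, and $\hat\Psi_n$ is the corresponding minimizer of $\Psi\mapsto h_n(\Psi,\hat\alpha_n)$ (whose values at the points $\hat\alpha_n^TX_i$ are uniquely determined) that is left-continuous and piecewise constant, with jumps only possible at the points $\hat\alpha_n^TX_i$, and extended as a constant to the left of the smallest and to the right of the largest of these points. *)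

theory Defs
  imports "HOL-Probability.Probability"
begin

definition atomless :: "'a::topological_space measure \<Rightarrow> bool" where
  "atomless Q \<longleftrightarrow> (\<forall>x. emeasure Q {x} = 0)"

definition msupport :: "'a::topological_space measure \<Rightarrow> 'a set" where
  "msupport Q = {x. \<forall>U. open U \<longrightarrow> x \<in> U \<longrightarrow> emeasure Q U > 0}"

text \<open>\<open>P x\<close> is a version of the conditional distribution of \<open>Y\<close> given \<open>X = x\<close>.\<close>

definition is_cond_distr ::
  "'w measure \<Rightarrow> ('w \<Rightarrow> 'a::topological_space) \<Rightarrow> ('w \<Rightarrow> real) \<Rightarrow> ('a \<Rightarrow> real measure) \<Rightarrow> bool" where
  "is_cond_distr M X Y P \<longleftrightarrow>
     P \<in> borel \<rightarrow>\<^sub>M prob_algebra borel \<and>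
     (\<forall>A\<in>sets borel. \<forall>B\<in>sets borel.
        emeasure M {\<omega> \<in> space M. X \<omega> \<in> A \<and> Y \<omega> \<in> B}
          = (\<integral>\<^sup>+x\<in>A. emeasure (P x) B \<partial>distr M borel X))"

text \<open>\<open>Z\<^sub>n = O\<^sub>p(r\<^sub>n)\<close>. The outer measure is needed because \<open>Z n\<close> may depend on a minimizer
  that was not chosen measurably; for measurable \<open>Z n\<close> it is the probability itself.\<close>

definition bigo_prob ::
  "'w measure \<Rightarrow> (nat \<Rightarrow> 'w \<Rightarrow> real) \<Rightarrow> (nat \<Rightarrow> real) \<Rightarrow> bool" where
  "bigo_prob M Z r \<longleftrightarrow>
     (\<forall>\<epsilon>>0. \<exists>C>0. \<forall>\<^sub>F n in sequentially.
        outer_measure_of M {\<omega> \<in> space M. \<bar>Z n \<omega>\<bar> > C * r n} \<le> ennreal \<epsilon>)"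

definition single_index :: "(real \<Rightarrow> real) \<Rightarrow> real ^ 'd \<Rightarrow> real ^ 'd \<Rightarrow> real" where
  "single_index \<Psi> \<alpha> x = \<Psi> (\<alpha> \<bullet> x)"

definition ls_crit ::
  "nat \<Rightarrow> (nat \<Rightarrow> real ^ 'd) \<Rightarrow> (nat \<Rightarrow> real) \<Rightarrow> (real \<Rightarrow> real) \<Rightarrow> real ^ 'd \<Rightarrow> real" where
  "ls_crit n x y \<Psi> \<alpha> = (\<Sum>i=1..n. (y i - single_index \<Psi> \<alpha> (x i))\<^sup>2)"

text \<open>The infimum is attained, so this is the minimum over the monotone class.\<close>

definition profile_crit ::
  "nat \<Rightarrow> (nat \<Rightarrow> real ^ 'd) \<Rightarrow> (nat \<Rightarrow> real) \<Rightarrow> real ^ 'd \<Rightarrow> real" where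
  "profile_crit n x y \<alpha> = (INF \<Psi>\<in>{\<Psi>. mono \<Psi>}. ls_crit n x y \<Psi> \<alpha>)"

text \<open>Left-continuous step functions with jumps only at the points \<open>z 1, \<dots>, z n\<close>, constant up to and
  including the smallest point and from the largest point onwards (so with no jump there).\<close>

definition left_cont_step :: "nat \<Rightarrow> (nat \<Rightarrow> real) \<Rightarrow> (real \<Rightarrow> real) \<Rightarrow> bool" where
  "left_cont_step n z \<Psi> \<longleftrightarrow>
     (\<forall>t. continuous (at_left t) \<Psi>) \<and>
     (\<forall>s t. s \<le> t \<longrightarrow> (\<forall>i\<in>{1..n}. z i \<notin> {s..t}) \<longrightarrow> \<Psi> s = \<Psi> t) \<and>
     (\<forall>s t. s \<le> t \<longrightarrow> (\<forall>i\<in>{1..n}. t \<le> z i) \<longrightarrow> \<Psi> s = \<Psi> t) \<and>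
     (\<forall>s t. s \<le> t \<longrightarrow> (\<forall>i\<in>{1..n}. z i \<le> s) \<longrightarrow> \<Psi> s = \<Psi> t)"

definition is_lse ::
  "nat \<Rightarrow> (nat \<Rightarrow> real ^ 'd) \<Rightarrow> (nat \<Rightarrow> real) \<Rightarrow> (real \<Rightarrow> real) \<Rightarrow> real ^ 'd \<Rightarrow> bool" where
  "is_lse n x y \<Psi> \<alpha> \<longleftrightarrow>
     is_arg_min (profile_crit n x y) (\<lambda>\<beta>. \<beta> \<in> sphere 0 1) \<alpha> \<and>
     is_arg_min (\<lambda>\<Phi>. ls_crit n x y \<Phi> \<alpha>) mono \<Psi> \<and>
     left_cont_step n (\<lambda>i. \<alpha> \<bullet> x i) \<Psi>"

end

theory Submission
  imports Defs "HOL-Real_Asymp.Real_Asymp"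
begin

text \<open>
  The estimator minimizes the empirical squared error over a class that contains the regression
  function, so its error \<open>f = gh - g\<^sub>0\<close> satisfies the basic inequality
  \<open>0 \<le> (\<Sum>i=1..n. 2 * e\<^sub>i * f (X\<^sub>i) - f (X\<^sub>i)\<^sup>2)\<close> with \<open>e\<^sub>i = Y\<^sub>i - g\<^sub>0 (X\<^sub>i)\<close>. Everything rests on a
  converse inequality, uniform over all ridge functions \<open>\<psi> (\<alpha> \<bullet> x)\<close> with monotone, suitably bounded \<open>\<psi>\<close>: up to an error of
  order \<open>n\<^bsup>1/3\<^esup>\<close> the same sum is at most \<open>- n/16 * (\<integral>x. f x\<^sup>2 \<partial>Q)\<close>. The two together give
  \<open>(\<integral>x. f x\<^sup>2 \<partial>Q) = O(n\<^bsup>-2/3\<^esup>)\<close>. Throughout, \<open>n\<close> lies between \<open>8 ^ J\<close> and \<open>8 ^ (J + 1)\<close>, so that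
  \<open>N = 2 ^ J\<close> is of the order \<open>n\<^bsup>1/3\<^esup>\<close>. The uniformity is obtained by union bounds over finite
  families of exponential inequalities, so the choice of the minimizer need not be measurable: with high
  probability a regular event (\<open>regular\<close>) occurs, and on it the error bound is deterministic.

  \<^emph>\<open>Bounded functions.\<close> Directions are replaced by a net with polynomially many elements; since the
  exponents below are of order \<open>N\<close> (or \<open>J\<^sup>2\<close>, which still beats any power of \<open>n\<close>), this costs nothing.
  In a fixed direction, a monotone function with values in \<open>[-K, K]\<close> is expanded over dyadic cells,
  from \<open>N\<close> cells down to \<open>N\<^sup>2\<close> cells, and the increments at the level with \<open>2 ^ k * N\<close> cells are rounded down
  to multiples of a mesh proportional to \<open>(5/4) ^ k / N\<close>. The total of the increments at each level is at
  most \<open>2 * K\<close>, so only few of them are rounded to something nonzero, and the rounded functions form a net of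
  cardinality at most \<open>exp (30 * N)\<close> and accuracy of order \<open>1 / N\<close> in quadratic mean
  (\<open>card_codes_le\<close>, \<open>monotone_decomposition\<close>). This is the entropy bound \<open>1 / \<epsilon>\<close> of the class
  of monotone functions, free of logarithms. Each net element obeys a one-sided exponential inequality
  (\<open>Chernoff_regression\<close>). The rounding remainders \<open>r\<close> are not covered by the net; there the noise
  enters through the cell sums \<open>S\<^sub>a\<close>, and \<open>(\<Sum>a. r\<^sub>a * S\<^sub>a) \<le> A * (\<Sum>a. r\<^sub>a) + max r * (\<Sum>a. max 0 (\<bar>S\<^sub>a\<bar> - A))\<close>,
  where the sum of the excesses is controlled by a single exponential moment (\<open>Chernoff_excess\<close>).
  These contributions decrease geometrically with the level and add up to a multiple of \<open>N\<close>
  (\<open>regular_residual_error\<close>, \<open>bounded_ridge_inequality\<close>).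

  \<^emph>\<open>Unbounded estimators.\<close> The estimator is only bounded by the largest observation. It is therefore
  truncated at a level \<open>K\<close> above the bound \<open>K0\<close> of \<open>g\<^sub>0\<close>. The part exceeding \<open>K\<close> is a superposition of
  indicators of halfspaces, and over every halfspace the sum of \<open>e\<^sub>i - B\<close> is at most of order \<open>J\<^sup>2\<close>
  if \<open>B\<close> is a suitable constant, because \<open>exp (\<lambda> * (e\<^sub>i - B))\<close> has mean at most one. With \<open>K = K0 + B\<close> the cross
  term of the square pays for \<open>B\<close> (\<open>tail_excess_bounds\<close>, \<open>least_squares_error_bound\<close>).
\<close>

section \<open>Coding bounded monotone sequences\<close>

definition bounded_sum_vectors :: "nat \<Rightarrow> nat \<Rightarrow> (nat \<Rightarrow> nat) set" where
  "bounded_sum_vectors m L = {f \<in> {..<m} \<rightarrow>\<^sub>E {..L}. (\<Sum>a<m. f a) \<le> L}"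

lemma finite_bounded_sum_vectors: "finite (bounded_sum_vectors m L)"
proof -
  have "finite ({..<m} \<rightarrow>\<^sub>E {..L})" by (intro finite_PiE) auto
  then show ?thesis unfolding bounded_sum_vectors_def by simp
qed

text \<open>
  A generating function bound: weight each vector by \<open>x\<close> to the power of its sum. Every weight is at
  least \<open>x ^ L\<close>, and the total weight of all vectors is at most a product of \<open>m\<close> geometric series.
\<close>

lemma card_bounded_sum_vectors_le:
  fixes x :: real assumes x: "0 < x" "x < 1"
  shows "real (card (bounded_sum_vectors m L)) \<le> (1 / x) ^ L * (1 / (1 - x)) ^ m"
proof -
  have fin: "finite ({..<m} \<rightarrow>\<^sub>E {..L})" by (intro finite_PiE) auto
  have "real (card (bounded_sum_vectors m L)) * x ^ L = (\<Sum>f\<in>bounded_sum_vectors m L. x ^ L)" by simp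
  also have "\<dots> \<le> (\<Sum>f\<in>bounded_sum_vectors m L. x ^ (\<Sum>a<m. f a))"
    using x by (intro sum_mono power_decreasing) (auto simp: bounded_sum_vectors_def)
  also have "\<dots> \<le> (\<Sum>f\<in>{..<m} \<rightarrow>\<^sub>E {..L}. x ^ (\<Sum>a<m. f a))"
    using x fin by (intro sum_mono2) (auto simp: bounded_sum_vectors_def)
  also have "\<dots> = (\<Sum>f\<in>{..<m} \<rightarrow>\<^sub>E {..L}. \<Prod>a<m. x ^ f a)"
    by (simp add: power_sum)
  also have "\<dots> = (\<Prod>a<m. \<Sum>l\<le>L. x ^ l)"
    by (subst prod_sum_PiE) auto
  also have "\<dots> \<le> (\<Prod>a<m. 1 / (1 - x))"
  proof (intro prod_mono conjI sum_nonneg)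
    show "(\<Sum>l\<le>L. x ^ l) \<le> 1 / (1 - x)"
    proof -
      have "(\<Sum>l\<le>L. x ^ l) \<le> (\<Sum>l. x ^ l)"
        using x by (intro sum_le_suminf summable_geometric) auto
      then show ?thesis using x by (simp add: suminf_geometric)
    qed
  qed (use x in auto)
  finally have "real (card (bounded_sum_vectors m L)) * x ^ L \<le> (1 / (1 - x)) ^ m" by simp
  then have "real (card (bounded_sum_vectors m L)) \<le> (1 / (1 - x)) ^ m / x ^ L"
    using x by (simp add: pos_le_divide_eq)
  then show ?thesis by (simp add: power_one_over field_simps)
qed

text \<open>
  A code lists the rounded increments of a monotone function: level \<open>k\<close> has \<open>2 ^ (J + k)\<close> cells, and the
  sum of its entries is bounded by \<open>2 * K\<close> divided by the mesh of that level.
\<close>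

definition codes :: "nat \<Rightarrow> (nat \<Rightarrow> nat \<Rightarrow> nat) set" where
  "codes J = (\<Pi>\<^sub>E k\<in>{..J}. bounded_sum_vectors (2 ^ (J + k)) (nat \<lfloor>2 ^ J * (4/5 :: real) ^ k\<rfloor>))"

lemma finite_codes: "finite (codes J)"
  unfolding codes_def by (intro finite_PiE finite_bounded_sum_vectors) auto

text \<open>
  The choice \<open>x = (2/5) ^ k / 2\<close> is of the order of the bound on the sum divided by the number of cells,
  which balances the two factors of the generating function bound.
\<close>

lemma card_bounded_sum_vectors_level_le:
  "real (card (bounded_sum_vectors (2 ^ (J + k)) (nat \<lfloor>2 ^ J * (4/5 :: real) ^ k\<rfloor>)))
     \<le> exp (2 ^ J * ((4/5) ^ k * (real k + 2)))"
proof -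
  define L where "L = nat \<lfloor>2 ^ J * (4/5 :: real) ^ k\<rfloor>"
  define x :: real where "x = (2/5) ^ k / 2"
  have x: "0 < x" "x \<le> 1/2" by (auto simp: x_def power_le_one)
  have L: "real L \<le> 2 ^ J * (4/5) ^ k" by (simp add: L_def)
  have "exp 1 \<ge> (1 + 1 + 1 / 2 :: real)"
    using exp_lower_Taylor_quadratic[of "1::real"] by simp
  then have e: "(5/2 :: real) \<le> exp 1" by simp
  have "1 / x = 2 * (5/2) ^ k" by (simp add: x_def power_divide field_simps)
  also have "\<dots> \<le> exp 1 * exp 1 ^ k" using e by (intro mult_mono power_mono) auto
  also have "\<dots> = exp (real k + 1)" by (simp add: exp_of_nat_mult[symmetric] exp_add)
  finally have 1: "(1 / x) ^ L \<le> exp ((real k + 1) * real L)"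
    using x power_mono[of "1/x" "exp (real k + 1)" L] by (simp add: exp_of_nat2_mult)
  have "1 / (1 - x) \<le> 1 + 2 * x" using x by (simp add: field_simps)
  also have "\<dots> \<le> exp (2 * x)" by (rule exp_ge_add_one_self)
  finally have 2: "(1 / (1 - x)) ^ (2 ^ (J + k)) \<le> exp (2 * x * real (2 ^ (J + k)))"
    using x power_mono[of "1/(1-x)" "exp (2 * x)" "2 ^ (J + k)"] by (simp add: exp_of_nat2_mult[symmetric])
  have "real (card (bounded_sum_vectors (2 ^ (J + k)) L)) \<le> (1 / x) ^ L * (1 / (1 - x)) ^ (2 ^ (J + k))"
    using x by (intro card_bounded_sum_vectors_le) auto
  also have "\<dots> \<le> exp ((real k + 1) * real L) * exp (2 * x * real (2 ^ (J + k)))"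
    using x by (intro mult_mono 1 2) auto
  also have "\<dots> = exp ((real k + 1) * real L + 2 * x * real (2 ^ (J + k)))"
    by (simp add: exp_add)
  also have "\<dots> \<le> exp (2 ^ J * ((4/5) ^ k * (real k + 2)))"
  proof -
    have "(real k + 1) * real L \<le> (real k + 1) * (2 ^ J * (4/5) ^ k)"
      using L by (intro mult_left_mono) auto
    moreover have "2 * x * real (2 ^ (J + k)) = 2 ^ J * (4/5) ^ k"
    proof -
      have "(2/5::real) ^ k * 2 ^ k = (4/5) ^ k" by (simp add: power_mult_distrib[symmetric])
      then show ?thesis by (simp add: x_def power_add mult_ac)
    qed
    ultimately have "(real k + 1) * real L + 2 * x * real (2 ^ (J + k)) \<le> 2 ^ J * ((4/5) ^ k * (real k + 2))"
      by (simp add: algebra_simps)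
    then show ?thesis by simp
  qed
  finally show ?thesis by (simp add: L_def)
qed

text \<open>
  The exponents of the levels decrease geometrically, so their sum has the order of the coarsest level and
  no logarithm appears.
\<close>

lemma card_codes_le: "real (card (codes J)) \<le> exp (30 * 2 ^ J)"
proof -
  have s: "(\<Sum>k<n. (4/5 :: real) ^ k * (real k + 2)) = 30 - (4/5) ^ n * (5 * real n + 30)" for n
  proof (induction n)
    case (Suc n)
    have "(4/5 :: real) ^ Suc n * (5 * real (Suc n) + 30) = (4/5) ^ n * (4 * real n + 28)" by simp
    then have "30 - (4/5 :: real) ^ n * (5 * real n + 30) + (4/5) ^ n * (real n + 2)
        = 30 - (4/5) ^ Suc n * (5 * real (Suc n) + 30)" by (simp only:) (simp add: algebra_simps)
    then show ?case using Suc by (simp only: sum.lessThan_Suc)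
  qed simp
  have "real (card (codes J)) = (\<Prod>k\<le>J. real (card (bounded_sum_vectors (2 ^ (J + k)) (nat \<lfloor>2 ^ J * (4/5 :: real) ^ k\<rfloor>))))"
    unfolding codes_def by (subst card_PiE) auto
  also have "\<dots> \<le> (\<Prod>k\<le>J. exp (2 ^ J * ((4/5) ^ k * (real k + 2))))"
    by (intro prod_mono conjI card_bounded_sum_vectors_level_le) auto
  also have "\<dots> = exp (2 ^ J * (\<Sum>k\<le>J. (4/5) ^ k * (real k + 2)))"
    by (simp add: exp_sum sum_distrib_left)
  also have "\<dots> \<le> exp (30 * 2 ^ J)"
    using s[of "Suc J"] by (simp add: lessThan_Suc_atMost)
  finally show ?thesis .
qed

text \<open>
  The factor \<open>5/4\<close> lies between \<open>1\<close> and \<open>2\<close>: above \<open>1\<close>, the number of nonzero entries decreases with the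
  level; below \<open>2\<close> (cells halve with the level), so does the quadratic rounding error.
\<close>

definition mesh :: "real \<Rightarrow> nat \<Rightarrow> nat \<Rightarrow> real" where
  "mesh K J k = 2 * K / 2 ^ J * (5/4) ^ k"

text \<open>
  At level \<open>0\<close> the rounded values themselves are monotone, and the code stores their increments; at
  higher levels it stores the rounded coefficients.
\<close>

definition coeff :: "nat \<Rightarrow> (nat \<Rightarrow> nat) \<Rightarrow> nat \<Rightarrow> nat" where
  "coeff k f a = (if k = 0 then \<Sum>b\<le>a. f b else f a)"

definition decode :: "real \<Rightarrow> nat \<Rightarrow> (nat \<Rightarrow> nat \<Rightarrow> nat) \<Rightarrow> (nat \<Rightarrow> nat) \<Rightarrow> real" where
  "decode K J m c = - K + (\<Sum>k\<le>J. mesh K J k * real (coeff k (m k) (c k)))"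

text \<open>
  Moving the left end point of an even cell does nothing, and for an odd cell the increment is
  \<open>w a - w (a - 1)\<close>; by monotonicity the sum is dominated by a telescoping one.
\<close>

lemma sum_increments_le:
  fixes w :: "nat \<Rightarrow> real"
  assumes "mono w"
  shows "(\<Sum>a<m. w a - w (2 * (a div 2))) \<le> w (m - 1) - w 0"
proof -
  have "(\<Sum>a<m. w a - w (2 * (a div 2))) \<le> (\<Sum>a<m. w a - w (a - 1))"
    by (intro sum_mono diff_left_mono monoD[OF assms]) presburger
  also have "\<dots> = w (m - 1) - w 0" by (induction m) auto
  finally show ?thesis .
qed


text \<open>
  Rounding of the dyadic expansion of a monotone sequence of length \<open>4 ^ J\<close>. The coefficient of a cell is
  the difference between the value at its left end and the value at the left end of its parent cell (at the
  coarsest level, the value itself plus \<open>K\<close>). The rounding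
  remainders \<open>r\<close> inherit two bounds from the coefficients: each is at most the mesh, and their total at each
  level is at most \<open>2 * K\<close>. Both are needed to control the noise.
\<close>

lemma monotone_decomposition:
  fixes v :: "nat \<Rightarrow> real"
  assumes v: "mono v" and bnd: "\<And>a. \<bar>v a\<bar> \<le> K" and K: "K > 0"
  obtains m r where "m \<in> codes J"
    "\<And>k a. 0 \<le> r k a" "\<And>k a. r k a \<le> mesh K J k"
    "\<And>k. k \<le> J \<Longrightarrow> (\<Sum>a<2 ^ (J + k). r k a) \<le> 2 * K"
    "\<And>i. i < 2 ^ (2 * J) \<Longrightarrow>
       v i = decode K J m (\<lambda>k. i div 2 ^ (J - k)) + (\<Sum>k\<le>J. r k (i div 2 ^ (J - k)))"
proof -
  define d where "d k a = (if k = 0 then v (a * 2 ^ J) + K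
      else v (a * 2 ^ (J - k)) - v (2 * (a div 2) * 2 ^ (J - k)))" for k a :: nat
  define t where "t = mesh K J"
  define q where "q k a = nat \<lfloor>d k a / t k\<rfloor>" for k a
  define r where "r k a = d k a - t k * real (q k a)" for k a
  define m where "m = (\<lambda>k\<in>{..J}. \<lambda>a\<in>{..<2 ^ (J + k)}.
      if k = 0 \<and> a > 0 then q 0 a - q 0 (a - 1) else q k a)"
  have t: "t k > 0" for k using K by (simp add: t_def mesh_def)
  have t_eq: "2 * K / t k = 2 ^ J * (4/5) ^ k" for k
    using K by (simp add: t_def mesh_def field_simps)
  have d0: "0 \<le> d k a" for k a
  proof -
    have "2 * (a div 2) * 2 ^ (J - k) \<le> a * 2 ^ (J - k)" by simp
    then show ?thesis using monoD[OF v] bnd[of "a * 2 ^ J"] by (auto simp: d_def)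
  qed
  have d_le: "d k a \<le> 2 * K" for k a
  proof (cases "k = 0")
    case True
    then show ?thesis using bnd[of "a * 2 ^ J"] unfolding d_def abs_le_iff by simp
  next
    case False
    have "v x - v y \<le> 2 * K" for x y using bnd[of x] bnd[of y] by linarith
    then show ?thesis using False unfolding d_def by (simp only: if_False)
  qed
  have q_le: "t k * real (q k a) \<le> d k a" for k a
  proof -
    have "real (q k a) \<le> d k a / t k" using d0[of k a] t[of k] by (simp add: q_def)
    then show ?thesis using t[of k] by (simp add: field_simps)
  qed
  have r0: "0 \<le> r k a" for k a using q_le[of k a] by (simp add: r_def)
  have rt: "r k a \<le> t k" for k a
  proof -
    have "d k a / t k \<le> real (q k a) + 1" unfolding q_def by linarith
    then show ?thesis using t[of k] by (simp add: r_def field_simps)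
  qed
  have rd: "r k a \<le> d k a" for k a using t[of k] by (simp add: r_def)
  have sum_d: "(\<Sum>a<2 ^ (J + k). d k a) \<le> 2 * K" if "k \<noteq> 0" for k
  proof -
    define w where "w = (\<lambda>a. v (a * 2 ^ (J - k)))"
    have "mono w" unfolding w_def by (intro monoI monoD[OF v]) simp
    have "(\<Sum>a<2 ^ (J + k). d k a) = (\<Sum>a<2 ^ (J + k). w a - w (2 * (a div 2)))"
      using that by (simp add: d_def w_def)
    also have "\<dots> \<le> w (2 ^ (J + k) - 1) - w 0" by (rule sum_increments_le) fact
    also have "\<dots> \<le> 2 * K" using bnd[of 0] bnd[of "(2 ^ (J + k) - 1) * 2 ^ (J - k)"]
      by (simp add: w_def)
    finally show ?thesis .
  qed
  have sum_r: "(\<Sum>a<2 ^ (J + k). r k a) \<le> 2 * K" for k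
  proof (cases "k = 0")
    case True
    have "r 0 a \<le> 2 * K / 2 ^ J" for a using rt[of 0 a] by (simp add: t_def mesh_def)
    then have "(\<Sum>a<(2::nat) ^ J. r 0 a) \<le> (\<Sum>a<(2::nat) ^ J. 2 * K / 2 ^ J)" by (intro sum_mono)
    then show ?thesis using True by simp
  next
    case False
    have "(\<Sum>a<2 ^ (J + k). r k a) \<le> (\<Sum>a<2 ^ (J + k). d k a)" by (intro sum_mono rd)
    with sum_d[OF False] show ?thesis by linarith
  qed
  have q_mono: "q 0 a \<le> q 0 b" if "a \<le> b" for a b
    unfolding q_def using that t[of 0]
    by (intro nat_mono floor_mono divide_right_mono) (auto simp: d_def intro!: monoD[OF v])
  (* at the coarsest level partial sums of the code recover the rounded values *)
  have q_tel: "(\<Sum>b\<le>a. if b > 0 then q 0 b - q 0 (b - 1) else q 0 b) = q 0 a" for a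
    by (induction a) (auto simp: q_mono)
  have coeff_eq: "coeff k (m k) a = q k a" if "k \<le> J" "a < 2 ^ (J + k)" for k a
  proof (cases "k = 0")
    case True
    then have "coeff k (m k) a = (\<Sum>b\<le>a. if b > 0 then q 0 b - q 0 (b - 1) else q 0 b)"
      using that unfolding coeff_def m_def by (auto intro!: sum.cong)
    then show ?thesis using q_tel True by simp
  next
    case False
    then show ?thesis using that by (simp add: coeff_def m_def)
  qed
  have m_sum: "(\<Sum>a<2 ^ (J + k). m k a) \<le> nat \<lfloor>2 ^ J * (4/5 :: real) ^ k\<rfloor>" if "k \<le> J" for k
  proof (rule le_nat_floor)
    have "t k * real (\<Sum>a<2 ^ (J + k). m k a) \<le> 2 * K"
    proof (cases "k = 0")
      case True
      have "(\<Sum>a<2 ^ (J + k). m k a) = (\<Sum>b\<le>2 ^ J - 1. if b > 0 then q 0 b - q 0 (b - 1) else q 0 b)"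
        using True that unfolding m_def by (intro sum.cong) (auto simp: less_Suc_eq_le[symmetric])
      then have "(\<Sum>a<2 ^ (J + k). m k a) = q 0 (2 ^ J - 1)" using q_tel by simp
      then show ?thesis using q_le[of 0 "2 ^ J - 1"] d_le[of 0 "2 ^ J - 1"] True by simp
    next
      case False
      have "t k * real (\<Sum>a<2 ^ (J + k). m k a) = (\<Sum>a<2 ^ (J + k). t k * real (q k a))"
        using False that by (simp add: m_def sum_distrib_left)
      also have "\<dots> \<le> (\<Sum>a<2 ^ (J + k). d k a)" by (intro sum_mono q_le)
      finally show ?thesis using sum_d[OF False] by linarith
    qed
    then have "real (\<Sum>a<2 ^ (J + k). m k a) \<le> 2 * K / t k" using t[of k] by (simp add: field_simps)
    then show "real (\<Sum>a<2 ^ (J + k). m k a) \<le> 2 ^ J * (4/5) ^ k" by (simp add: t_eq)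
  qed
  have "m \<in> codes J"
    unfolding codes_def
  proof (intro PiE_I)
    fix k assume k: "k \<in> {..J}"
    have "m k a \<le> nat \<lfloor>2 ^ J * (4/5 :: real) ^ k\<rfloor>" if "a < 2 ^ (J + k)" for a
      using m_sum[of k] k member_le_sum[of a "{..<2 ^ (J + k)}" "m k"] that by auto
    then show "m k \<in> bounded_sum_vectors (2 ^ (J + k)) (nat \<lfloor>2 ^ J * (4/5 :: real) ^ k\<rfloor>)"
      using k m_sum[of k] by (auto simp: bounded_sum_vectors_def m_def)
  qed (auto simp: m_def)
  moreover have "v i = decode K J m (\<lambda>k. i div 2 ^ (J - k)) + (\<Sum>k\<le>J. r k (i div 2 ^ (J - k)))"
    if i: "i < 2 ^ (2 * J)" for i
  proof -
    have tel: "(\<Sum>k\<le>n. d k (i div 2 ^ (J - k))) = v ((i div 2 ^ (J - n)) * 2 ^ (J - n)) + K"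
      if "n \<le> J" for n
      using that
    proof (induction n)
      case (Suc n)
      then have e: "J - n = Suc (J - Suc n)" by simp
      have "(i div 2 ^ (J - Suc n)) div 2 = i div 2 ^ (J - n)"
        unfolding e power_Suc2 div_mult2_eq ..
      then show ?case using Suc unfolding e
        by (simp add: d_def e mult_ac)
    qed (simp add: d_def)
    have lt: "i div 2 ^ (J - k) < 2 ^ (J + k)" if "k \<le> J" for k
    proof -
      have "(2::nat) ^ (2 * J) = 2 ^ (J + k) * 2 ^ (J - k)" using that by (simp add: power_add[symmetric] mult_2)
      then show ?thesis using i by (simp add: less_mult_imp_div_less)
    qed
    have "(\<Sum>k\<le>J. t k * real (coeff k (m k) (i div 2 ^ (J - k)))) + (\<Sum>k\<le>J. r k (i div 2 ^ (J - k)))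
        = (\<Sum>k\<le>J. d k (i div 2 ^ (J - k)))"
      unfolding sum.distrib[symmetric]
      by (intro sum.cong) (auto simp: coeff_eq lt r_def)
    then show ?thesis using tel[of J] by (simp add: decode_def t_def)
  qed
  ultimately show ?thesis using r0 rt sum_r that[of m r] by (simp add: t_def)
qed

section \<open>Nets of directions and layer-cake comparisons\<close>

text \<open>
  The unit vectors are classified by the integer parts of their scaled coordinates, and one unit vector is
  kept from each class, so that the net consists of directions.
\<close>

lemma sphere_net:
  fixes d :: nat and G :: nat
  assumes d: "d = CARD('d::finite)" and G: "G > 0"
  obtains S :: "(real ^ 'd) set" where "finite S" "S \<subseteq> sphere 0 1"
    "card S \<le> (2 * G + 1) ^ d"
    "\<And>\<alpha>. \<alpha> \<in> sphere 0 1 \<Longrightarrow> \<exists>\<beta>\<in>S. norm (\<alpha> - \<beta>) \<le> real d / real G"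
proof -
  define c :: "real ^ 'd \<Rightarrow> 'd \<Rightarrow> int" where "c = (\<lambda>\<alpha> i. \<lfloor>\<alpha> $ i * real G\<rfloor>)"
  define T where "T = c ` sphere (0 :: real ^ 'd) 1"
  define B where "B = (UNIV :: 'd set) \<rightarrow>\<^sub>E {- int G..int G}"
  have T: "T \<subseteq> B"
  proof -
    have "c \<alpha> i \<in> {- int G..int G}" if "norm \<alpha> = 1" for \<alpha> i
    proof -
      have "\<bar>\<alpha> $ i\<bar> \<le> 1" using component_le_norm_cart[of \<alpha> i] that by simp
      then have "\<bar>\<alpha> $ i\<bar> * real G \<le> real G"
        using mult_right_mono[of "\<bar>\<alpha> $ i\<bar>" 1 "real G"] by simp
      then have "- real G \<le> \<alpha> $ i * real G" "\<alpha> $ i * real G \<le> real G"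
        by (metis abs_mult abs_of_nat abs_le_iff minus_le_iff)+
      then have "- int G \<le> \<lfloor>\<alpha> $ i * real G\<rfloor>" "\<lfloor>\<alpha> $ i * real G\<rfloor> \<le> int G"
        by (simp_all add: le_floor_iff floor_le_iff)
      then show ?thesis by (simp add: c_def)
    qed
    then show ?thesis by (auto simp: T_def B_def PiE_def)
  qed
  have finB: "finite B" unfolding B_def by (intro finite_PiE) auto
  have cardB: "card B = (2 * G + 1) ^ d"
  proof -
    have "nat (2 * int G + 1) = 2 * G + 1" by simp
    then show ?thesis unfolding B_def by (subst card_PiE) (simp_all add: d)
  qed
  define g where "g = inv_into (sphere (0 :: real ^ 'd) 1) c"
  show ?thesis
  proof (rule that[of "g ` T"])
    show "finite (g ` T)" using finB T by (meson finite_imageI finite_subset)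
    show "g ` T \<subseteq> sphere 0 1" unfolding T_def g_def by (auto intro!: inv_into_into simp del: mem_sphere)
    show "card (g ` T) \<le> (2 * G + 1) ^ d"
      using card_image_le[of T g] card_mono[OF finB T] finite_subset[OF T finB] cardB by linarith
    fix \<alpha> :: "real ^ 'd" assume \<alpha>: "\<alpha> \<in> sphere 0 1"
    define \<beta> where "\<beta> = g (c \<alpha>)"
    have cb: "c \<beta> = c \<alpha>" unfolding \<beta>_def g_def using \<alpha> by (intro f_inv_into_f) auto
    have "\<bar>(\<alpha> - \<beta>) $ i\<bar> \<le> 1 / real G" for i
    proof -
      have "\<lfloor>\<alpha> $ i * real G\<rfloor> = \<lfloor>\<beta> $ i * real G\<rfloor>" using fun_cong[OF cb, of i] by (simp add: c_def)
      then have "\<bar>\<alpha> $ i * real G - \<beta> $ i * real G\<bar> \<le> 1" by linarith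
      then have "\<bar>(\<alpha> - \<beta>) $ i\<bar> * real G \<le> 1"
        by (simp add: abs_mult_pos left_diff_distrib)
      then show ?thesis using G by (simp add: field_simps)
    qed
    then have "norm (\<alpha> - \<beta>) \<le> (\<Sum>i\<in>(UNIV::'d set). 1 / real G)"
      by (intro order_trans[OF norm_le_l1_cart] sum_mono)
    then have "norm (\<alpha> - \<beta>) \<le> real d / real G" by (simp add: d)
    moreover have "\<beta> \<in> g ` T" using \<alpha> by (auto simp: \<beta>_def T_def)
    ultimately show "\<exists>\<beta>\<in>g ` T. norm (\<alpha> - \<beta>) \<le> real d / real G" by blast
  qed
qed

text \<open>
  Integration of the hypothesis over \<open>v\<close> between \<open>0\<close> and \<open>w\<close>, since \<open>h i\<close> is the length of the set of
  those \<open>v\<close> that lie below it. The weights \<open>a\<close> may have either sign.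
\<close>

lemma layer_cake_sum_le:
  fixes h a :: "'i \<Rightarrow> real"
  assumes I: "finite I" and h: "\<And>i. i \<in> I \<Longrightarrow> 0 \<le> h i" "\<And>i. i \<in> I \<Longrightarrow> h i \<le> w" and w: "0 \<le> w"
    and le: "\<And>v. 0 \<le> v \<Longrightarrow> (\<Sum>i\<in>{i\<in>I. v < h i}. a i) \<le> r"
  shows "(\<Sum>i\<in>I. a i * h i) \<le> r * w"
proof -
  have 1: "((\<lambda>v. if v < h i then a i else 0) has_integral a i * h i) {0..w}" if i: "i \<in> I" for i
  proof -
    have "((\<lambda>v. a i) has_integral a i * h i) {0..h i}"
      using has_integral_const_real[of "a i" 0 "h i"] h[OF i] by (simp add: mult.commute)
    then have "((\<lambda>v. if v < h i then a i else 0) has_integral a i * h i) {0..h i}"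
      by (rule has_integral_spike_finite[of "{h i}", rotated 2]) auto
    moreover have "((\<lambda>v. if v < h i then a i else 0) has_integral 0) {h i..w}"
      by (rule has_integral_is_0) auto
    ultimately show ?thesis
      using has_integral_combine[OF h[OF i]] by fastforce
  qed
  have "((\<lambda>v. \<Sum>i\<in>I. if v < h i then a i else 0) has_integral (\<Sum>i\<in>I. a i * h i)) {0..w}"
    by (intro has_integral_sum I 1)
  moreover have "((\<lambda>v. r) has_integral r * w) {0..w}"
    using has_integral_const_real[of r 0 w] w by (simp add: mult.commute)
  moreover have "(\<Sum>i\<in>I. if v < h i then a i else 0) \<le> r" if "v \<in> {0..w}" for v
    using le[of v] that I by (simp add: sum.inter_filter)
  ultimately show ?thesis by (rule has_integral_le)
qed

text \<open>
  The same principle for two measures, here used to compare \<open>Q\<close> with the empirical measure; the functions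
  may live on different spaces.
\<close>

lemma layer_cake_nn_integral_le:
  fixes f :: "'a \<Rightarrow> real" and g :: "'b \<Rightarrow> real"
  assumes sf: "sigma_finite_measure \<mu>" "sigma_finite_measure \<nu>"
    and [measurable]: "f \<in> borel_measurable \<mu>" "g \<in> borel_measurable \<nu>"
    and f: "\<And>x. x \<in> space \<mu> \<Longrightarrow> f x \<le> w" and w: "0 \<le> w"
    and le: "\<And>v. 0 \<le> v \<Longrightarrow> emeasure \<mu> {x\<in>space \<mu>. v < f x} \<le> emeasure \<nu> {x\<in>space \<nu>. v < g x} + ennreal r"
  shows "(\<integral>\<^sup>+x. ennreal (f x) \<partial>\<mu>) \<le> (\<integral>\<^sup>+x. ennreal (g x) \<partial>\<nu>) + ennreal (r * w)"
proof -
  have cake: "(\<integral>\<^sup>+x. ennreal (h x) \<partial>\<kappa>) = (\<integral>\<^sup>+v\<in>{0..}. emeasure \<kappa> {x\<in>space \<kappa>. v < h x} \<partial>lborel)"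
    if sf: "sigma_finite_measure \<kappa>" and [measurable]: "h \<in> borel_measurable \<kappa>" for \<kappa> :: "'c measure" and h :: "'c \<Rightarrow> real"
  proof -
    interpret K: sigma_finite_measure \<kappa> by fact
    interpret PS: pair_sigma_finite \<kappa> lborel by standard
    have "(\<integral>\<^sup>+x. ennreal (h x) \<partial>\<kappa>) = (\<integral>\<^sup>+x. \<integral>\<^sup>+v. indicator {v. 0 \<le> v \<and> v < h x} v \<partial>lborel \<partial>\<kappa>)"
    proof (intro nn_integral_cong)
      fix x
      have "{v. 0 \<le> v \<and> v < h x} = {0..<h x}" by auto
      then show "ennreal (h x) = (\<integral>\<^sup>+v. indicator {v. 0 \<le> v \<and> v < h x} v \<partial>lborel)"
        by (cases "0 \<le> h x") (auto simp: ennreal_neg)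
    qed
    also have "\<dots> = (\<integral>\<^sup>+v. \<integral>\<^sup>+x. indicator {v. 0 \<le> v \<and> v < h x} v \<partial>\<kappa> \<partial>lborel)"
    proof -
      have "(\<lambda>(x, v). indicator {v. 0 \<le> v \<and> v < h x} v :: ennreal) \<in> borel_measurable (\<kappa> \<Otimes>\<^sub>M lborel)"
        by measurable
      from PS.Fubini'[OF this] show ?thesis by simp
    qed
    also have "\<dots> = (\<integral>\<^sup>+v\<in>{0..}. emeasure \<kappa> {x\<in>space \<kappa>. v < h x} \<partial>lborel)"
    proof (intro nn_integral_cong)
      fix v :: real
      have "(\<integral>\<^sup>+x. indicator {v. 0 \<le> v \<and> v < h x} v \<partial>\<kappa>)
          = (\<integral>\<^sup>+x. indicator {x\<in>space \<kappa>. v < h x} x * indicator {0..} v \<partial>\<kappa>)"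
        by (intro nn_integral_cong) (auto split: split_indicator)
      then show "(\<integral>\<^sup>+x. indicator {v. 0 \<le> v \<and> v < h x} v \<partial>\<kappa>) = emeasure \<kappa> {x\<in>space \<kappa>. v < h x} * indicator {0..} v"
        by (simp add: nn_integral_multc)
    qed
    finally show ?thesis .
  qed
  interpret N: sigma_finite_measure \<nu> by fact
  have [measurable]: "(\<lambda>v. emeasure \<nu> {x\<in>space \<nu>. v < g x}) \<in> borel_measurable lborel"
  proof -
    have "(\<lambda>v. emeasure \<nu> {x\<in>space \<nu>. v < g x}) = (\<lambda>v. \<integral>\<^sup>+x. indicator {v. v < g x} v \<partial>\<nu>)"
    proof
      fix v
      have "(\<integral>\<^sup>+x. indicator {v. v < g x} v \<partial>\<nu>) = (\<integral>\<^sup>+x. indicator {x\<in>space \<nu>. v < g x} x \<partial>\<nu>)"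
        by (intro nn_integral_cong) (auto split: split_indicator)
      then show "emeasure \<nu> {x\<in>space \<nu>. v < g x} = (\<integral>\<^sup>+x. indicator {v. v < g x} v \<partial>\<nu>)" by simp
    qed
    then show ?thesis by simp
  qed
  have "(\<integral>\<^sup>+x. ennreal (f x) \<partial>\<mu>) = (\<integral>\<^sup>+v\<in>{0..}. emeasure \<mu> {x\<in>space \<mu>. v < f x} \<partial>lborel)"
    by (intro cake sf) simp
  also have "\<dots> \<le> (\<integral>\<^sup>+v. emeasure \<nu> {x\<in>space \<nu>. v < g x} * indicator {0..} v + ennreal r * indicator {0..w} v \<partial>lborel)"
  proof (intro nn_integral_mono)
    fix v :: real
    show "emeasure \<mu> {x\<in>space \<mu>. v < f x} * indicator {0..} v
        \<le> emeasure \<nu> {x\<in>space \<nu>. v < g x} * indicator {0..} v + ennreal r * indicator {0..w} v"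
    proof (cases "0 \<le> v \<and> v \<le> w")
      case True
      then show ?thesis using le[of v] by simp
    next
      case False
      then have "v < 0 \<or> {x\<in>space \<mu>. v < f x} = {}" using f by force
      then show ?thesis
      proof
        assume "{x\<in>space \<mu>. v < f x} = {}"
        then show ?thesis by (simp only: emeasure_empty) simp
      qed simp
    qed
  qed
  also have "\<dots> = (\<integral>\<^sup>+v\<in>{0..}. emeasure \<nu> {x\<in>space \<nu>. v < g x} \<partial>lborel) + ennreal r * ennreal w"
    using w by (subst nn_integral_add) (auto simp: nn_integral_cmult)
  also have "(\<integral>\<^sup>+v\<in>{0..}. emeasure \<nu> {x\<in>space \<nu>. v < g x} \<partial>lborel) = (\<integral>\<^sup>+x. ennreal (g x) \<partial>\<nu>)"
    by (intro cake[symmetric] sf) simp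
  also have "ennreal r * ennreal w = ennreal (r * w)" using w by (simp add: ennreal_mult'')
  finally show ?thesis .
qed

section \<open>Conditional distributions and exponential moments\<close>

lemma exp_le_quadratic:
  fixes z :: real shows "exp z \<le> 1 + z + z\<^sup>2 / 2 * exp \<bar>z\<bar>"
proof -
  obtain t where t: "\<bar>t\<bar> \<le> \<bar>z\<bar>" and e: "exp z = (\<Sum>m<2. z ^ m / fact m) + exp t / fact 2 * z ^ 2"
    using Maclaurin_exp_le[of z 2] by blast
  have "exp z = 1 + z + z\<^sup>2 / 2 * exp t" using e by (simp add: numeral_2_eq_2)
  moreover have "exp t \<le> exp \<bar>z\<bar>" using t by simp
  ultimately show ?thesis by (simp add: mult_left_mono)
qed

text \<open>
  Termwise integration of the exponential series. The first moment, which is not covered by the hypothesis, is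
  bounded through the second one.
\<close>

lemma exp_moment_of_factorial_moments:
  fixes p :: "real measure"
  assumes "prob_space p" and [measurable_cong]: "sets p = sets borel" and M: "0 < b" and a: "0 < a"
    and mom: "\<And>s::nat. s \<ge> 2 \<Longrightarrow> (\<integral>\<^sup>+y. ennreal (\<bar>y\<bar> ^ s) \<partial>p) \<le> ennreal (a * fact s * b ^ (s - 2))"
  defines "l \<equiv> 1 / (2 * b)"
  shows "(\<integral>\<^sup>+y. ennreal (exp (l * \<bar>y\<bar>)) \<partial>p) \<le> ennreal (2 * (1 + 2 * l * (1 + 2 * a) + 4 * a * l\<^sup>2))"
proof -
  interpret p: prob_space p by fact
  define C where "C = 1 + 2 * l * (1 + 2 * a) + 4 * a * l\<^sup>2"
  have l: "l > 0" using M by (simp add: l_def)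
  have C: "C \<ge> 1" "C \<ge> 2 * l * (1 + 2 * a)" "C \<ge> 4 * a * l\<^sup>2" using l a by (simp_all add: C_def)
  have m1: "(\<integral>\<^sup>+y. ennreal \<bar>y\<bar> \<partial>p) \<le> ennreal (1 + 2 * a)"
  proof -
    have "(\<integral>\<^sup>+y. ennreal \<bar>y\<bar> \<partial>p) \<le> (\<integral>\<^sup>+y. 1 + ennreal (\<bar>y\<bar> ^ 2) \<partial>p)"
    proof (intro nn_integral_mono)
      fix y :: real
      have "0 \<le> (\<bar>y\<bar> - 1)\<^sup>2" by simp
      then have "\<bar>y\<bar> \<le> 1 + \<bar>y\<bar> ^ 2" unfolding power2_diff by simp
      then show "ennreal \<bar>y\<bar> \<le> 1 + ennreal (\<bar>y\<bar> ^ 2)"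
        by (metis ennreal_1 ennreal_leI ennreal_plus zero_le_one zero_le_power abs_ge_zero)
    qed
    also have "\<dots> = 1 + (\<integral>\<^sup>+y. ennreal (\<bar>y\<bar> ^ 2) \<partial>p)"
      by (subst nn_integral_add) (auto simp: p.emeasure_space_1)
    also have "\<dots> \<le> 1 + ennreal (2 * a)" using mom[of 2] by (intro add_left_mono) (simp add: mult.commute)
    finally show ?thesis using a by simp
  qed
  (* one geometric series dominates all terms, those with s < 2 included *)
  have summand: "(\<integral>\<^sup>+y. ennreal ((l * \<bar>y\<bar>) ^ s / fact s) \<partial>p) \<le> ennreal (C * (1/2) ^ s)" for s :: nat
  proof -
    have eq: "(\<integral>\<^sup>+y. ennreal ((l * \<bar>y\<bar>) ^ s / fact s) \<partial>p) = ennreal (l ^ s / fact s) * (\<integral>\<^sup>+y. ennreal (\<bar>y\<bar> ^ s) \<partial>p)"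
    proof -
      have "ennreal ((l * \<bar>y\<bar>) ^ s / fact s) = ennreal (l ^ s / fact s) * ennreal (\<bar>y\<bar> ^ s)" for y
        using l by (simp add: power_mult_distrib ennreal_mult'[symmetric])
      then show ?thesis by (simp add: nn_integral_cmult)
    qed
    consider "s = 0" | "s = 1" | "s \<ge> 2" by linarith
    then show ?thesis
    proof cases
      case 1
      then show ?thesis using C by (simp add: p.emeasure_space_1)
    next
      case 2
      have "ennreal l * (\<integral>\<^sup>+y. ennreal \<bar>y\<bar> \<partial>p) \<le> ennreal l * ennreal (1 + 2 * a)"
        by (intro mult_left_mono m1) auto
      also have "\<dots> = ennreal (l * (1 + 2 * a))" using l by (simp add: ennreal_mult')
      also have "\<dots> \<le> ennreal (C * (1/2))" using C by (intro ennreal_leI) simp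
      finally show ?thesis using 2 unfolding eq by simp
    next
      case 3
      have "ennreal (l ^ s / fact s) * (\<integral>\<^sup>+y. ennreal (\<bar>y\<bar> ^ s) \<partial>p)
          \<le> ennreal (l ^ s / fact s) * ennreal (a * fact s * b ^ (s - 2))"
        by (intro mult_left_mono mom 3) auto
      also have "\<dots> = ennreal (a * l ^ s * b ^ (s - 2))"
        using l by (subst ennreal_mult'[symmetric]) (auto simp: field_simps)
      also have "a * l ^ s * b ^ (s - 2) = 4 * a * l\<^sup>2 * (1/2) ^ s"
      proof -
        obtain k where k: "s = k + 2" using 3 by (metis add.commute le_Suc_ex)
        have "l ^ k * b ^ k = (1/2) ^ k" using M by (simp add: l_def flip: power_mult_distrib)
        then have "a * l ^ s * b ^ (s - 2) = a * l\<^sup>2 * (1/2) ^ k" by (simp add: k power_add power2_eq_square)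
        then show ?thesis by (simp add: k power_add power2_eq_square)
      qed
      also have "\<dots> \<le> C * (1/2) ^ s" using C by (intro mult_right_mono) auto
      finally show ?thesis unfolding eq by (simp add: ennreal_leI)
    qed
  qed
  have "(\<integral>\<^sup>+y. ennreal (exp (l * \<bar>y\<bar>)) \<partial>p) = (\<integral>\<^sup>+y. (\<Sum>s. ennreal ((l * \<bar>y\<bar>) ^ s / fact s)) \<partial>p)"
  proof (intro nn_integral_cong)
    fix y
    have "(\<lambda>s. (l * \<bar>y\<bar>) ^ s / fact s) sums exp (l * \<bar>y\<bar>)"
      using exp_converges[of "l * \<bar>y\<bar>"] by (simp add: field_simps)
    then show "ennreal (exp (l * \<bar>y\<bar>)) = (\<Sum>s. ennreal ((l * \<bar>y\<bar>) ^ s / fact s))"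
      using l by (intro suminf_ennreal_eq[symmetric]) auto
  qed
  also have "\<dots> = (\<Sum>s. \<integral>\<^sup>+y. ennreal ((l * \<bar>y\<bar>) ^ s / fact s) \<partial>p)"
    by (intro nn_integral_suminf) simp
  also have "\<dots> \<le> (\<Sum>s. ennreal (C * (1/2) ^ s))" by (intro suminf_le summand) auto
  also have "\<dots> = ennreal (\<Sum>s. C * (1/2) ^ s)"
    using C by (intro suminf_ennreal2 summable_mult summable_geometric) auto
  also have "(\<Sum>s. C * (1/2) ^ s) = 2 * C"
    by (subst suminf_mult) (auto simp: suminf_geometric)
  finally show ?thesis by (simp add: C_def)
qed

text \<open>
  The quadratic bound for small \<open>w\<close> comes from the second order Taylor expansion: the linear term
  integrates to zero, and the remainder \<open>(w * t)\<^sup>2 / 2 * exp \<bar>w * t\<bar>\<close> is absorbed by \<open>exp (l * t)\<close> as long as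
  \<open>\<bar>w\<bar> \<le> l / 2\<close>. A single constant serves for both bounds.
\<close>

lemma centred_exp_moments:
  fixes p :: "real measure"
  assumes "prob_space p" and [measurable_cong]: "sets p = sets borel"
    and l: "l > 0" and mom: "(\<integral>\<^sup>+y. ennreal (exp (l * \<bar>y\<bar>)) \<partial>p) \<le> ennreal B"
    and mean: "integrable p (\<lambda>y. y)" "(\<integral>y. y \<partial>p) = \<mu>" and K: "\<bar>\<mu>\<bar> \<le> K"
  defines "g \<equiv> (1 + 4 / l\<^sup>2) * (exp (l * K) * B)"
  shows "(\<integral>\<^sup>+y. ennreal (exp (l * \<bar>y - \<mu>\<bar>)) \<partial>p) \<le> ennreal g"
    and "\<bar>w\<bar> \<le> l / 2 \<Longrightarrow> (\<integral>\<^sup>+y. ennreal (exp (w * (y - \<mu>))) \<partial>p) \<le> ennreal (1 + g * w\<^sup>2)"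
proof -
  interpret p: prob_space p by fact
  have B: "B \<ge> 0"
  proof (rule ccontr)
    assume "\<not> B \<ge> 0"
    then have "(\<integral>\<^sup>+y. ennreal (exp (l * \<bar>y\<bar>)) \<partial>p) = 0" using mom by (simp add: ennreal_neg)
    moreover have "(\<integral>\<^sup>+y. 1 \<partial>p) \<le> (\<integral>\<^sup>+y. ennreal (exp (l * \<bar>y\<bar>)) \<partial>p)"
      using l by (intro nn_integral_mono) (simp flip: ennreal_1)
    ultimately show False by (simp add: p.emeasure_space_1)
  qed
  have pt: "exp (l * \<bar>y - \<mu>\<bar>) \<le> exp (l * K) * exp (l * \<bar>y\<bar>)" for y
  proof -
    have "\<bar>y - \<mu>\<bar> \<le> K + \<bar>y\<bar>" using K by linarith
    then have "l * \<bar>y - \<mu>\<bar> \<le> l * (K + \<bar>y\<bar>)" using l by (intro mult_left_mono) auto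
    then show ?thesis by (simp add: distrib_left flip: exp_add)
  qed
  have e1: "(\<integral>\<^sup>+y. ennreal (exp (l * \<bar>y - \<mu>\<bar>)) \<partial>p) \<le> ennreal (exp (l * K) * B)"
  proof -
    have "(\<integral>\<^sup>+y. ennreal (exp (l * \<bar>y - \<mu>\<bar>)) \<partial>p) \<le> (\<integral>\<^sup>+y. ennreal (exp (l * K)) * ennreal (exp (l * \<bar>y\<bar>)) \<partial>p)"
      using pt by (intro nn_integral_mono) (simp add: ennreal_leI flip: ennreal_mult')
    also have "\<dots> = ennreal (exp (l * K)) * (\<integral>\<^sup>+y. ennreal (exp (l * \<bar>y\<bar>)) \<partial>p)"
      by (intro nn_integral_cmult) simp
    also have "\<dots> \<le> ennreal (exp (l * K)) * ennreal B" by (intro mult_left_mono mom) simp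
    finally show ?thesis by (simp add: ennreal_mult')
  qed
  have g: "exp (l * K) * B \<le> g" "4 / l\<^sup>2 * (exp (l * K) * B) \<le> g"
    using B by (auto simp: g_def distrib_right)
  show "(\<integral>\<^sup>+y. ennreal (exp (l * \<bar>y - \<mu>\<bar>)) \<partial>p) \<le> ennreal g"
    using e1 g(1) by (meson ennreal_leI order_trans)
  assume w: "\<bar>w\<bar> \<le> l / 2"
  have int: "integrable p (\<lambda>y. exp (l * \<bar>y - \<mu>\<bar>))"
    using e1 by (intro integrableI_bounded) (auto simp: top_unique less_top[symmetric])
  have intE: "(\<integral>y. exp (l * \<bar>y - \<mu>\<bar>) \<partial>p) \<le> exp (l * K) * B"
    using e1 B by (subst integral_eq_nn_integral) (auto intro!: enn2real_leI)
  have q: "exp (w * (y - \<mu>)) \<le> 1 + w * (y - \<mu>) + w\<^sup>2 * (4 / l\<^sup>2 * exp (l * \<bar>y - \<mu>\<bar>))" for y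
  proof -
    define t where "t = \<bar>y - \<mu>\<bar>"
    have t: "t \<ge> 0" by (simp add: t_def)
    have "(l / 2 * t)\<^sup>2 / 2 \<le> exp (l / 2 * t)"
    proof -
      have "0 \<le> l / 2 * t" using l t by simp
      with exp_lower_Taylor_quadratic[OF this] show ?thesis by linarith
    qed
    moreover have "t\<^sup>2 / 2 = 4 / l\<^sup>2 * ((l / 2 * t)\<^sup>2 / 2)"
      using l by (simp add: power_mult_distrib power_divide)
    ultimately have sq: "t\<^sup>2 / 2 \<le> 4 / l\<^sup>2 * exp (l / 2 * t)"
      using mult_left_mono[of "(l / 2 * t)\<^sup>2 / 2" "exp (l / 2 * t)" "4 / l\<^sup>2"] by simp
    have wl: "\<bar>w * (y - \<mu>)\<bar> \<le> l / 2 * t"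
      unfolding abs_mult t_def by (intro mult_right_mono w) simp
    have "(w * (y - \<mu>))\<^sup>2 / 2 * exp \<bar>w * (y - \<mu>)\<bar> = w\<^sup>2 * (t\<^sup>2 / 2 * exp \<bar>w * (y - \<mu>)\<bar>)"
      by (simp add: power_mult_distrib t_def)
    also have "\<dots> \<le> w\<^sup>2 * (4 / l\<^sup>2 * exp (l / 2 * t) * exp (l / 2 * t))"
      using wl sq by (intro mult_left_mono mult_mono) auto
    also have "\<dots> = w\<^sup>2 * (4 / l\<^sup>2 * exp (l * t))"
      by (simp add: exp_add[symmetric])
    finally show ?thesis using exp_le_quadratic[of "w * (y - \<mu>)"] by (simp add: t_def)
  qed
  have intq: "integrable p (\<lambda>y. 1 + w * (y - \<mu>) + w\<^sup>2 * (4 / l\<^sup>2 * exp (l * \<bar>y - \<mu>\<bar>)))"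
    using int mean(1) by auto
  have "(\<integral>\<^sup>+y. ennreal (exp (w * (y - \<mu>))) \<partial>p)
      \<le> (\<integral>\<^sup>+y. ennreal (1 + w * (y - \<mu>) + w\<^sup>2 * (4 / l\<^sup>2 * exp (l * \<bar>y - \<mu>\<bar>))) \<partial>p)"
    by (intro nn_integral_mono ennreal_leI q)
  also have "\<dots> = ennreal (\<integral>y. 1 + w * (y - \<mu>) + w\<^sup>2 * (4 / l\<^sup>2 * exp (l * \<bar>y - \<mu>\<bar>)) \<partial>p)"
    using q by (intro nn_integral_eq_integral intq) (auto intro!: AE_I2 order_trans[OF exp_ge_zero])
  also have "(\<integral>y. 1 + w * (y - \<mu>) + w\<^sup>2 * (4 / l\<^sup>2 * exp (l * \<bar>y - \<mu>\<bar>)) \<partial>p)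
      = 1 + w\<^sup>2 * (4 / l\<^sup>2 * (\<integral>y. exp (l * \<bar>y - \<mu>\<bar>) \<partial>p))"
    using int mean by (simp add: p.prob_space)
  also have "\<dots> \<le> 1 + g * w\<^sup>2"
  proof -
    have "4 / l\<^sup>2 * (\<integral>y. exp (l * \<bar>y - \<mu>\<bar>) \<partial>p) \<le> 4 / l\<^sup>2 * (exp (l * K) * B)"
      by (intro mult_left_mono intE) simp
    then have "4 / l\<^sup>2 * (\<integral>y. exp (l * \<bar>y - \<mu>\<bar>) \<partial>p) \<le> g" using g(2) by linarith
    then have "w\<^sup>2 * (4 / l\<^sup>2 * (\<integral>y. exp (l * \<bar>y - \<mu>\<bar>) \<partial>p)) \<le> w\<^sup>2 * g" by (intro mult_left_mono) auto
    then show ?thesis by (simp only: mult.commute[of g])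
  qed
  finally show "(\<integral>\<^sup>+y. ennreal (exp (w * (y - \<mu>))) \<partial>p) \<le> ennreal (1 + g * w\<^sup>2)"
    by (simp add: ennreal_leI)
qed

text \<open>
  The defining property gives the joint law on measurable rectangles, which determine it.
\<close>

lemma nn_integral_cond_distr:
  fixes M :: "'w measure" and X :: "'w \<Rightarrow> real ^ 'd" and Y :: "'w \<Rightarrow> real"
  assumes "prob_space M" and [measurable]: "X \<in> borel_measurable M" "Y \<in> borel_measurable M"
    and P: "is_cond_distr M X Y P" and F: "F \<in> borel_measurable (borel \<Otimes>\<^sub>M borel)"
  shows "(\<integral>\<^sup>+\<omega>. F (X \<omega>, Y \<omega>) \<partial>M) = (\<integral>\<^sup>+x. \<integral>\<^sup>+y. F (x, y) \<partial>P x \<partial>distr M borel X)"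
proof -
  interpret M: prob_space M by fact
  let ?Q = "distr M borel X"
  interpret Q: prob_space ?Q by (rule M.prob_space_distr) simp
  let ?B = "borel \<Otimes>\<^sub>M borel :: ((real ^ 'd) \<times> real) measure"
  have Pm[measurable]: "P \<in> borel \<rightarrow>\<^sub>M prob_algebra borel" using P by (simp add: is_cond_distr_def)
  define N where "N = (\<lambda>x. distr (P x) ?B (Pair x))"
  have PsQ: "P \<in> ?Q \<rightarrow>\<^sub>M subprob_algebra borel" by (rule measurable_prob_algebraD) simp
  have N: "N \<in> ?Q \<rightarrow>\<^sub>M subprob_algebra ?B"
    unfolding N_def using PsQ by (intro measurable_distr2[where M = borel]) auto
  have setsP[measurable_cong]: "sets (P x) = sets borel" for x
    using measurable_space[OF Pm, of x] by (simp add: space_prob_algebra)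
  have bind: "(\<integral>\<^sup>+z. f z \<partial>(?Q \<bind> N)) = (\<integral>\<^sup>+x. \<integral>\<^sup>+y. f (x, y) \<partial>P x \<partial>?Q)"
    if [measurable]: "f \<in> borel_measurable ?B" for f
  proof -
    have "(\<integral>\<^sup>+z. f z \<partial>(?Q \<bind> N)) = (\<integral>\<^sup>+x. \<integral>\<^sup>+z. f z \<partial>N x \<partial>?Q)"
      by (rule nn_integral_bind[OF that N])
    also have "(\<lambda>x. \<integral>\<^sup>+z. f z \<partial>N x) = (\<lambda>x. \<integral>\<^sup>+y. f (x, y) \<partial>P x)"
      unfolding N_def by (intro ext nn_integral_distr) auto
    finally show ?thesis .
  qed
  have sb: "sets (?Q \<bind> N) = sets ?B" using N by (intro sets_bind) (auto dest: sets_kernel)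
  have "distr M ?B (\<lambda>\<omega>. (X \<omega>, Y \<omega>)) = ?Q \<bind> N"
  proof (rule measure_eqI_generator_eq)
    show "Int_stable {a \<times> b |a b. a \<in> sets (borel :: (real ^ 'd) measure) \<and> b \<in> sets (borel :: real measure)}"
      by (rule Int_stable_pair_measure_generator)
    show "sets (distr M ?B (\<lambda>\<omega>. (X \<omega>, Y \<omega>))) = sigma_sets UNIV {a \<times> b |a b. a \<in> sets borel \<and> b \<in> sets borel}"
      by (simp add: sets_pair_measure)
    show "sets (?Q \<bind> N) = sigma_sets UNIV {a \<times> b |a b. a \<in> sets borel \<and> b \<in> sets borel}"
      unfolding sb by (simp add: sets_pair_measure)
    show "range (\<lambda>i::nat. UNIV) \<subseteq> {a \<times> b |a b. a \<in> sets borel \<and> b \<in> sets borel}"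
      by (auto intro!: exI[of _ UNIV] simp: UNIV_Times_UNIV)
    show "emeasure (distr M ?B (\<lambda>\<omega>. (X \<omega>, Y \<omega>))) UNIV \<noteq> \<infinity>" for i :: nat
    proof -
      interpret D: prob_space "distr M ?B (\<lambda>\<omega>. (X \<omega>, Y \<omega>))" by (rule M.prob_space_distr) simp
      show ?thesis using D.emeasure_finite by simp
    qed
    fix Z assume "Z \<in> {a \<times> b |a b. a \<in> sets (borel :: (real ^ 'd) measure) \<and> b \<in> sets (borel :: real measure)}"
    then obtain a b where Z: "Z = a \<times> b" and [measurable]: "a \<in> sets borel" "b \<in> sets borel" by auto
    have "emeasure (distr M ?B (\<lambda>\<omega>. (X \<omega>, Y \<omega>))) Z = emeasure M {\<omega>\<in>space M. X \<omega> \<in> a \<and> Y \<omega> \<in> b}"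
      unfolding Z by (subst emeasure_distr) (auto intro!: arg_cong[where f = "emeasure M"])
    also have "\<dots> = (\<integral>\<^sup>+x\<in>a. emeasure (P x) b \<partial>?Q)" using P by (auto simp: is_cond_distr_def)
    also have "\<dots> = (\<integral>\<^sup>+x. \<integral>\<^sup>+y. indicator Z (x, y) \<partial>P x \<partial>?Q)"
    proof (intro nn_integral_cong)
      fix x
      have "(\<integral>\<^sup>+y. indicator Z (x, y) \<partial>P x) = (\<integral>\<^sup>+y. indicator b y * indicator a x \<partial>P x)"
        unfolding Z by (intro nn_integral_cong) (auto split: split_indicator)
      then show "emeasure (P x) b * indicator a x = (\<integral>\<^sup>+y. indicator Z (x, y) \<partial>P x)"
        by (simp add: nn_integral_multc)
    qed
    also have "\<dots> = (\<integral>\<^sup>+z. indicator Z z \<partial>(?Q \<bind> N))"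
      by (rule bind[symmetric]) (simp add: Z)
    also have "\<dots> = emeasure (?Q \<bind> N) Z"
      by (rule nn_integral_indicator) (simp add: sb Z)
    finally show "emeasure (distr M ?B (\<lambda>\<omega>. (X \<omega>, Y \<omega>))) Z = emeasure (?Q \<bind> N) Z" .
  qed auto
  then have "(\<integral>\<^sup>+z. F z \<partial>distr M ?B (\<lambda>\<omega>. (X \<omega>, Y \<omega>))) = (\<integral>\<^sup>+x. \<integral>\<^sup>+y. F (x, y) \<partial>P x \<partial>?Q)"
    using bind[OF F] by simp
  then show ?thesis using F by (simp add: nn_integral_distr)
qed

text \<open>
  By the Lindelof property the complement of the support is a countable union of open null sets.
\<close>

lemma AE_mem_msupport:
  fixes Q :: "(real ^ 'd) measure"
  assumes "sets Q = sets borel"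
  shows "AE x in Q. x \<in> msupport Q" and "closed (msupport Q)"
proof -
  define \<U> where "\<U> = {U :: (real ^ 'd) set. open U \<and> emeasure Q U = 0}"
  have eq: "- msupport Q = \<Union>\<U>" by (auto simp: msupport_def \<U>_def zero_less_iff_neq_zero)
  then show "closed (msupport Q)" unfolding closed_def eq by (auto simp: \<U>_def)
  obtain \<V> where V: "\<V> \<subseteq> \<U>" "countable \<V>" "\<Union>\<V> = \<Union>\<U>"
    using Lindelof[of \<U>] by (auto simp: \<U>_def)
  have "(\<Union>U\<in>\<V>. U) \<in> null_sets Q"
    using V assms by (intro null_sets_UN') (auto simp: \<U>_def null_sets_def)
  then show "AE x in Q. x \<in> msupport Q"
    using V(3) eq by (intro AE_I'[of "\<Union>U\<in>\<V>. U"]) auto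
qed


text \<open>
  The mean of the kernel, composed with \<open>X\<close>, satisfies the characterization of the conditional expectation.
  Positive and negative parts are treated separately, because the kernel formula is available for nonnegative
  functions only.
\<close>

lemma AE_cond_mean:
  fixes M :: "'w measure" and X :: "'w \<Rightarrow> real ^ 'd" and Y :: "'w \<Rightarrow> real"
  assumes "prob_space M" and [measurable]: "X \<in> borel_measurable M" "Y \<in> borel_measurable M"
    and P: "is_cond_distr M X Y P" and Y: "integrable M Y"
    and reg: "AE \<omega> in M. real_cond_exp M (vimage_algebra (space M) X borel) Y \<omega> = g (X \<omega>)"
    and [measurable]: "g \<in> borel_measurable borel"
  shows "AE x in distr M borel X. integrable (P x) (\<lambda>y. y) \<and> (\<integral>y. y \<partial>P x) = g x"
proof -
  interpret M: prob_space M by fact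
  let ?Q = "distr M borel X"
  let ?F = "vimage_algebra (space M) X borel"
  interpret Q: prob_space ?Q by (rule M.prob_space_distr) simp
  have sub: "subalgebra M ?F"
    unfolding subalgebra_def using measurable_sets[of X M borel] by (auto simp: sets_vimage_algebra2)
  interpret F: finite_measure_subalgebra M ?F by standard (rule sub)
  have [measurable]: "P \<in> borel \<rightarrow>\<^sub>M subprob_algebra borel"
    using P by (auto simp: is_cond_distr_def intro: measurable_prob_algebraD)
  have [measurable_cong]: "sets (P x) = sets borel" for x
    by (rule sets_kernel[of P borel borel x]) auto
  note kernel = nn_integral_cond_distr[OF \<open>prob_space M\<close> \<open>X \<in> _\<close> \<open>Y \<in> _\<close> P]
  define mp where "mp x = (\<integral>\<^sup>+y. ennreal y \<partial>P x)" for x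
  define mn where "mn x = (\<integral>\<^sup>+y. ennreal (- y) \<partial>P x)" for x
  have [measurable]: "mp \<in> borel_measurable borel" "mn \<in> borel_measurable borel"
    unfolding mp_def[abs_def] mn_def[abs_def]
    by (rule nn_integral_measurable_subprob_algebra2[where N = borel]; measurable)+
  have kp: "(\<integral>\<^sup>+\<omega>. indicator B (X \<omega>) * ennreal (Y \<omega>) \<partial>M) = (\<integral>\<^sup>+x. indicator B x * mp x \<partial>?Q)"
    if [measurable]: "B \<in> sets borel" for B
    using kernel[of "\<lambda>(x, y). indicator B x * ennreal y"] by (simp add: nn_integral_cmult mp_def)
  have kn: "(\<integral>\<^sup>+\<omega>. indicator B (X \<omega>) * ennreal (- Y \<omega>) \<partial>M) = (\<integral>\<^sup>+x. indicator B x * mn x \<partial>?Q)"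
    if [measurable]: "B \<in> sets borel" for B
    using kernel[of "\<lambda>(x, y). indicator B x * ennreal (- y)"] by (simp add: nn_integral_cmult mn_def)
  have fin: "(\<integral>\<^sup>+x. mp x \<partial>?Q) < \<infinity>" "(\<integral>\<^sup>+x. mn x \<partial>?Q) < \<infinity>"
    using kp[of UNIV] kn[of UNIV] Y unfolding real_integrable_def by (simp_all add: less_top)
  have fin': "AE x in ?Q. mp x \<noteq> \<infinity>" "AE x in ?Q. mn x \<noteq> \<infinity>"
    using fin by (intro nn_integral_PInf_AE; simp)+
  define mean where "mean x = enn2real (mp x) - enn2real (mn x)" for x
  have [measurable]: "mean \<in> borel_measurable borel" unfolding mean_def[abs_def] by measurable
  have nn_real: "(\<integral>\<^sup>+x. ennreal (indicator B x * enn2real (m x)) \<partial>?Q) = (\<integral>\<^sup>+x. indicator B x * m x \<partial>?Q)"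
    if "AE x in ?Q. m x \<noteq> \<infinity>" for m B
    using that by (intro nn_integral_cong_AE) (auto split: split_indicator simp: less_top)
  have int_part: "integrable ?Q (\<lambda>x. indicator B x * enn2real (m x))"
    if [measurable]: "m \<in> borel_measurable borel" "B \<in> sets borel"
      and m: "(\<integral>\<^sup>+x. m x \<partial>?Q) < \<infinity>" "AE x in ?Q. m x \<noteq> \<infinity>" for m B
  proof (rule integrableI_nonneg)
    have "(\<integral>\<^sup>+x. indicator B x * m x \<partial>?Q) \<le> (\<integral>\<^sup>+x. m x \<partial>?Q)"
      by (intro nn_integral_mono) (auto split: split_indicator)
    then show "(\<integral>\<^sup>+x. ennreal (indicator B x * enn2real (m x)) \<partial>?Q) < \<infinity>"
      using m(1) by (subst nn_real[OF m(2)]) (rule le_less_trans)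
  qed auto
  have eq_part: "(\<integral>x. indicator B x * enn2real (m x) \<partial>?Q) = enn2real (\<integral>\<^sup>+x. indicator B x * m x \<partial>?Q)"
    if [measurable]: "m \<in> borel_measurable borel" "B \<in> sets borel"
      and m: "AE x in ?Q. m x \<noteq> \<infinity>" for m B
    by (subst integral_eq_nn_integral) (auto simp: nn_real[OF m])
  have int_mean: "integrable ?Q (\<lambda>x. indicator B x * mean x)" if [measurable]: "B \<in> sets borel" for B
  proof -
    have "integrable ?Q (\<lambda>x. indicator B x * enn2real (mp x) - indicator B x * enn2real (mn x))"
      by (intro Bochner_Integration.integrable_diff int_part fin fin') auto
    then show ?thesis by (simp add: mean_def right_diff_distrib)
  qed
  have "AE \<omega> in M. real_cond_exp M ?F Y \<omega> = mean (X \<omega>)"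
  proof (rule F.real_cond_exp_charact)
    show "integrable M Y" by fact
    show "integrable M (\<lambda>\<omega>. mean (X \<omega>))"
      using int_mean[of UNIV] by (simp add: integrable_distr_eq)
    have "X \<in> ?F \<rightarrow>\<^sub>M borel" by (rule measurable_vimage_algebra1) auto
    then show "(\<lambda>\<omega>. mean (X \<omega>)) \<in> borel_measurable ?F" by simp
    fix A assume "A \<in> sets ?F"
    then obtain B where [measurable]: "B \<in> sets borel" and A: "A = X -` B \<inter> space M"
      by (auto simp: sets_vimage_algebra2)
    have ind: "indicat_real A \<omega> = indicator B (X \<omega>)" if "\<omega> \<in> space M" for \<omega>
      using that by (auto simp: A split: split_indicator)
    have iY: "integrable M (\<lambda>\<omega>. indicator B (X \<omega>) * Y \<omega>)"
      using Y by (rule Bochner_Integration.integrable_bound) (auto split: split_indicator)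
    have "(\<integral>\<omega>\<in>A. Y \<omega> \<partial>M) = (\<integral>\<omega>. indicator B (X \<omega>) * Y \<omega> \<partial>M)"
      unfolding set_lebesgue_integral_def by (intro Bochner_Integration.integral_cong) (auto simp: ind)
    also have "\<dots> = enn2real (\<integral>\<^sup>+\<omega>. indicator B (X \<omega>) * ennreal (Y \<omega>) \<partial>M)
        - enn2real (\<integral>\<^sup>+\<omega>. indicator B (X \<omega>) * ennreal (- Y \<omega>) \<partial>M)"
      unfolding real_lebesgue_integral_def[OF iY]
      by (intro arg_cong2[where f = "(-)"] arg_cong[where f = enn2real] nn_integral_cong)
        (auto split: split_indicator)
    also have "\<dots> = (\<integral>x. indicator B x * enn2real (mp x) \<partial>?Q) - (\<integral>x. indicator B x * enn2real (mn x) \<partial>?Q)"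
      using fin' by (simp add: kp kn eq_part)
    also have "\<dots> = (\<integral>x. indicator B x * mean x \<partial>?Q)"
      unfolding mean_def right_diff_distrib
      by (intro Bochner_Integration.integral_diff[symmetric] int_part fin fin') auto
    also have "\<dots> = (\<integral>\<omega>. indicator B (X \<omega>) * mean (X \<omega>) \<partial>M)"
      by (subst integral_distr) auto
    also have "\<dots> = (\<integral>\<omega>\<in>A. mean (X \<omega>) \<partial>M)"
      unfolding set_lebesgue_integral_def by (intro Bochner_Integration.integral_cong) (auto simp: ind)
    finally show "(\<integral>\<omega>\<in>A. Y \<omega> \<partial>M) = (\<integral>\<omega>\<in>A. mean (X \<omega>) \<partial>M)" .
  qed
  with reg have "AE \<omega> in M. mean (X \<omega>) = g (X \<omega>)" by eventually_elim simp
  then have "AE x in ?Q. mean x = g x" by (subst AE_distr_iff) auto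
  with fin' show ?thesis
  proof eventually_elim
    case (elim x)
    have "integrable (P x) (\<lambda>y. y)"
      unfolding real_integrable_def using elim by (simp add: mp_def mn_def)
    then show ?case using elim by (simp add: real_lebesgue_integral_def mean_def mp_def mn_def)
  qed
qed

lemma distributed_slab_measure_le:
  fixes Z :: "'w \<Rightarrow> real"
  assumes "prob_space M" and D: "distributed M lborel Z (\<lambda>t. ennreal (f t))"
    and A[measurable]: "A \<in> sets borel" and ZA: "AE \<omega> in M. Z \<omega> \<in> A"
    and f: "\<And>t. t \<in> A \<Longrightarrow> f t \<le> q" and ab: "a \<le> b" and q: "0 \<le> q"
  shows "measure M {\<omega>\<in>space M. a \<le> Z \<omega> \<and> Z \<omega> \<le> b} \<le> q * (b - a)"
proof -
  interpret prob_space M by fact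
  have [measurable]: "Z \<in> borel_measurable M" using distributed_measurable[OF D] by simp
  have [measurable]: "(\<lambda>t. ennreal (f t)) \<in> borel_measurable borel"
    using distributed_borel_measurable[OF D] by simp
  have "emeasure M {\<omega>\<in>space M. a \<le> Z \<omega> \<and> Z \<omega> \<le> b} = emeasure M (Z -` ({a..b} \<inter> A) \<inter> space M)"
    using ZA by (intro emeasure_eq_AE) auto
  also have "\<dots> = (\<integral>\<^sup>+t. ennreal (f t) * indicator ({a..b} \<inter> A) t \<partial>lborel)"
    by (rule distributed_emeasure[OF D]) simp
  also have "\<dots> \<le> (\<integral>\<^sup>+t. ennreal q * indicator {a..b} t \<partial>lborel)"
    using f by (intro nn_integral_mono) (auto split: split_indicator intro!: ennreal_leI)
  also have "\<dots> = ennreal (q * (b - a))"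
    using ab q by (simp add: nn_integral_cmult ennreal_mult')
  finally show ?thesis using ab q by (simp add: emeasure_eq_measure)
qed

section \<open>Elementary inequalities and cells\<close>

text \<open>
  The affine image of \<open>\<beta> \<bullet> x\<close> that takes the ball of radius \<open>R\<close> into the unit interval.
\<close>

definition pos :: "real \<Rightarrow> real ^ 'd \<Rightarrow> real ^ 'd \<Rightarrow> real" where
  "pos R \<beta> x = (\<beta> \<bullet> x + R) / (2 * R)"

definition cell :: "real \<Rightarrow> real ^ 'd \<Rightarrow> nat \<Rightarrow> real ^ 'd \<Rightarrow> nat" where
  "cell R \<beta> m x = nat \<lfloor>real m * pos R \<beta> x\<rfloor>"

lemma measurable_pos[measurable]: "pos R \<beta> \<in> borel_measurable borel"
  unfolding pos_def[abs_def] by measurable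

lemma measurable_cell[measurable]: "cell R \<beta> m \<in> borel \<rightarrow>\<^sub>M count_space UNIV"
  unfolding cell_def[abs_def] by measurable

lemma exp_minus_le_half: "0 \<le> z \<Longrightarrow> z \<le> 1 \<Longrightarrow> exp (- z) \<le> 1 - z / 2" for z :: real
proof -
  assume z: "0 \<le> z" "z \<le> 1"
  have "z * z \<le> z * 1" using z by (intro mult_left_mono) auto
  then have "1 \<le> (1 + z) * (1 - z / 2)" by (simp add: algebra_simps)
  also have "\<dots> \<le> exp z * (1 - z / 2)" using z by (intro mult_right_mono) auto
  finally show "exp (- z) \<le> 1 - z / 2" by (simp add: exp_minus field_simps)
qed

text \<open>
  The left-hand side is the largest of the three exponentials. Writing an excess as a maximum over signs
  turns the exponential of a sum of excesses into a sum of exponentials of linear functions.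
\<close>

lemma exp_excess_le:
  fixes s A b :: real assumes "0 \<le> b"
  shows "exp (b * max 0 (\<bar>s\<bar> - A)) \<le> (\<Sum>t\<in>{-1, 0, 1}. exp (b * (t * s - A * \<bar>t\<bar>)))"
proof -
  consider "\<bar>s\<bar> \<le> A" | "\<bar>s\<bar> > A" "s \<ge> 0" | "\<bar>s\<bar> > A" "s < 0" by linarith
  then show ?thesis by cases (auto simp: max_def add_nonneg_nonneg)
qed

lemma sum_shift3_le:
  fixes v :: "nat \<Rightarrow> real"
  assumes "\<And>a. \<bar>v a\<bar> \<le> K"
  shows "(\<Sum>b<m. v (b + 3) - v b) \<le> 6 * K"
proof -
  have "(\<Sum>b<m. v (b + 3) - v b) = v m + v (m + 1) + v (m + 2) - v 0 - v 1 - v 2"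
    by (induction m) (auto simp: numeral_eq_Suc)
  then show ?thesis using assms[of m] assms[of "m + 1"] assms[of "m + 2"] assms[of 0] assms[of 1] assms[of 2]
    by linarith
qed

text \<open>
  The Cauchy-Schwarz inequality with geometric weights \<open>(4/5) ^ k\<close>, whose sum is at most \<open>5\<close>.
\<close>

lemma sum_weighted_square_le:
  fixes r :: "nat \<Rightarrow> real"
  shows "(\<Sum>k\<le>J. r k)\<^sup>2 \<le> 5 * (\<Sum>k\<le>J. (5/4) ^ k * (r k)\<^sup>2)"
proof -
  define a where "a k = sqrt ((4/5) ^ k)" for k :: nat
  have a: "a k > 0" "(a k)\<^sup>2 = (4/5) ^ k" for k by (auto simp: a_def)
  have s: "(\<Sum>k<n. (4/5 :: real) ^ k) \<le> 5" for n
  proof -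
    have "(\<Sum>k<n. (4/5 :: real) ^ k) = 5 - 5 * (4/5) ^ n" by (induction n) auto
    then show ?thesis by simp
  qed
  have "(\<Sum>k\<le>J. r k)\<^sup>2 = (\<Sum>k\<le>J. a k * (r k / a k))\<^sup>2"
    using a(1) by (simp add: less_imp_neq[symmetric])
  also have "\<dots> \<le> (\<Sum>k\<le>J. (a k)\<^sup>2) * (\<Sum>k\<le>J. (r k / a k)\<^sup>2)"
    by (rule Cauchy_Schwarz_ineq_sum)
  also have "(\<Sum>k\<le>J. (r k / a k)\<^sup>2) = (\<Sum>k\<le>J. (5/4) ^ k * (r k)\<^sup>2)"
  proof (intro sum.cong refl)
    fix k
    have "(5/4 :: real) ^ k * (4/5) ^ k = 1" by (simp flip: power_mult_distrib)
    then show "(r k / a k)\<^sup>2 = (5/4) ^ k * (r k)\<^sup>2"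
      unfolding power_divide a(2) by (simp add: field_simps)
  qed
  also have "(\<Sum>k\<le>J. (a k)\<^sup>2) * (\<Sum>k\<le>J. (5/4) ^ k * (r k)\<^sup>2) \<le> 5 * (\<Sum>k\<le>J. (5/4) ^ k * (r k)\<^sup>2)"
    using s[of "Suc J"] by (intro mult_right_mono sum_nonneg) (auto simp: a lessThan_Suc_atMost)
  finally show ?thesis .
qed

lemma geometric_sum_le:
  fixes x :: real assumes "0 \<le> x" "x < 1"
  shows "(\<Sum>k\<le>J. x ^ k) \<le> 1 / (1 - x)"
proof -
  have "(\<Sum>k\<le>J. x ^ k) \<le> (\<Sum>k. x ^ k)"
    using assms by (intro sum_le_suminf summable_geometric) auto
  then show ?thesis using assms by (simp add: suminf_geometric)
qed

text \<open>
  This is how the two bounds on the rounding remainders are used: the bound on their sum against the part of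
  \<open>\<bar>S a\<bar>\<close> below \<open>A\<close>, the pointwise bound against the excess over \<open>A\<close>.
\<close>

lemma sum_excess_le:
  fixes r S :: "'a \<Rightarrow> real"
  assumes B: "finite B" and r: "\<And>a. a \<in> B \<Longrightarrow> 0 \<le> r a" "\<And>a. a \<in> B \<Longrightarrow> r a \<le> t" and A: "0 \<le> A" and s: "(\<Sum>a\<in>B. r a) \<le> s"
  shows "(\<Sum>a\<in>B. r a * S a) \<le> A * s + t * (\<Sum>a\<in>B. max 0 (\<bar>S a\<bar> - A))"
proof -
  have "(\<Sum>a\<in>B. r a * S a) \<le> (\<Sum>a\<in>B. A * r a + t * max 0 (\<bar>S a\<bar> - A))"
  proof (intro sum_mono)
    fix a assume a: "a \<in> B"
    have "r a * S a \<le> r a * (A + max 0 (\<bar>S a\<bar> - A))" using r[OF a] by (intro mult_left_mono) auto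
    also have "\<dots> \<le> A * r a + t * max 0 (\<bar>S a\<bar> - A)"
      using mult_right_mono[OF r(2)[OF a], of "max 0 (\<bar>S a\<bar> - A)"] by (simp add: algebra_simps)
    finally show "r a * S a \<le> A * r a + t * max 0 (\<bar>S a\<bar> - A)" .
  qed
  also have "\<dots> = A * (\<Sum>a\<in>B. r a) + t * (\<Sum>a\<in>B. max 0 (\<bar>S a\<bar> - A))"
    by (simp add: sum.distrib sum_distrib_left)
  also have "\<dots> \<le> A * s + t * (\<Sum>a\<in>B. max 0 (\<bar>S a\<bar> - A))" using A s by (simp add: mult_left_mono)
  finally show ?thesis .
qed

section \<open>Exponential inequalities for the sample\<close>

text \<open>
  The form in which the distributional assumptions are used. The kernel \<open>P\<close> yields conditional
  exponential moments of the noise \<open>y - g0 x\<close>, and the density bound yields the mass of a slab orthogonal to a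
  direction.
\<close>

locale index_sample = prob_space M for M :: "'w measure" +
  fixes Xs :: "nat \<Rightarrow> 'w \<Rightarrow> real ^ 'd" and Ys :: "nat \<Rightarrow> 'w \<Rightarrow> real"
    and Q :: "(real ^ 'd) measure" and P :: "real ^ 'd \<Rightarrow> real measure"
    and XX :: "(real ^ 'd) set" and g0 :: "real ^ 'd \<Rightarrow> real" and R c K0 l \<gamma> :: real
  assumes indep: "indep_vars (\<lambda>_. borel \<Otimes>\<^sub>M borel) (\<lambda>i \<omega>. (Xs i \<omega>, Ys i \<omega>)) {1..}"
    and law: "\<And>i F. i \<ge> 1 \<Longrightarrow> F \<in> borel_measurable (borel \<Otimes>\<^sub>M borel) \<Longrightarrow>
      (\<integral>\<^sup>+\<omega>. F (Xs i \<omega>, Ys i \<omega>) \<partial>M) = (\<integral>\<^sup>+x. \<integral>\<^sup>+y. F (x, y) \<partial>P x \<partial>Q)"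
    and prob_space_Q: "prob_space Q" and sets_Q[measurable_cong]: "sets Q = sets borel"
    and kernel: "P \<in> borel \<rightarrow>\<^sub>M prob_algebra borel"
    and XX[measurable]: "XX \<in> sets borel" and AE_XX: "AE x in Q. x \<in> XX"
    and noise: "AE x in Q. (\<integral>\<^sup>+y. ennreal (exp (l * \<bar>y - g0 x\<bar>)) \<partial>P x) \<le> ennreal \<gamma> \<and>
      (\<forall>w. \<bar>w\<bar> \<le> l / 2 \<longrightarrow> (\<integral>\<^sup>+y. ennreal (exp (w * (y - g0 x))) \<partial>P x) \<le> ennreal (1 + \<gamma> * w\<^sup>2))"
    and g0[measurable]: "g0 \<in> borel_measurable borel"
    and g0_bound: "\<And>x. x \<in> XX \<Longrightarrow> \<bar>g0 x\<bar> \<le> K0" and norm_less: "\<And>x. x \<in> XX \<Longrightarrow> norm x < R"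
    and slab: "\<And>\<beta> a b. \<beta> \<in> sphere 0 1 \<Longrightarrow> a \<le> b \<Longrightarrow>
      measure Q {x. a \<le> pos R \<beta> x \<and> pos R \<beta> x \<le> b} \<le> c * (b - a)"
    and constants: "0 < R" "0 < c" "0 < K0" "0 < l" "1 \<le> \<gamma>"
begin

sublocale Q: prob_space Q by (rule prob_space_Q)

lemma space_Q[simp]: "space Q = UNIV" using sets_eq_imp_space_eq[OF sets_Q] by simp

lemma integrable_indicator_Q: "A \<in> sets borel \<Longrightarrow> integrable Q (indicat_real A)"
  by (rule Q.integrable_const_bound[of _ 1]) auto

lemma Xs_Ys_measurable[measurable (raw)]:
  assumes "i \<ge> 1" shows "Xs i \<in> borel_measurable M" "Ys i \<in> borel_measurable M"
proof -
  have "(\<lambda>\<omega>. (Xs i \<omega>, Ys i \<omega>)) \<in> M \<rightarrow>\<^sub>M borel \<Otimes>\<^sub>M borel"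
    using indep assms by (auto simp: indep_vars_def)
  from measurable_fst'[OF this] measurable_snd'[OF this]
  show "Xs i \<in> borel_measurable M" "Ys i \<in> borel_measurable M" by simp_all
qed

lemma sets_P[measurable_cong]: "sets (P x) = sets borel"
  using measurable_space[OF kernel, of x] by (simp add: space_prob_algebra)

lemma prob_space_P: "prob_space (P x)"
  using measurable_space[OF kernel, of x] by (simp add: space_prob_algebra)

definition res :: "nat \<Rightarrow> 'w \<Rightarrow> real" where "res i \<omega> = Ys i \<omega> - g0 (Xs i \<omega>)"

lemma res_measurable[measurable (raw)]: "i \<ge> 1 \<Longrightarrow> res i \<in> borel_measurable M"
  unfolding res_def[abs_def] using Xs_Ys_measurable[of i] by measurable

lemma mgf_sample:
  assumes [measurable]: "case_prod h \<in> borel_measurable (borel \<Otimes>\<^sub>M borel)"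
  shows "(\<integral>\<^sup>+\<omega>. ennreal (exp (\<Sum>i=1..n. h (Xs i \<omega>) (Ys i \<omega>))) \<partial>M)
      = (\<integral>\<^sup>+x. \<integral>\<^sup>+y. ennreal (exp (h x y)) \<partial>P x \<partial>Q) ^ n"
proof -
  have ind: "indep_vars (\<lambda>_. borel) (\<lambda>i \<omega>. ennreal (exp (case_prod h (Xs i \<omega>, Ys i \<omega>)))) {1..n}"
    by (rule indep_vars_compose2[OF indep_vars_subset[OF indep]]) auto
  have "(\<integral>\<^sup>+\<omega>. ennreal (exp (\<Sum>i=1..n. h (Xs i \<omega>) (Ys i \<omega>))) \<partial>M)
      = (\<integral>\<^sup>+\<omega>. (\<Prod>i=1..n. ennreal (exp (case_prod h (Xs i \<omega>, Ys i \<omega>)))) \<partial>M)"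
    by (simp add: exp_sum prod_ennreal)
  also have "\<dots> = (\<Prod>i=1..n. \<integral>\<^sup>+\<omega>. ennreal (exp (case_prod h (Xs i \<omega>, Ys i \<omega>))) \<partial>M)"
    by (rule indep_vars_nn_integral[OF _ ind]) auto
  also have "\<dots> = (\<Prod>i=1..n. \<integral>\<^sup>+x. \<integral>\<^sup>+y. ennreal (exp (h x y)) \<partial>P x \<partial>Q)"
  proof (intro prod.cong refl)
    fix i assume "i \<in> {1..n}"
    then show "(\<integral>\<^sup>+\<omega>. ennreal (exp (case_prod h (Xs i \<omega>, Ys i \<omega>))) \<partial>M)
      = (\<integral>\<^sup>+x. \<integral>\<^sup>+y. ennreal (exp (h x y)) \<partial>P x \<partial>Q)"
      by (subst law[where F = "\<lambda>z. ennreal (exp (case_prod h z))"]) auto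
  qed
  finally show ?thesis by simp
qed

text \<open>
  Independence turns the exponential moment of the sum into a power, and \<open>1 + m \<le> exp m\<close>. Here \<open>b\<close> bounds the
  excess over \<open>1\<close> of the exponential moment conditionally on the covariate.
\<close>

lemma mgf_sample_le:
  assumes h[measurable]: "case_prod h \<in> borel_measurable (borel \<Otimes>\<^sub>M borel)"
    and b: "integrable Q b" "\<And>x. - 1 \<le> b x" "(\<integral>x. b x \<partial>Q) \<le> m"
    and le: "AE x in Q. (\<integral>\<^sup>+y. ennreal (exp (h x y)) \<partial>P x) \<le> ennreal (1 + b x)"
  shows "(\<integral>\<^sup>+\<omega>. ennreal (exp (\<Sum>i=1..n. h (Xs i \<omega>) (Ys i \<omega>))) \<partial>M) \<le> ennreal (exp (real n * m))"
proof -
  have "(\<integral>\<^sup>+x. \<integral>\<^sup>+y. ennreal (exp (h x y)) \<partial>P x \<partial>Q) \<le> (\<integral>\<^sup>+x. ennreal (1 + b x) \<partial>Q)"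
    by (rule nn_integral_mono_AE[OF le])
  also have "\<dots> = ennreal (\<integral>x. 1 + b x \<partial>Q)"
  proof (intro nn_integral_eq_integral AE_I2)
    show "0 \<le> 1 + b x" for x using b(2)[of x] by linarith
  qed (use b in auto)
  also have "(\<integral>x. 1 + b x \<partial>Q) = 1 + (\<integral>x. b x \<partial>Q)" using b Q.prob_space by simp
  also have "ennreal (1 + (\<integral>x. b x \<partial>Q)) \<le> ennreal (exp m)"
  proof (rule ennreal_leI)
    have "1 + (\<integral>x. b x \<partial>Q) \<le> 1 + m" using b by simp
    also have "\<dots> \<le> exp m" by (rule exp_ge_add_one_self)
    finally show "1 + (\<integral>x. b x \<partial>Q) \<le> exp m" .
  qed
  finally have "(\<integral>\<^sup>+x. \<integral>\<^sup>+y. ennreal (exp (h x y)) \<partial>P x \<partial>Q) ^ n \<le> ennreal (exp m) ^ n"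
    by (rule power_mono) simp
  then show ?thesis unfolding mgf_sample[OF h] by (simp add: ennreal_power exp_of_nat_mult)
qed

lemma exponential_Markov:
  fixes Z :: "'w \<Rightarrow> real"
  assumes [measurable]: "Z \<in> borel_measurable M" and "(\<integral>\<^sup>+\<omega>. ennreal (exp (Z \<omega>)) \<partial>M) \<le> ennreal (exp m)"
  shows "emeasure M {\<omega>\<in>space M. m + u \<le> Z \<omega>} \<le> ennreal (exp (- u))"
proof -
  have "emeasure M {\<omega>\<in>space M. m + u \<le> Z \<omega>}
      = emeasure M {\<omega>\<in>space M. 1 \<le> ennreal (exp (- (m + u))) * ennreal (exp (Z \<omega>))}"
  proof (intro arg_cong[where f = "emeasure M"] Collect_cong conj_cong refl)
    fix \<omega>
    have "ennreal (exp (- (m + u))) * ennreal (exp (Z \<omega>)) = ennreal (exp (Z \<omega> - (m + u)))"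
      by (simp add: algebra_simps flip: ennreal_mult' exp_add)
    then show "m + u \<le> Z \<omega> \<longleftrightarrow> 1 \<le> ennreal (exp (- (m + u))) * ennreal (exp (Z \<omega>))" by simp
  qed
  also have "\<dots> \<le> ennreal (exp (- (m + u))) * (\<integral>\<^sup>+\<omega>. ennreal (exp (Z \<omega>)) * indicator (space M) \<omega> \<partial>M)"
    by (intro nn_integral_Markov_inequality) auto
  also have "(\<integral>\<^sup>+\<omega>. ennreal (exp (Z \<omega>)) * indicator (space M) \<omega> \<partial>M) = (\<integral>\<^sup>+\<omega>. ennreal (exp (Z \<omega>)) \<partial>M)"
    by (intro nn_integral_cong) auto
  also have "ennreal (exp (- (m + u))) * (\<integral>\<^sup>+\<omega>. ennreal (exp (Z \<omega>)) \<partial>M) \<le> ennreal (exp (- (m + u))) * ennreal (exp m)"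
    by (intro mult_left_mono assms) simp
  also have "\<dots> = ennreal (exp (- u))" by (simp flip: ennreal_mult' exp_add)
  finally show ?thesis .
qed

lemma Chernoff:
  assumes h[measurable]: "case_prod h \<in> borel_measurable (borel \<Otimes>\<^sub>M borel)"
    and b: "integrable Q b" "\<And>x. - 1 \<le> b x" "(\<integral>x. b x \<partial>Q) \<le> m"
    and le: "AE x in Q. (\<integral>\<^sup>+y. ennreal (exp (h x y)) \<partial>P x) \<le> ennreal (1 + b x)"
  shows "emeasure M {\<omega>\<in>space M. real n * m + u \<le> (\<Sum>i=1..n. h (Xs i \<omega>) (Ys i \<omega>))} \<le> ennreal (exp (- u))"
  by (rule exponential_Markov[OF _ mgf_sample_le[OF assms]]) measurable

text \<open>
  Given the covariate \<open>x\<close>, the noise contributes at most \<open>1 + 4 * \<gamma> * (r * f x)\<^sup>2\<close> to the exponential moment,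
  which for small \<open>r\<close> is dominated by the factor \<open>exp (- r * (f x)\<^sup>2 / 2)\<close>. What remains of this factor
  produces the negative drift, proportional to \<open>n\<close> times the squared norm of \<open>f\<close>. Because of this drift no
  localization of the function class is required.
\<close>

lemma Chernoff_regression:
  assumes f[measurable]: "f \<in> borel_measurable borel" and F: "\<And>x. x \<in> XX \<Longrightarrow> \<bar>f x\<bar> \<le> F"
    and r: "0 < r" "4 * r * F \<le> l" "16 * \<gamma> * r \<le> 1" "r * F\<^sup>2 \<le> 4"
  shows "emeasure M {\<omega>\<in>space M. - (real n * (r / 8) * (\<integral>x. (f x)\<^sup>2 \<partial>Q)) + u
      \<le> (\<Sum>i=1..n. r * (2 * res i \<omega> * f (Xs i \<omega>) - (f (Xs i \<omega>))\<^sup>2 / 2))} \<le> ennreal (exp (- u))"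
proof -
  define b where "b x = - (r / 8) * (indicator XX x * (f x)\<^sup>2)" for x
  have bd: "indicator XX x * (f x)\<^sup>2 \<le> F\<^sup>2" for x
    using F[of x] abs_le_square_iff[of "f x" F] by (auto split: split_indicator)
  have ib: "integrable Q (\<lambda>x. indicator XX x * (f x)\<^sup>2)"
    using bd by (intro Q.integrable_const_bound[of _ "F\<^sup>2"]) auto
  have eq: "(\<integral>x. (f x)\<^sup>2 \<partial>Q) = (\<integral>x. indicator XX x * (f x)\<^sup>2 \<partial>Q)"
    using AE_XX by (intro integral_cong_AE) auto
  have "emeasure M {\<omega>\<in>space M. real n * (- (r / 8) * (\<integral>x. (f x)\<^sup>2 \<partial>Q)) + u
      \<le> (\<Sum>i=1..n. (\<lambda>x y. r * (2 * (y - g0 x) * f x - (f x)\<^sup>2 / 2)) (Xs i \<omega>) (Ys i \<omega>))} \<le> ennreal (exp (- u))"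
  proof (rule Chernoff[where b = b])
    show "integrable Q b" unfolding b_def using ib by (intro integrable_mult_right) auto
    show "(\<integral>x. b x \<partial>Q) \<le> - (r / 8) * (\<integral>x. (f x)\<^sup>2 \<partial>Q)" by (simp add: b_def eq)
    fix x
    have "r * (indicator XX x * (f x)\<^sup>2) \<le> r * F\<^sup>2" using r(1) bd by (intro mult_left_mono) auto
    then show "- 1 \<le> b x" using r(4) unfolding b_def by linarith
  next
    show "AE x in Q. (\<integral>\<^sup>+y. ennreal (exp (r * (2 * (y - g0 x) * f x - (f x)\<^sup>2 / 2))) \<partial>P x) \<le> ennreal (1 + b x)"
      using noise AE_XX
    proof eventually_elim
      case (elim x)
      note fx = F[OF elim(2)]
      define w where "w = 2 * r * f x"
      have "\<bar>w\<bar> \<le> l / 2"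
      proof -
        have "\<bar>w\<bar> = 2 * r * \<bar>f x\<bar>" using r by (simp add: w_def abs_mult)
        also have "\<dots> \<le> 2 * r * F" using fx r by (intro mult_left_mono) auto
        finally show ?thesis using r by linarith
      qed
      with elim have n: "(\<integral>\<^sup>+y. ennreal (exp (w * (y - g0 x))) \<partial>P x) \<le> ennreal (1 + \<gamma> * w\<^sup>2)" by blast
      have "(\<integral>\<^sup>+y. ennreal (exp (r * (2 * (y - g0 x) * f x - (f x)\<^sup>2 / 2))) \<partial>P x)
          = (\<integral>\<^sup>+y. ennreal (exp (- (r * (f x)\<^sup>2 / 2))) * ennreal (exp (w * (y - g0 x))) \<partial>P x)"
        by (intro nn_integral_cong) (simp add: w_def algebra_simps flip: ennreal_mult' exp_add)
      also have "\<dots> = ennreal (exp (- (r * (f x)\<^sup>2 / 2))) * (\<integral>\<^sup>+y. ennreal (exp (w * (y - g0 x))) \<partial>P x)"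
        by (intro nn_integral_cmult) simp
      also have "\<dots> \<le> ennreal (exp (- (r * (f x)\<^sup>2 / 2))) * ennreal (1 + \<gamma> * w\<^sup>2)"
        by (intro mult_left_mono n) simp
      also have "\<dots> = ennreal (exp (- (r * (f x)\<^sup>2 / 2)) * (1 + \<gamma> * w\<^sup>2))"
        by (simp add: ennreal_mult')
      also have "\<dots> \<le> ennreal (1 + b x)"
      proof (rule ennreal_leI)
        have "exp (- (r * (f x)\<^sup>2 / 2)) * (1 + \<gamma> * w\<^sup>2) \<le> exp (- (r * (f x)\<^sup>2 / 2)) * exp (\<gamma> * w\<^sup>2)"
          by (intro mult_left_mono exp_ge_add_one_self) simp
        also have "\<dots> = exp (\<gamma> * w\<^sup>2 - r * (f x)\<^sup>2 / 2)" by (simp flip: exp_add)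
        also have "\<dots> \<le> exp (- (r * (f x)\<^sup>2 / 4))"
        proof -
          have "16 * \<gamma> * r * (r * (f x)\<^sup>2) \<le> 1 * (r * (f x)\<^sup>2)" using r by (intro mult_right_mono) auto
          then have "\<gamma> * w\<^sup>2 \<le> r * (f x)\<^sup>2 / 4" by (simp add: w_def power2_eq_square algebra_simps)
          then show ?thesis by simp
        qed
        also have "\<dots> \<le> 1 - (r * (f x)\<^sup>2 / 4) / 2"
        proof (rule exp_minus_le_half)
          have "(f x)\<^sup>2 \<le> F\<^sup>2" using bd[of x] elim by simp
          then have "r * (f x)\<^sup>2 \<le> r * F\<^sup>2" using r by (intro mult_left_mono) auto
          then show "r * (f x)\<^sup>2 / 4 \<le> 1" using r by linarith
        qed (use r in auto)
        also have "\<dots> = 1 + b x" using elim by (simp add: b_def)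
        finally show "exp (- (r * (f x)\<^sup>2 / 2)) * (1 + \<gamma> * w\<^sup>2) \<le> 1 + b x" .
      qed
      finally show ?case .
    qed
  qed measurable
  then show ?thesis by (simp add: res_def algebra_simps)
qed

lemma Chernoff_count:
  assumes C[measurable]: "C \<in> sets borel" and p: "measure Q C \<le> p"
  shows "emeasure M {\<omega>\<in>space M. real n * (2 * p) + u \<le> (\<Sum>i=1..n. indicator C (Xs i \<omega>))} \<le> ennreal (exp (- u))"
proof (rule Chernoff[where b = "\<lambda>x. 2 * indicator C x" and h = "\<lambda>x y. indicator C x"])
  have e: "exp 1 \<le> (3 :: real)" using exp_le by simp
  have "(\<integral>\<^sup>+y. ennreal (exp (indicat_real C x)) \<partial>P x) \<le> ennreal (1 + 2 * indicator C x)" for x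
  proof -
    interpret P: prob_space "P x" by (rule prob_space_P)
    have "exp (indicat_real C x) \<le> 1 + 2 * indicator C x" using e by (auto split: split_indicator)
    then show ?thesis by (simp only: nn_integral_const P.emeasure_space_1 mult_1_right ennreal_leI)
  qed
  then show "AE x in Q. (\<integral>\<^sup>+y. ennreal (exp (indicat_real C x)) \<partial>P x) \<le> ennreal (1 + 2 * indicator C x)" by simp
qed (use p in \<open>auto split: split_indicator intro!: integrable_indicator_Q\<close>)

lemma Chernoff_absolute_residuals:
  assumes C[measurable]: "C \<in> sets borel" and p: "measure Q C \<le> p"
  shows "emeasure M {\<omega>\<in>space M. real n * (\<gamma> * p) + u \<le> (\<Sum>i=1..n. l * (\<bar>res i \<omega>\<bar> * indicator C (Xs i \<omega>)))} \<le> ennreal (exp (- u))"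
  unfolding res_def
proof (rule Chernoff[where b = "\<lambda>x. \<gamma> * indicator C x" and h = "\<lambda>x y. l * (\<bar>y - g0 x\<bar> * indicator C x)"])
  show "AE x in Q. (\<integral>\<^sup>+y. ennreal (exp (l * (\<bar>y - g0 x\<bar> * indicat_real C x))) \<partial>P x) \<le> ennreal (1 + \<gamma> * indicator C x)"
    using noise
  proof eventually_elim
    case (elim x)
    interpret P: prob_space "P x" by (rule prob_space_P)
    have "ennreal \<gamma> \<le> ennreal (1 + \<gamma>)" by (intro ennreal_leI) simp
    with elim show ?case by (cases "x \<in> C") (auto simp: P.emeasure_space_1)
  qed
qed (use p constants in \<open>auto split: split_indicator intro!: mult_left_mono integrable_indicator_Q\<close>)

text \<open>
  The constant \<open>\<gamma> * l / 2\<close> is chosen such that on \<open>I\<close> the exponential moment, with parameter \<open>l / 2\<close>, is at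
  most \<open>1\<close>: \<open>1 + \<gamma> * (l / 2)\<^sup>2 \<le> exp (\<gamma> * (l / 2)\<^sup>2)\<close>. Hence \<open>I\<close> may have any mass, and only the mass of the thin set
  \<open>S\<close> enters the bound.
\<close>

lemma Chernoff_halfspace_residuals:
  assumes I[measurable]: "I \<in> sets borel" and S[measurable]: "S \<in> sets borel" and disj: "I \<inter> S = {}"
    and p: "measure Q S \<le> p" and s: "\<bar>s\<bar> = 1"
  shows "emeasure M {\<omega>\<in>space M. real n * (\<gamma> * p) + u \<le> (\<Sum>i=1..n. l / 2 *
      ((s * res i \<omega> - \<gamma> * l / 2) * indicator I (Xs i \<omega>) + \<bar>res i \<omega>\<bar> * indicator S (Xs i \<omega>)))} \<le> ennreal (exp (- u))"
  unfolding res_def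
proof (rule Chernoff[where b = "\<lambda>x. \<gamma> * indicator S x" and h = "\<lambda>x y. l / 2 *
      ((s * (y - g0 x) - \<gamma> * l / 2) * indicator I x + \<bar>y - g0 x\<bar> * indicator S x)"])
  show "AE x in Q. (\<integral>\<^sup>+y. ennreal (exp (l / 2 *
      ((s * (y - g0 x) - \<gamma> * l / 2) * indicat_real I x + \<bar>y - g0 x\<bar> * indicator S x))) \<partial>P x)
      \<le> ennreal (1 + \<gamma> * indicator S x)"
    using noise
  proof eventually_elim
    case (elim x)
    interpret P: prob_space "P x" by (rule prob_space_P)
    consider "x \<in> I" "x \<notin> S" | "x \<in> S" "x \<notin> I" | "x \<notin> I" "x \<notin> S" using disj by blast
    then show ?case
    proof cases
      case 1
      define w where "w = l / 2 * s"
      have w: "\<bar>w\<bar> \<le> l / 2" "w\<^sup>2 = (l / 2)\<^sup>2"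
        using s constants by (auto simp: w_def abs_mult power_mult_distrib power_divide abs_if split: if_splits)
      have "(\<integral>\<^sup>+y. ennreal (exp (l / 2 * (s * (y - g0 x) - \<gamma> * l / 2))) \<partial>P x)
          = (\<integral>\<^sup>+y. ennreal (exp (- (\<gamma> * (l / 2)\<^sup>2))) * ennreal (exp (w * (y - g0 x))) \<partial>P x)"
        by (intro nn_integral_cong)
          (simp add: w_def algebra_simps power2_eq_square flip: ennreal_mult' exp_add)
      also have "\<dots> = ennreal (exp (- (\<gamma> * (l / 2)\<^sup>2))) * (\<integral>\<^sup>+y. ennreal (exp (w * (y - g0 x))) \<partial>P x)"
        by (intro nn_integral_cmult) simp
      also have "\<dots> \<le> ennreal (exp (- (\<gamma> * (l / 2)\<^sup>2))) * ennreal (1 + \<gamma> * w\<^sup>2)"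
        using elim w by (intro mult_left_mono) auto
      also have "\<dots> \<le> ennreal (exp (- (\<gamma> * (l / 2)\<^sup>2))) * ennreal (exp (\<gamma> * w\<^sup>2))"
        by (intro mult_left_mono ennreal_leI exp_ge_add_one_self) simp
      also have "\<dots> = 1" unfolding w(2) by (simp flip: ennreal_mult' exp_add)
      finally show ?thesis using 1 by simp
    next
      case 2
      have "(\<integral>\<^sup>+y. ennreal (exp (l / 2 * \<bar>y - g0 x\<bar>)) \<partial>P x) \<le> (\<integral>\<^sup>+y. ennreal (exp (l * \<bar>y - g0 x\<bar>)) \<partial>P x)"
        using constants by (intro nn_integral_mono ennreal_leI) auto
      also have "\<dots> \<le> ennreal \<gamma>" using elim by blast
      also have "\<dots> \<le> ennreal (1 + \<gamma>)" by (intro ennreal_leI) simp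
      finally show ?thesis using 2 by simp
    next
      case 3
      then show ?thesis by (simp add: P.emeasure_space_1)
    qed
  qed
qed (use p constants in \<open>auto split: split_indicator intro!: mult_left_mono integrable_indicator_Q\<close>)

lemma Chernoff_count_lower:
  assumes I[measurable]: "I \<in> sets borel"
  shows "emeasure M {\<omega>\<in>space M. real n * (- measure Q I / 2) + u \<le> (\<Sum>i=1..n. - indicator I (Xs i \<omega>))} \<le> ennreal (exp (- u))"
proof (rule Chernoff[where b = "\<lambda>x. - indicator I x / 2" and h = "\<lambda>x y. - indicator I x"])
  have e: "exp (- 1) \<le> (1 - 1 / 2 :: real)" using exp_minus_le_half[of 1] by simp
  have "(\<integral>\<^sup>+y. ennreal (exp (- indicat_real I x)) \<partial>P x) \<le> ennreal (1 + - indicator I x / 2)" for x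
  proof -
    interpret P: prob_space "P x" by (rule prob_space_P)
    have "exp (- indicat_real I x) \<le> 1 + - indicator I x / 2" using e by (auto split: split_indicator)
    then show ?thesis by (simp only: nn_integral_const P.emeasure_space_1 mult_1_right ennreal_leI)
  qed
  then show "AE x in Q. (\<integral>\<^sup>+y. ennreal (exp (- indicat_real I x)) \<partial>P x) \<le> ennreal (1 + - indicator I x / 2)" by simp
qed (auto split: split_indicator intro!: integrable_indicator_Q)

lemma residual_tail:
  assumes i: "i \<ge> 1"
  shows "emeasure M {\<omega>\<in>space M. t \<le> \<bar>res i \<omega>\<bar>} \<le> ennreal (\<gamma> * exp (- (l * t)))"
proof -
  note [measurable] = Xs_Ys_measurable[OF i] res_measurable[OF i]
  have "(\<integral>\<^sup>+\<omega>. ennreal (exp (l * \<bar>res i \<omega>\<bar>)) \<partial>M) = (\<integral>\<^sup>+x. \<integral>\<^sup>+y. ennreal (exp (l * \<bar>y - g0 x\<bar>)) \<partial>P x \<partial>Q)"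
    unfolding res_def using law[OF i, of "\<lambda>z. ennreal (exp (l * \<bar>snd z - g0 (fst z)\<bar>))"] by simp
  also have "\<dots> \<le> (\<integral>\<^sup>+x. ennreal \<gamma> \<partial>Q)" using noise by (intro nn_integral_mono_AE) auto
  also have "\<dots> = ennreal (exp (ln \<gamma>))" using constants Q.emeasure_space_1 by simp
  finally have "emeasure M {\<omega>\<in>space M. ln \<gamma> + (l * t - ln \<gamma>) \<le> l * \<bar>res i \<omega>\<bar>} \<le> ennreal (exp (- (l * t - ln \<gamma>)))"
    by (intro exponential_Markov) auto
  moreover have "exp (- (l * t - ln \<gamma>)) = \<gamma> * exp (- (l * t))"
    using constants by (simp add: exp_diff exp_minus field_simps)
  ultimately show ?thesis using constants by simp
qed

lemma Xs_outside: "i \<ge> 1 \<Longrightarrow> emeasure M {\<omega>\<in>space M. Xs i \<omega> \<notin> XX} = 0"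
proof -
  assume i: "i \<ge> 1"
  note [measurable] = Xs_Ys_measurable[OF i]
  have "emeasure M {\<omega>\<in>space M. Xs i \<omega> \<notin> XX} = (\<integral>\<^sup>+\<omega>. indicator {\<omega>\<in>space M. Xs i \<omega> \<notin> XX} \<omega> \<partial>M)"
    by simp
  also have "\<dots> = (\<integral>\<^sup>+\<omega>. indicator (- XX) (Xs i \<omega>) \<partial>M)"
    by (intro nn_integral_cong) (auto split: split_indicator)
  also have "\<dots> = (\<integral>\<^sup>+x. \<integral>\<^sup>+y. indicator (- XX) x \<partial>P x \<partial>Q)"
    using law[OF i, of "\<lambda>z. indicator (- XX) (fst z)"] by simp
  also have "\<dots> = (\<integral>\<^sup>+x. 0 \<partial>Q)"
  proof (intro nn_integral_cong_AE)
    show "AE x in Q. (\<integral>\<^sup>+y. indicator (- XX) x \<partial>P x) = 0"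
      using AE_XX by eventually_elim simp
  qed
  finally show ?thesis by simp
qed

text \<open>
  Expanding the product over the cells of the bounds of \<open>exp_excess_le\<close> gives a sum over sign patterns
  \<open>\<sigma>\<close>. For each pattern the exponent is linear in the noise, with the weight function
  \<open>\<Sum>a\<in>B. \<sigma> a * indicator (C a)\<close>, so its exponential moment is known; as the cells are disjoint it factorizes over
  the cells again, and the sum over the patterns recombines to a product. Thus the cell sums, which
  are dependent through the number of observations in each cell, behave as if they were independent.
\<close>

lemma Chernoff_excess:
  fixes C :: "'b \<Rightarrow> (real ^ 'd) set"
  assumes B: "finite B" and C[measurable]: "\<And>a. a \<in> B \<Longrightarrow> C a \<in> sets borel"
    and disj: "disjoint_family_on C B" and p: "\<And>a. a \<in> B \<Longrightarrow> measure Q (C a) \<le> p"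
    and r: "0 < r" "2 * r \<le> l" and q: "exp (real n * \<gamma> * r\<^sup>2 * p - r * A) \<le> q"
  shows "emeasure M {\<omega>\<in>space M. 2 * q * real (card B) + u \<le>
      r * (\<Sum>a\<in>B. max 0 (\<bar>\<Sum>i=1..n. indicator (C a) (Xs i \<omega>) * res i \<omega>\<bar> - A))} \<le> ennreal (exp (- u))"
proof (rule exponential_Markov)
  define S where "S a \<omega> = (\<Sum>i=1..n. indicator (C a) (Xs i \<omega>) * res i \<omega>)" for a \<omega>
  have S[measurable]: "S a \<in> borel_measurable M" if "a \<in> B" for a
    unfolding S_def[abs_def] using C[OF that] Xs_Ys_measurable res_measurable by measurable
  then show "(\<lambda>\<omega>. r * (\<Sum>a\<in>B. max 0 (\<bar>\<Sum>i=1..n. indicator (C a) (Xs i \<omega>) * res i \<omega>\<bar> - A))) \<in> borel_measurable M"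
    unfolding S_def[symmetric] by measurable
  define T where "T = B \<rightarrow>\<^sub>E {-1, 0, 1 :: real}"
  have T: "finite T" unfolding T_def using B by (intro finite_PiE) auto
  define v where "v = real n * \<gamma> * r\<^sup>2 * p"
  have pw: "exp (r * (\<Sum>a\<in>B. max 0 (\<bar>S a \<omega>\<bar> - A))) \<le> (\<Sum>\<sigma>\<in>T. exp (- (r * A * (\<Sum>a\<in>B. \<bar>\<sigma> a\<bar>))) * exp (r * (\<Sum>a\<in>B. \<sigma> a * S a \<omega>)))" for \<omega>
  proof -
    have "exp (r * (\<Sum>a\<in>B. max 0 (\<bar>S a \<omega>\<bar> - A))) = (\<Prod>a\<in>B. exp (r * max 0 (\<bar>S a \<omega>\<bar> - A)))"
      using B by (simp add: sum_distrib_left exp_sum)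
    also have "\<dots> \<le> (\<Prod>a\<in>B. \<Sum>t\<in>{-1, 0, 1}. exp (r * (t * S a \<omega> - A * \<bar>t\<bar>)))"
      using r by (intro prod_mono conjI exp_excess_le) auto
    also have "\<dots> = (\<Sum>\<sigma>\<in>T. \<Prod>a\<in>B. exp (r * (\<sigma> a * S a \<omega> - A * \<bar>\<sigma> a\<bar>)))"
      unfolding T_def using B by (subst prod_sum_PiE) auto
    also have "\<dots> = (\<Sum>\<sigma>\<in>T. exp (- (r * A * (\<Sum>a\<in>B. \<bar>\<sigma> a\<bar>))) * exp (r * (\<Sum>a\<in>B. \<sigma> a * S a \<omega>)))"
    proof (intro sum.cong refl)
      fix \<sigma>
      have "(\<Prod>a\<in>B. exp (r * (\<sigma> a * S a \<omega> - A * \<bar>\<sigma> a\<bar>))) = exp (\<Sum>a\<in>B. r * (\<sigma> a * S a \<omega> - A * \<bar>\<sigma> a\<bar>))"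
        using B by (simp add: exp_sum)
      also have "(\<Sum>a\<in>B. r * (\<sigma> a * S a \<omega> - A * \<bar>\<sigma> a\<bar>)) = - (r * A * (\<Sum>a\<in>B. \<bar>\<sigma> a\<bar>)) + r * (\<Sum>a\<in>B. \<sigma> a * S a \<omega>)"
        by (simp add: right_diff_distrib sum_subtractf sum_distrib_left mult.assoc)
      finally show "(\<Prod>a\<in>B. exp (r * (\<sigma> a * S a \<omega> - A * \<bar>\<sigma> a\<bar>))) = exp (- (r * A * (\<Sum>a\<in>B. \<bar>\<sigma> a\<bar>))) * exp (r * (\<Sum>a\<in>B. \<sigma> a * S a \<omega>))"
        by (simp only: exp_add)
    qed
    finally show ?thesis .
  qed
  have mgf: "(\<integral>\<^sup>+\<omega>. ennreal (exp (r * (\<Sum>a\<in>B. \<sigma> a * S a \<omega>))) \<partial>M) \<le> ennreal (exp (v * (\<Sum>a\<in>B. \<bar>\<sigma> a\<bar>)))"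
    if \<sigma>: "\<sigma> \<in> T" for \<sigma>
  proof -
    define w where "w x = (\<Sum>a\<in>B. \<sigma> a * indicator (C a) x)" for x
    have [measurable]: "w \<in> borel_measurable borel" unfolding w_def[abs_def] by measurable
    have s1: "\<sigma> a \<in> {-1, 0, 1}" if "a \<in> B" for a using \<sigma> that by (auto simp: T_def)
    have w2: "(w x)\<^sup>2 = (\<Sum>a\<in>B. \<bar>\<sigma> a\<bar> * indicator (C a) x) \<and> \<bar>w x\<bar> \<le> 1" for x
    proof (cases "\<exists>a\<in>B. x \<in> C a")
      case True
      then obtain a where a: "a \<in> B" "x \<in> C a" by blast
      have o: "x \<notin> C b" if "b \<in> B" "b \<noteq> a" for b
        using disj a that by (auto simp: disjoint_family_on_def)
      have e: "(\<Sum>b\<in>B. f b * indicator (C b) x) = f a" for f :: "'b \<Rightarrow> real"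
      proof -
        have "(\<Sum>b\<in>B. f b * indicator (C b) x) = (\<Sum>b\<in>B. if b = a then f b else 0)"
          using a o by (intro sum.cong) auto
        then show ?thesis using B a by simp
      qed
      show ?thesis using s1[OF a(1)] unfolding w_def e by auto
    next
      case False
      then have "(\<Sum>b\<in>B. f b * indicator (C b) x) = 0" for f :: "'b \<Rightarrow> real"
        by (intro sum.neutral) auto
      then show ?thesis by (simp add: w_def)
    qed
    have "r * (\<Sum>a\<in>B. \<sigma> a * S a \<omega>) = (\<Sum>i=1..n. r * w (Xs i \<omega>) * res i \<omega>)" for \<omega>
    proof -
      have "(\<Sum>a\<in>B. \<sigma> a * S a \<omega>) = (\<Sum>i=1..n. \<Sum>a\<in>B. \<sigma> a * (indicator (C a) (Xs i \<omega>) * res i \<omega>))"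
        unfolding S_def sum_distrib_left by (rule sum.swap)
      then show ?thesis by (simp add: w_def sum_distrib_left sum_distrib_right mult_ac)
    qed
    then have "(\<integral>\<^sup>+\<omega>. ennreal (exp (r * (\<Sum>a\<in>B. \<sigma> a * S a \<omega>))) \<partial>M)
        = (\<integral>\<^sup>+\<omega>. ennreal (exp (\<Sum>i=1..n. (\<lambda>x y. r * w x * (y - g0 x)) (Xs i \<omega>) (Ys i \<omega>))) \<partial>M)"
      by (simp add: res_def)
    also have "\<dots> \<le> ennreal (exp (real n * (\<gamma> * r\<^sup>2 * (p * (\<Sum>a\<in>B. \<bar>\<sigma> a\<bar>)))))"
    proof (rule mgf_sample_le[where b = "\<lambda>x. \<gamma> * r\<^sup>2 * (w x)\<^sup>2"])
      have iw: "integrable Q (\<lambda>x. (w x)\<^sup>2)"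
      proof (rule Q.integrable_const_bound[of _ 1])
        have "(w x)\<^sup>2 \<le> 1" for x using w2[of x] abs_square_le_1[of "w x"] by blast
        then show "AE x in Q. norm ((w x)\<^sup>2) \<le> 1" by simp
      qed simp
      then show "integrable Q (\<lambda>x. \<gamma> * r\<^sup>2 * (w x)\<^sup>2)" by simp
      have "(\<integral>x. (w x)\<^sup>2 \<partial>Q) = (\<Sum>a\<in>B. \<bar>\<sigma> a\<bar> * measure Q (C a))"
      proof -
        have "(\<lambda>x. (w x)\<^sup>2) = (\<lambda>x. \<Sum>a\<in>B. \<bar>\<sigma> a\<bar> * indicator (C a) x)" using w2 by blast
        then show ?thesis by (simp add: C integrable_indicator_Q)
      qed
      also have "\<dots> \<le> (\<Sum>a\<in>B. \<bar>\<sigma> a\<bar> * p)" by (intro sum_mono mult_left_mono p) auto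
      finally have "(\<integral>x. (w x)\<^sup>2 \<partial>Q) \<le> p * (\<Sum>a\<in>B. \<bar>\<sigma> a\<bar>)" by (simp add: sum_distrib_left mult.commute)
      then show "(\<integral>x. \<gamma> * r\<^sup>2 * (w x)\<^sup>2 \<partial>Q) \<le> \<gamma> * r\<^sup>2 * (p * (\<Sum>a\<in>B. \<bar>\<sigma> a\<bar>))"
        using constants by (simp add: mult_left_mono)
      have "0 \<le> \<gamma> * r\<^sup>2 * (w x)\<^sup>2" for x using constants by simp
      then show "- 1 \<le> \<gamma> * r\<^sup>2 * (w x)\<^sup>2" for x by (meson order_trans neg_le_0_iff_le zero_le_one)
      show "AE x in Q. (\<integral>\<^sup>+y. ennreal (exp (r * w x * (y - g0 x))) \<partial>P x) \<le> ennreal (1 + \<gamma> * r\<^sup>2 * (w x)\<^sup>2)"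
        using noise
      proof eventually_elim
        case (elim x)
        have "\<bar>r * w x\<bar> \<le> r * 1" unfolding abs_mult using r w2[of x] by (intro mult_mono) auto
        then have "\<bar>r * w x\<bar> \<le> l / 2" using r by simp
        with elim have "(\<integral>\<^sup>+y. ennreal (exp (r * w x * (y - g0 x))) \<partial>P x) \<le> ennreal (1 + \<gamma> * (r * w x)\<^sup>2)" by blast
        then show ?case by (simp add: power_mult_distrib mult.assoc)
      qed
    qed measurable
    finally show ?thesis by (simp add: v_def mult_ac)
  qed
  have "(\<integral>\<^sup>+\<omega>. ennreal (exp (r * (\<Sum>a\<in>B. max 0 (\<bar>S a \<omega>\<bar> - A)))) \<partial>M)
      \<le> (\<integral>\<^sup>+\<omega>. (\<Sum>\<sigma>\<in>T. ennreal (exp (- (r * A * (\<Sum>a\<in>B. \<bar>\<sigma> a\<bar>)))) * ennreal (exp (r * (\<Sum>a\<in>B. \<sigma> a * S a \<omega>)))) \<partial>M)"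
    using pw by (intro nn_integral_mono) (simp add: ennreal_leI sum_ennreal flip: ennreal_mult')
  also have "\<dots> = (\<Sum>\<sigma>\<in>T. ennreal (exp (- (r * A * (\<Sum>a\<in>B. \<bar>\<sigma> a\<bar>)))) * (\<integral>\<^sup>+\<omega>. ennreal (exp (r * (\<Sum>a\<in>B. \<sigma> a * S a \<omega>))) \<partial>M))"
    by (subst nn_integral_sum) (auto simp: nn_integral_cmult)
  also have "\<dots> \<le> (\<Sum>\<sigma>\<in>T. ennreal (exp (- (r * A * (\<Sum>a\<in>B. \<bar>\<sigma> a\<bar>)))) * ennreal (exp (v * (\<Sum>a\<in>B. \<bar>\<sigma> a\<bar>))))"
    by (intro sum_mono mult_left_mono mgf) auto
  also have "\<dots> = ennreal (\<Sum>\<sigma>\<in>T. exp ((v - r * A) * (\<Sum>a\<in>B. \<bar>\<sigma> a\<bar>)))"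
    by (simp add: sum_ennreal left_diff_distrib flip: ennreal_mult' exp_add)
  also have "(\<Sum>\<sigma>\<in>T. exp ((v - r * A) * (\<Sum>a\<in>B. \<bar>\<sigma> a\<bar>))) = (\<Sum>\<sigma>\<in>T. \<Prod>a\<in>B. exp ((v - r * A) * \<bar>\<sigma> a\<bar>))"
    using B by (simp add: sum_distrib_left exp_sum)
  also have "\<dots> = (\<Prod>a\<in>B. \<Sum>t\<in>{-1, 0, 1 :: real}. exp ((v - r * A) * \<bar>t\<bar>))"
    unfolding T_def using B by (subst prod_sum_PiE) auto
  also have "\<dots> = (1 + 2 * exp (v - r * A)) ^ card B" by (simp add: add.commute)
  also have "\<dots> \<le> exp (2 * q) ^ card B"
  proof (rule power_mono)
    have "1 + 2 * exp (v - r * A) \<le> 1 + 2 * q" using q by (simp add: v_def)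
    also have "\<dots> \<le> exp (2 * q)" by (rule exp_ge_add_one_self)
    finally show "1 + 2 * exp (v - r * A) \<le> exp (2 * q)" .
  qed (simp add: add_nonneg_nonneg)
  finally show "(\<integral>\<^sup>+\<omega>. ennreal (exp (r * (\<Sum>a\<in>B. max 0 (\<bar>\<Sum>i=1..n. indicator (C a) (Xs i \<omega>) * res i \<omega>\<bar> - A)))) \<partial>M)
      \<le> ennreal (exp (2 * q * real (card B)))"
    by (simp add: S_def ennreal_leI exp_of_nat2_mult)
qed

section \<open>The regular event and the geometry of cells\<close>

text \<open>
  The truncation level exceeds the bound \<open>K0\<close> of the regression function by exactly the constant of
  \<open>Chernoff_halfspace_residuals\<close>.
\<close>

definition "cap = K0 + \<gamma> * l / 2"
text \<open>
  The exponential parameter at which \<open>Chernoff_regression\<close> applies to all functions bounded by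
  \<open>cap + K0\<close>.
\<close>

definition "tilt = min (l / (4 * (cap + K0))) (min (1 / (16 * \<gamma>)) (4 / (cap + K0)\<^sup>2))"
text \<open>
  The truncation does not affect the codes that approximate functions with values in \<open>[-cap, cap]\<close>; it
  makes the remaining codes obey the same bound.
\<close>

definition approx :: "nat \<Rightarrow> real ^ 'd \<Rightarrow> (nat \<Rightarrow> nat \<Rightarrow> nat) \<Rightarrow> real ^ 'd \<Rightarrow> real" where
  "approx J \<beta> m x = max (- cap) (min cap (decode cap J m (\<lambda>k. cell R \<beta> (2 ^ (J + k)) x)))"
text \<open>
  At level \<open>k\<close> a cell contains up to order \<open>4 ^ J / 2 ^ k\<close> observations, so a cell sum has standard deviation
  \<open>2 ^ J / 2 powr (k / 2)\<close>. The threshold is larger by a factor that grows like \<open>(9/8) powr (k / 2)\<close>, which is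
  what a simultaneous bound over all cells of the level requires, and it is still summable over the levels.
\<close>

definition threshold :: "nat \<Rightarrow> nat \<Rightarrow> real" where
  "threshold J k = (8 * c * \<gamma> + 8) * 2 ^ J * (3/4) ^ k"
text \<open>
  Halfspaces at the resolution \<open>8 ^ J\<close>, hence of order \<open>1 / n\<close>. A shell is three units wide: it absorbs
  both the rounding of the offset and the replacement of a direction by an element of the net.
\<close>

definition halfspace :: "nat \<Rightarrow> real ^ 'd \<Rightarrow> nat \<Rightarrow> (real ^ 'd) set" where
  "halfspace J \<beta> j = {x. real j + 1 \<le> 8 ^ J * pos R \<beta> x}"
definition shell :: "nat \<Rightarrow> real ^ 'd \<Rightarrow> nat \<Rightarrow> (real ^ 'd) set" where
  "shell J \<beta> j = {x. real j - 2 \<le> 8 ^ J * pos R \<beta> x \<and> 8 ^ J * pos R \<beta> x < real j + 1}"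

text \<open>
  The clauses concern, in this order: the range of the sample and of the noise; the net of rounded
  functions; the excesses of the cell sums; the numbers of observations in the cells; the absolute noise in the
  finest cells; the noise in halfspaces, with both signs; and the numbers of observations in halfspaces.
\<close>

definition regular :: "(real ^ 'd) set \<Rightarrow> nat \<Rightarrow> nat \<Rightarrow> 'w \<Rightarrow> bool" where
  "regular S J n \<omega> \<longleftrightarrow>
    (\<forall>i\<in>{1..n}. Xs i \<omega> \<in> XX \<and> \<bar>res i \<omega>\<bar> < (real J)\<^sup>2) \<and>
    (\<forall>\<beta>\<in>S. \<forall>m\<in>codes J. (\<Sum>i=1..n. tilt * (2 * res i \<omega> * (approx J \<beta> m (Xs i \<omega>) - g0 (Xs i \<omega>))
        - (approx J \<beta> m (Xs i \<omega>) - g0 (Xs i \<omega>))\<^sup>2 / 2))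
      < - (real n * (tilt / 8) * (\<integral>x. (approx J \<beta> m x - g0 x)\<^sup>2 \<partial>Q)) + 31 * 2 ^ J) \<and>
    (\<forall>\<beta>\<in>S. \<forall>k\<le>J. (3/2) ^ k / 2 ^ J * (\<Sum>a<2 ^ (J + k). max 0
        (\<bar>\<Sum>i=1..n. indicator {x. cell R \<beta> (2 ^ (J + k)) x = a} (Xs i \<omega>) * res i \<omega>\<bar> - threshold J k)) < 3 * 2 ^ J) \<and>
    (\<forall>\<beta>\<in>S. \<forall>k\<le>J. \<forall>a<2 ^ (J + k).
        (\<Sum>i=1..n. indicator {x. cell R \<beta> (2 ^ (J + k)) x = a} (Xs i \<omega>)) < (16 * c + 1) * 4 ^ J / 2 ^ k) \<and>
    (\<forall>\<beta>\<in>S. \<forall>a<2 ^ (2 * J).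
        (\<Sum>i=1..n. l * (\<bar>res i \<omega>\<bar> * indicator {x. cell R \<beta> (2 ^ (2 * J)) x = a} (Xs i \<omega>))) < (8 * \<gamma> * c + 1) * 2 ^ J) \<and>
    (\<forall>\<beta>\<in>S. \<forall>j\<le>8 ^ J + 1. \<forall>s\<in>{-1, 1}.
        (\<Sum>i=1..n. l / 2 * ((s * res i \<omega> - \<gamma> * l / 2) * indicator (halfspace J \<beta> j) (Xs i \<omega>)
          + \<bar>res i \<omega>\<bar> * indicator (shell J \<beta> j) (Xs i \<omega>))) < 24 * \<gamma> * c + (real J)\<^sup>2) \<and>
    (\<forall>\<beta>\<in>S. \<forall>j\<le>8 ^ J + 1.
        real n * measure Q (halfspace J \<beta> j) / 2 - (real J)\<^sup>2 < (\<Sum>i=1..n. indicator (halfspace J \<beta> j) (Xs i \<omega>)))"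

lemma cap: "0 < cap" "K0 \<le> cap" "cap - K0 = \<gamma> * l / 2"
  using constants by (simp_all add: cap_def add_pos_pos)

lemma tilt: "0 < tilt" "4 * tilt * (cap + K0) \<le> l" "16 * \<gamma> * tilt \<le> 1" "tilt * (cap + K0)\<^sup>2 \<le> 4"
proof -
  have p: "0 < cap + K0" "0 < \<gamma>" using cap constants by auto
  show "0 < tilt" using p constants by (simp add: tilt_def)
  have "tilt \<le> l / (4 * (cap + K0))" "tilt \<le> 1 / (16 * \<gamma>)" "tilt \<le> 4 / (cap + K0)\<^sup>2"
    by (auto simp: tilt_def)
  then show "4 * tilt * (cap + K0) \<le> l" "16 * \<gamma> * tilt \<le> 1" "tilt * (cap + K0)\<^sup>2 \<le> 4"
    using p by (simp_all add: pos_le_divide_eq algebra_simps)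
qed

lemma measurable_decode[measurable]:
  "(\<lambda>x. decode cap J m (\<lambda>k. cell R \<beta> (2 ^ (J + k)) x)) \<in> borel_measurable borel"
  unfolding decode_def by measurable

lemma measurable_approx[measurable]: "approx J \<beta> m \<in> borel_measurable borel"
  unfolding approx_def[abs_def] by measurable

lemma measurable_halfspace[measurable]: "halfspace J \<beta> j \<in> sets borel"
  unfolding halfspace_def by measurable

lemma measurable_shell[measurable]: "shell J \<beta> j \<in> sets borel"
  unfolding shell_def by measurable

lemma measurable_cell_eq[measurable]: "{x. cell R \<beta> m x = a} \<in> sets borel"
  by measurable

lemma approx_bound: "\<bar>approx J \<beta> m x\<bar> \<le> cap"
  using cap by (auto simp: approx_def)

lemma pos_in_unit:
  assumes "\<beta> \<in> sphere 0 1" "x \<in> XX"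
  shows "0 < pos R \<beta> x" "pos R \<beta> x < 1"
proof -
  have "\<bar>\<beta> \<bullet> x\<bar> \<le> norm \<beta> * norm x" by (rule Cauchy_Schwarz_ineq2)
  also have "\<dots> < R" using assms norm_less by simp
  finally show "0 < pos R \<beta> x" "pos R \<beta> x < 1" using constants by (auto simp: pos_def field_simps)
qed

lemma cell_bounds:
  assumes "\<beta> \<in> sphere 0 1" "x \<in> XX" "0 < m"
  shows "real (cell R \<beta> m x) \<le> real m * pos R \<beta> x" "real m * pos R \<beta> x < real (cell R \<beta> m x) + 1"
    "cell R \<beta> m x < m"
proof -
  note p = pos_in_unit[OF assms(1,2)]
  have "0 \<le> real m * pos R \<beta> x" using p by simp
  then show b: "real (cell R \<beta> m x) \<le> real m * pos R \<beta> x" "real m * pos R \<beta> x < real (cell R \<beta> m x) + 1"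
    unfolding cell_def by linarith+
  have "real m * pos R \<beta> x < real m * 1" using p assms by (intro mult_strict_left_mono) auto
  then show "cell R \<beta> m x < m" using b by simp
qed

lemma measure_cell_le:
  assumes "\<beta> \<in> sphere 0 1" "0 < m"
  shows "measure Q {x. cell R \<beta> m x = a} \<le> c / real m"
proof -
  have "measure Q {x. cell R \<beta> m x = a} \<le> measure Q {x. real a / real m \<le> pos R \<beta> x \<and> pos R \<beta> x \<le> (real a + 1) / real m}"
  proof (intro Q.finite_measure_mono_AE)
    show "AE x in Q. x \<in> {x. cell R \<beta> m x = a} \<longrightarrow> x \<in> {x. real a / real m \<le> pos R \<beta> x \<and> pos R \<beta> x \<le> (real a + 1) / real m}"
      using AE_XX
    proof eventually_elim
      case (elim x)
      then show ?case using cell_bounds[OF assms(1) elim assms(2)] assms(2)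
        by (auto simp: pos_divide_le_eq pos_le_divide_eq mult.commute)
    qed
  qed simp
  also have "\<dots> \<le> c * ((real a + 1) / real m - real a / real m)"
    by (intro slab assms divide_right_mono) auto
  also have "\<dots> = c / real m" using assms by (simp add: diff_divide_distrib[symmetric])
  finally show ?thesis .
qed

lemma measure_shell_le:
  assumes "\<beta> \<in> sphere 0 1"
  shows "measure Q (shell J \<beta> j) \<le> 3 * c / 8 ^ J"
proof -
  have "measure Q (shell J \<beta> j) \<le> measure Q {x. (real j - 2) / 8 ^ J \<le> pos R \<beta> x \<and> pos R \<beta> x \<le> (real j + 1) / 8 ^ J}"
    by (intro Q.finite_measure_mono) (auto simp: shell_def field_simps)
  also have "\<dots> \<le> c * ((real j + 1) / 8 ^ J - (real j - 2) / 8 ^ J)"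
    by (intro slab assms divide_right_mono) auto
  also have "\<dots> = 3 * c / 8 ^ J" by (simp add: diff_divide_distrib[symmetric])
  finally show ?thesis .
qed

lemma cell_refine:
  assumes "k \<le> J"
  shows "cell R \<beta> (2 ^ (J + k)) x = cell R \<beta> (2 ^ (2 * J)) x div 2 ^ (J - k)"
proof -
  define z where "z = 2 ^ (2 * J) * pos R \<beta> x"
  have e: "(2::real) ^ (2 * J) = 2 ^ (J + k) * 2 ^ (J - k)"
    using assms by (simp add: mult_2 flip: power_add)
  have "2 ^ (J + k) * pos R \<beta> x = z / 2 ^ (J - k)" unfolding z_def e by simp
  moreover have "\<lfloor>z / 2 ^ (J - k)\<rfloor> = \<lfloor>z\<rfloor> div 2 ^ (J - k)"
    using floor_divide_real_eq_div[of "2 ^ (J - k)" z] by simp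
  ultimately have "cell R \<beta> (2 ^ (J + k)) x = nat (\<lfloor>z\<rfloor> div 2 ^ (J - k))"
    by (simp add: cell_def)
  also have "\<dots> = nat \<lfloor>z\<rfloor> div nat (2 ^ (J - k))"
    by (rule nat_div_distrib') simp
  finally show ?thesis by (simp add: cell_def z_def nat_power_eq)
qed

lemma pos_net:
  assumes "\<alpha> \<in> sphere 0 1" "x \<in> XX" "norm (\<alpha> - \<beta>) \<le> 2 / 8 ^ J"
  shows "\<bar>8 ^ J * pos R \<alpha> x - 8 ^ J * pos R \<beta> x\<bar> \<le> 1"
proof -
  have "pos R \<alpha> x - pos R \<beta> x = (\<alpha> - \<beta>) \<bullet> x / (2 * R)"
    by (simp add: pos_def inner_diff_left diff_divide_distrib[symmetric])
  then have "\<bar>pos R \<alpha> x - pos R \<beta> x\<bar> = \<bar>(\<alpha> - \<beta>) \<bullet> x\<bar> / (2 * R)" using constants by simp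
  also have "\<dots> \<le> 2 / 8 ^ J * R / (2 * R)"
  proof (intro divide_right_mono)
    have "\<bar>(\<alpha> - \<beta>) \<bullet> x\<bar> \<le> norm (\<alpha> - \<beta>) * norm x" by (rule Cauchy_Schwarz_ineq2)
    also have "\<dots> \<le> 2 / 8 ^ J * R"
      using assms norm_less[OF assms(2)] constants by (intro mult_mono) auto
    finally show "\<bar>(\<alpha> - \<beta>) \<bullet> x\<bar> \<le> 2 / 8 ^ J * R" .
  qed (use constants in auto)
  finally have "\<bar>pos R \<alpha> x - pos R \<beta> x\<bar> \<le> 1 / 8 ^ J" using constants by simp
  moreover have "\<bar>8 ^ J * pos R \<alpha> x - 8 ^ J * pos R \<beta> x\<bar> = 8 ^ J * \<bar>pos R \<alpha> x - pos R \<beta> x\<bar>"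
    by (simp add: abs_mult right_diff_distrib[symmetric])
  ultimately show ?thesis by (simp add: field_simps)
qed

text \<open>
  If \<open>\<beta>\<close> is close to \<open>\<alpha>\<close>, then on a finest cell in the direction \<open>\<beta>\<close> the position in the direction \<open>\<alpha>\<close> varies
  over an interval of three cell lengths. The value of \<open>\<psi>\<close> at the left end of that interval is a monotone function of the
  cell, to which \<open>monotone_decomposition\<close> applies; the oscillation of \<open>\<psi>\<close> over the interval is \<open>D\<close>. Each
  cell length is used three times, whence the bound \<open>6 * cap\<close> for the sum.
\<close>

lemma ridge_decomposition:
  assumes \<alpha>: "\<alpha> \<in> sphere 0 1" and \<beta>: "\<beta> \<in> sphere 0 1" "norm (\<alpha> - \<beta>) \<le> 2 / 8 ^ J"
    and \<psi>: "mono \<psi>" "\<And>t. \<bar>\<psi> t\<bar> \<le> cap"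
  obtains m r D where "m \<in> codes J"
    "\<And>k a. 0 \<le> r k a" "\<And>k a. r k a \<le> mesh cap J k"
    "\<And>k. k \<le> J \<Longrightarrow> (\<Sum>a<2 ^ (J + k). r k a) \<le> 2 * cap"
    "\<And>b. 0 \<le> D b" "\<And>b. D b \<le> 2 * cap" "(\<Sum>b<2 ^ (2 * J). D b) \<le> 6 * cap"
    "\<And>x. x \<in> XX \<Longrightarrow> 0 \<le> \<psi> (\<alpha> \<bullet> x) - approx J \<beta> m x - (\<Sum>k\<le>J. r k (cell R \<beta> (2 ^ (J + k)) x))"
    "\<And>x. x \<in> XX \<Longrightarrow> \<psi> (\<alpha> \<bullet> x) - approx J \<beta> m x - (\<Sum>k\<le>J. r k (cell R \<beta> (2 ^ (J + k)) x)) \<le> D (cell R \<beta> (2 ^ (2 * J)) x)"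
proof -
  define v where "v b = \<psi> (2 * R * ((real b - 1) / 4 ^ J) - R)" for b :: nat
  have vK: "\<bar>v b\<bar> \<le> cap" for b unfolding v_def by (rule \<psi>)
  have "mono v"
    unfolding v_def using constants
    by (intro monoI monoD[OF \<psi>(1)] diff_right_mono mult_left_mono divide_right_mono) auto
  then obtain m r where m: "m \<in> codes J"
    and r: "\<And>k a. 0 \<le> r k a" "\<And>k a. r k a \<le> mesh cap J k" "\<And>k. k \<le> J \<Longrightarrow> (\<Sum>a<2 ^ (J + k). r k a) \<le> 2 * cap"
    and dec: "\<And>i. i < 2 ^ (2 * J) \<Longrightarrow>
       v i = decode cap J m (\<lambda>k. i div 2 ^ (J - k)) + (\<Sum>k\<le>J. r k (i div 2 ^ (J - k)))"
    by (rule monotone_decomposition[OF _ vK cap(1), where J = J]) (rule that)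
  define D where "D b = v (b + 3) - v b" for b
  have D: "0 \<le> D b" "D b \<le> 2 * cap" for b
    using monoD[OF \<open>mono v\<close>, of b "b + 3"] vK[of b] vK[of "b + 3"] by (auto simp: D_def)
  have "(\<Sum>b<2 ^ (2 * J). D b) \<le> 6 * cap" unfolding D_def by (rule sum_shift3_le) (rule vK)
  moreover have "0 \<le> \<psi> (\<alpha> \<bullet> x) - approx J \<beta> m x - (\<Sum>k\<le>J. r k (cell R \<beta> (2 ^ (J + k)) x)) \<and>
     \<psi> (\<alpha> \<bullet> x) - approx J \<beta> m x - (\<Sum>k\<le>J. r k (cell R \<beta> (2 ^ (J + k)) x)) \<le> D (cell R \<beta> (2 ^ (2 * J)) x)"
    if x: "x \<in> XX" for x
  proof -
    define b where "b = cell R \<beta> (2 ^ (2 * J)) x"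
    have e4: "real (2 ^ (2 * J)) = 4 ^ J" by (simp add: power_mult)
    have b: "real b \<le> 4 ^ J * pos R \<beta> x" "4 ^ J * pos R \<beta> x < real b + 1" "b < 2 ^ (2 * J)"
      using cell_bounds[OF \<beta>(1) x, of "2 ^ (2 * J)"] unfolding b_def e4 by auto
    have ck: "cell R \<beta> (2 ^ (J + k)) x = b div 2 ^ (J - k)" if "k \<le> J" for k
      unfolding b_def by (rule cell_refine[OF that])
    define rs where "rs = (\<Sum>k\<le>J. r k (cell R \<beta> (2 ^ (J + k)) x))"
    define d where "d = decode cap J m (\<lambda>k. cell R \<beta> (2 ^ (J + k)) x)"
    have "v b = d + rs"
      using dec[OF b(3)] ck unfolding d_def rs_def decode_def by (simp cong: sum.cong_simp)
    moreover have "0 \<le> rs" unfolding rs_def by (intro sum_nonneg r)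
    moreover have "- cap \<le> d"
      unfolding d_def decode_def using cap by (auto simp: mesh_def intro!: sum_nonneg)
    ultimately have ap: "approx J \<beta> m x = d" "v b = d + rs"
      using vK[of b] by (auto simp: approx_def d_def[symmetric])
    have close: "\<bar>4 ^ J * pos R \<alpha> x - 4 ^ J * pos R \<beta> x\<bar> \<le> 1"
    proof -
      have "\<bar>8 ^ J * pos R \<alpha> x - 8 ^ J * pos R \<beta> x\<bar> \<le> 1" by (rule pos_net[OF \<alpha> x \<beta>(2)])
      moreover have "(8::real) ^ J = 2 ^ J * 4 ^ J" by (simp flip: power_mult_distrib)
      ultimately have "2 ^ J * \<bar>4 ^ J * pos R \<alpha> x - 4 ^ J * pos R \<beta> x\<bar> \<le> 1"
        by (simp add: abs_mult mult.assoc right_diff_distrib[symmetric])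
      moreover define t where "t = \<bar>4 ^ J * pos R \<alpha> x - 4 ^ J * pos R \<beta> x\<bar>"
      moreover have "1 * t \<le> 2 ^ J * t" unfolding t_def by (intro mult_right_mono) auto
      ultimately show ?thesis by simp
    qed
    have \<alpha>x: "\<alpha> \<bullet> x = 2 * R * pos R \<alpha> x - R" using constants by (simp add: pos_def)
    (* changing the direction moves a position by at most one cell *)
    have z: "(real b - 1) / 4 ^ J \<le> pos R \<alpha> x" "pos R \<alpha> x \<le> (real (b + 3) - 1) / 4 ^ J"
      using b(1,2) close by (simp_all add: pos_divide_le_eq pos_le_divide_eq mult.commute[of _ "4 ^ J"] abs_le_iff)
    have "v b \<le> \<psi> (\<alpha> \<bullet> x)"
      unfolding v_def \<alpha>x using constants z(1)
      by (intro monoD[OF \<psi>(1)] diff_right_mono mult_left_mono) auto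
    moreover have "\<psi> (\<alpha> \<bullet> x) \<le> v (b + 3)"
      unfolding v_def \<alpha>x using constants z(2)
      by (intro monoD[OF \<psi>(1)] diff_right_mono mult_left_mono) auto
    ultimately show ?thesis
      unfolding rs_def[symmetric] ap D_def b_def[symmetric] using ap by auto
  qed
  ultimately show ?thesis by (intro that[of m r D] m r D) blast+
qed

section \<open>Approximation errors on the regular event\<close>

lemma cell_expansion:
  fixes f :: "nat \<Rightarrow> real"
  assumes "\<beta> \<in> sphere 0 1" "x \<in> XX" "0 < m"
  shows "f (cell R \<beta> m x) = (\<Sum>a<m. f a * indicator {x. cell R \<beta> m x = a} x)"
proof -
  have "(\<Sum>a<m. f a * indicator {x. cell R \<beta> m x = a} x) = (\<Sum>a<m. if a = cell R \<beta> m x then f a else 0)"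
    by (intro sum.cong) auto
  then show ?thesis using cell_bounds(3)[OF assms] by simp
qed

definition "noise_const = 6 * cap * ((8 * \<gamma> * c + 1) / l) + 8 * cap * (8 * c * \<gamma> + 8) + 36 * cap"

text \<open>
  The oscillation in a finest cell is multiplied by the absolute noise there, which is of order \<open>2 ^ J\<close>. At the
  dyadic levels the thresholds contribute the ratio \<open>3/4\<close>, and mesh times excess the ratio
  \<open>5/4 * 2/3 = 5/6\<close>; both series converge.
\<close>

lemma regular_residual_error:
  assumes reg: "regular S J n \<omega>" and \<beta>: "\<beta> \<in> S" "\<beta> \<in> sphere 0 1"
    and r: "\<And>k a. 0 \<le> r k a" "\<And>k a. r k a \<le> mesh cap J k"
      "\<And>k. k \<le> J \<Longrightarrow> (\<Sum>a<2 ^ (J + k). r k a) \<le> 2 * cap"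
    and D: "\<And>b. 0 \<le> D b" "(\<Sum>b<2 ^ (2 * J). D b) \<le> 6 * cap"
    and u: "\<And>x. x \<in> XX \<Longrightarrow> 0 \<le> u x - (\<Sum>k\<le>J. r k (cell R \<beta> (2 ^ (J + k)) x))"
      "\<And>x. x \<in> XX \<Longrightarrow> u x - (\<Sum>k\<le>J. r k (cell R \<beta> (2 ^ (J + k)) x)) \<le> D (cell R \<beta> (2 ^ (2 * J)) x)"
  shows "(\<Sum>i=1..n. res i \<omega> * u (Xs i \<omega>)) \<le> noise_const * 2 ^ J"
proof -
  define p where "p x = (\<Sum>k\<le>J. r k (cell R \<beta> (2 ^ (J + k)) x))" for x
  have X: "Xs i \<omega> \<in> XX" if "i \<in> {1..n}" for i using reg that by (auto simp: regular_def)
  have K: "cap > 0" by (rule cap)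
  define I where "I m a i = indicat_real {x. cell R \<beta> m x = a} (Xs i \<omega>)" for m a i
  have "(\<Sum>i=1..n. res i \<omega> * (u (Xs i \<omega>) - p (Xs i \<omega>))) \<le> (\<Sum>i=1..n. \<bar>res i \<omega>\<bar> * D (cell R \<beta> (2 ^ (2 * J)) (Xs i \<omega>)))"
  proof (intro sum_mono)
    fix i assume "i \<in> {1..n}"
    note u = u[OF X[OF this], folded p_def]
    have "res i \<omega> * (u (Xs i \<omega>) - p (Xs i \<omega>)) \<le> \<bar>res i \<omega>\<bar> * (u (Xs i \<omega>) - p (Xs i \<omega>))"
      using u by (intro mult_right_mono) auto
    also have "\<dots> \<le> \<bar>res i \<omega>\<bar> * D (cell R \<beta> (2 ^ (2 * J)) (Xs i \<omega>))"
      using u by (intro mult_left_mono) auto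
    finally show "res i \<omega> * (u (Xs i \<omega>) - p (Xs i \<omega>)) \<le> \<bar>res i \<omega>\<bar> * D (cell R \<beta> (2 ^ (2 * J)) (Xs i \<omega>))" .
  qed
  also have "\<dots> = (\<Sum>i=1..n. \<Sum>b<2 ^ (2 * J). D b * (\<bar>res i \<omega>\<bar> * I (2 ^ (2 * J)) b i))"
  proof (intro sum.cong refl)
    fix i assume i: "i \<in> {1..n}"
    have "D (cell R \<beta> (2 ^ (2 * J)) (Xs i \<omega>)) = (\<Sum>b<2 ^ (2 * J). D b * I (2 ^ (2 * J)) b i)"
      unfolding I_def by (rule cell_expansion[OF \<beta>(2) X[OF i]]) simp
    then show "\<bar>res i \<omega>\<bar> * D (cell R \<beta> (2 ^ (2 * J)) (Xs i \<omega>)) = (\<Sum>b<2 ^ (2 * J). D b * (\<bar>res i \<omega>\<bar> * I (2 ^ (2 * J)) b i))"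
      by (simp add: sum_distrib_left mult_ac)
  qed
  also have "\<dots> = (\<Sum>b<2 ^ (2 * J). D b * (\<Sum>i=1..n. \<bar>res i \<omega>\<bar> * I (2 ^ (2 * J)) b i))"
    unfolding sum_distrib_left by (rule sum.swap)
  also have "\<dots> \<le> (\<Sum>b<2 ^ (2 * J). D b * ((8 * \<gamma> * c + 1) * 2 ^ J / l))"
  proof (intro sum_mono mult_left_mono D)
    fix b :: nat assume "b \<in> {..<2 ^ (2 * J)}"
    then have "(\<Sum>i=1..n. l * (\<bar>res i \<omega>\<bar> * I (2 ^ (2 * J)) b i)) < (8 * \<gamma> * c + 1) * 2 ^ J"
      using reg \<beta>(1) unfolding regular_def I_def by blast
    then show "(\<Sum>i=1..n. \<bar>res i \<omega>\<bar> * I (2 ^ (2 * J)) b i) \<le> (8 * \<gamma> * c + 1) * 2 ^ J / l"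
      using constants by (simp add: sum_distrib_left[symmetric] pos_le_divide_eq mult.commute)
  qed
  also have "\<dots> \<le> 6 * cap * ((8 * \<gamma> * c + 1) * 2 ^ J / l)"
    unfolding sum_distrib_right[symmetric] using D constants by (intro mult_right_mono) auto
  finally have 1: "(\<Sum>i=1..n. res i \<omega> * (u (Xs i \<omega>) - p (Xs i \<omega>))) \<le> 6 * cap * ((8 * \<gamma> * c + 1) / l) * 2 ^ J"
    by simp
  have "(\<Sum>i=1..n. res i \<omega> * p (Xs i \<omega>))
      = (\<Sum>i=1..n. \<Sum>k\<le>J. \<Sum>a<2 ^ (J + k). r k a * (I (2 ^ (J + k)) a i * res i \<omega>))"
  proof (intro sum.cong refl)
    fix i assume i: "i \<in> {1..n}"
    have "r k (cell R \<beta> (2 ^ (J + k)) (Xs i \<omega>)) = (\<Sum>a<2 ^ (J + k). r k a * I (2 ^ (J + k)) a i)" for k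
      unfolding I_def by (rule cell_expansion[OF \<beta>(2) X[OF i]]) simp
    then show "res i \<omega> * p (Xs i \<omega>) = (\<Sum>k\<le>J. \<Sum>a<2 ^ (J + k). r k a * (I (2 ^ (J + k)) a i * res i \<omega>))"
      unfolding p_def by (simp add: sum_distrib_left mult_ac)
  qed
  also have "\<dots> = (\<Sum>k\<le>J. \<Sum>i=1..n. \<Sum>a<2 ^ (J + k). r k a * (I (2 ^ (J + k)) a i * res i \<omega>))"
    by (rule sum.swap)
  also have "\<dots> = (\<Sum>k\<le>J. \<Sum>a<2 ^ (J + k). r k a * (\<Sum>i=1..n. I (2 ^ (J + k)) a i * res i \<omega>))"
    unfolding sum_distrib_left by (intro sum.cong refl sum.swap)
  also have "\<dots> \<le> (\<Sum>k\<le>J. (8 * c * \<gamma> + 8) * (2 * cap) * 2 ^ J * (3/4) ^ k + 6 * cap * 2 ^ J * (5/6) ^ k)"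
  proof (intro sum_mono)
    fix k assume "k \<in> {..J}"
    then have k: "k \<le> J" by simp
    define e where "e = (\<Sum>a<2 ^ (J + k). max 0 (\<bar>\<Sum>i=1..n. I (2 ^ (J + k)) a i * res i \<omega>\<bar> - threshold J k))"
    have "(3/2) ^ k / 2 ^ J * e < 3 * 2 ^ J" using reg \<beta>(1) k unfolding regular_def I_def e_def by blast
    then have e: "e \<le> 3 * 2 ^ J * 2 ^ J * (2/3) ^ k" by (simp add: field_simps power_divide)
    have "(\<Sum>a<2 ^ (J + k). r k a * (\<Sum>i=1..n. I (2 ^ (J + k)) a i * res i \<omega>)) \<le> threshold J k * (2 * cap) + mesh cap J k * e"
      unfolding e_def using r(1,2) r(3)[OF k] constants
      by (intro sum_excess_le) (auto simp: threshold_def)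
    also have "\<dots> \<le> threshold J k * (2 * cap) + mesh cap J k * (3 * 2 ^ J * 2 ^ J * (2/3) ^ k)"
      using K by (intro add_left_mono mult_left_mono e) (auto simp: mesh_def)
    also have "mesh cap J k * (3 * 2 ^ J * 2 ^ J * (2/3) ^ k) = 6 * cap * 2 ^ J * (5/6) ^ k"
    proof -
      have "(5/4 :: real) ^ k * (2/3) ^ k = (5/6) ^ k" by (simp flip: power_mult_distrib)
      then show ?thesis by (simp add: mesh_def)
    qed
    finally show "(\<Sum>a<2 ^ (J + k). r k a * (\<Sum>i=1..n. I (2 ^ (J + k)) a i * res i \<omega>))
        \<le> (8 * c * \<gamma> + 8) * (2 * cap) * 2 ^ J * (3/4) ^ k + 6 * cap * 2 ^ J * (5/6) ^ k"
      by (simp add: threshold_def mult_ac)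
  qed
  also have "\<dots> = (8 * c * \<gamma> + 8) * (2 * cap) * 2 ^ J * (\<Sum>k\<le>J. (3/4) ^ k) + 6 * cap * 2 ^ J * (\<Sum>k\<le>J. (5/6) ^ k)"
    by (simp add: sum.distrib sum_distrib_left)
  also have "\<dots> \<le> (8 * c * \<gamma> + 8) * (2 * cap) * 2 ^ J * 4 + 6 * cap * 2 ^ J * 6"
    using geometric_sum_le[of "3/4" J] geometric_sum_le[of "5/6" J] constants K
    by (intro add_mono mult_left_mono) auto
  finally have 2: "(\<Sum>i=1..n. res i \<omega> * p (Xs i \<omega>)) \<le> (8 * cap * (8 * c * \<gamma> + 8) + 36 * cap) * 2 ^ J"
    by (simp add: algebra_simps)
  have "(\<Sum>i=1..n. res i \<omega> * u (Xs i \<omega>)) = (\<Sum>i=1..n. res i \<omega> * (u (Xs i \<omega>) - p (Xs i \<omega>))) + (\<Sum>i=1..n. res i \<omega> * p (Xs i \<omega>))"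
    by (simp add: sum.distrib[symmetric] algebra_simps)
  then show ?thesis using 1 2 unfolding noise_const_def distrib_right by linarith
qed

text \<open>
  Stated for an arbitrary measure because it serves both for \<open>Q\<close> and for the empirical measure. The square of a
  remainder is at most the mesh times the remainder, whose sum is bounded; level \<open>k\<close> then contributes a
  multiple of \<open>(5/4 * 5/4 / 2) ^ k\<close>, the first factor being the Cauchy-Schwarz weight and the last one the mass
  of the cells.
\<close>

lemma integral_square_error_le:
  assumes "finite_measure \<mu>" and [measurable_cong]: "sets \<mu> = sets borel" and XX: "AE x in \<mu>. x \<in> XX"
    and \<beta>: "\<beta> \<in> sphere 0 1" and s: "0 \<le> s"
    and mass: "\<And>k a. k \<le> J \<Longrightarrow> a < 2 ^ (J + k) \<Longrightarrow> measure \<mu> {x. cell R \<beta> (2 ^ (J + k)) x = a} \<le> s / 2 ^ k"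
    and r: "\<And>k a. 0 \<le> r k a" "\<And>k a. r k a \<le> mesh cap J k"
      "\<And>k. k \<le> J \<Longrightarrow> (\<Sum>a<2 ^ (J + k). r k a) \<le> 2 * cap"
    and D: "\<And>b. 0 \<le> D b" "\<And>b. D b \<le> 2 * cap" "(\<Sum>b<2 ^ (2 * J). D b) \<le> 6 * cap"
    and u: "\<And>x. x \<in> XX \<Longrightarrow> 0 \<le> u x - (\<Sum>k\<le>J. r k (cell R \<beta> (2 ^ (J + k)) x))"
      "\<And>x. x \<in> XX \<Longrightarrow> u x - (\<Sum>k\<le>J. r k (cell R \<beta> (2 ^ (J + k)) x)) \<le> D (cell R \<beta> (2 ^ (2 * J)) x)"
    and [measurable]: "u \<in> borel_measurable borel"
  shows "(\<integral>x. (u x)\<^sup>2 \<partial>\<mu>) \<le> 224 * cap\<^sup>2 * s / 2 ^ J"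
proof -
  interpret finite_measure \<mu> by fact
  have K: "cap > 0" by (rule cap)
  have sp: "space \<mu> = UNIV" using sets_eq_imp_space_eq[OF \<open>sets \<mu> = _\<close>] by simp
  define E where "E m a = {x. cell R \<beta> m x = a}" for m a
  have E[measurable]: "E m a \<in> sets borel" for m a unfolding E_def by (rule measurable_cell_eq)
  define F where "F m a x = indicat_real (E m a) x" for m a x
  have iE: "integrable \<mu> (F m a)" for m a
    unfolding F_def[abs_def] by (rule integrable_const_bound[of _ 1]) auto
  have intE: "(\<integral>x. F m a x \<partial>\<mu>) = measure \<mu> (E m a)" for m a
    by (simp add: sp F_def)
  define G where "G x = (\<Sum>b<2 ^ (2 * J). 4 * cap * D b * F (2 ^ (2 * J)) b x)
     + (\<Sum>k\<le>J. \<Sum>a<2 ^ (J + k). 20 * cap / 2 ^ J * (25/16) ^ k * r k a * F (2 ^ (J + k)) a x)" for x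
  have iG: "integrable \<mu> G" unfolding G_def by (intro Bochner_Integration.integrable_add Bochner_Integration.integrable_sum integrable_mult_right iE)
  have le: "(u x)\<^sup>2 \<le> G x" if x: "x \<in> XX" for x
  proof -
    define p where "p = (\<Sum>k\<le>J. r k (cell R \<beta> (2 ^ (J + k)) x))"
    define d where "d = u x - p"
    have d: "0 \<le> d" "d \<le> D (cell R \<beta> (2 ^ (2 * J)) x)" "d \<le> 2 * cap"
      using u[OF x] D(2) order_trans unfolding d_def p_def by blast+
    have "(u x)\<^sup>2 = (d + p)\<^sup>2" by (simp add: d_def)
    also have "\<dots> \<le> 2 * d\<^sup>2 + 2 * p\<^sup>2"
      using sum_squares_ge_zero[of "d - p" 0] by (simp add: power2_eq_square algebra_simps)
    also have "2 * d\<^sup>2 \<le> 4 * cap * D (cell R \<beta> (2 ^ (2 * J)) x)"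
      using mult_mono[OF d(3,2)] d K D by (simp add: power2_eq_square)
    also have "D (cell R \<beta> (2 ^ (2 * J)) x) = (\<Sum>b<2 ^ (2 * J). D b * F (2 ^ (2 * J)) b x)"
      unfolding F_def E_def by (rule cell_expansion[OF \<beta> x]) simp
    also have "2 * p\<^sup>2 \<le> (\<Sum>k\<le>J. 20 * cap / 2 ^ J * (25/16) ^ k * r k (cell R \<beta> (2 ^ (J + k)) x))"
    proof -
      have "2 * p\<^sup>2 \<le> 2 * (5 * (\<Sum>k\<le>J. (5/4) ^ k * (r k (cell R \<beta> (2 ^ (J + k)) x))\<^sup>2))"
        unfolding p_def by (intro mult_left_mono sum_weighted_square_le) auto
      also have "\<dots> = (\<Sum>k\<le>J. 10 * (5/4) ^ k * (r k (cell R \<beta> (2 ^ (J + k)) x))\<^sup>2)"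
        by (simp add: sum_distrib_left mult.assoc)
      also have "\<dots> \<le> (\<Sum>k\<le>J. 20 * cap / 2 ^ J * (25/16) ^ k * r k (cell R \<beta> (2 ^ (J + k)) x))"
      proof (intro sum_mono)
        fix k
        define t where "t = r k (cell R \<beta> (2 ^ (J + k)) x)"
        have "t * t \<le> mesh cap J k * t" unfolding t_def by (intro mult_right_mono r)
        then have "10 * (5/4) ^ k * t\<^sup>2 \<le> 10 * (5/4) ^ k * (mesh cap J k * t)"
          unfolding power2_eq_square by (intro mult_left_mono) auto
        also have "\<dots> = 20 * cap / 2 ^ J * ((5/4) ^ k * (5/4) ^ k) * t" by (simp add: mesh_def)
        also have "(5/4 :: real) ^ k * (5/4) ^ k = (25/16) ^ k" by (simp flip: power_mult_distrib)
        finally show "10 * (5/4) ^ k * (r k (cell R \<beta> (2 ^ (J + k)) x))\<^sup>2 \<le> 20 * cap / 2 ^ J * (25/16) ^ k * r k (cell R \<beta> (2 ^ (J + k)) x)"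
          unfolding t_def .
      qed
      finally show ?thesis .
    qed
    also have "(\<Sum>k\<le>J. 20 * cap / 2 ^ J * (25/16) ^ k * r k (cell R \<beta> (2 ^ (J + k)) x))
        = (\<Sum>k\<le>J. 20 * cap / 2 ^ J * (25/16) ^ k * (\<Sum>a<2 ^ (J + k). r k a * F (2 ^ (J + k)) a x))"
      unfolding F_def E_def by (intro sum.cong refl arg_cong2[where f = "(*)"] cell_expansion[OF \<beta> x]) simp
    finally show ?thesis unfolding G_def by (simp only: sum_distrib_left mult.assoc)
  qed
  have int_le: "(\<integral>x. (u x)\<^sup>2 \<partial>\<mu>) \<le> (\<integral>x. G x \<partial>\<mu>)"
  proof (rule integral_mono_AE[OF _ iG])
    show ae: "AE x in \<mu>. (u x)\<^sup>2 \<le> G x" using XX by eventually_elim (rule le)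
    show "integrable \<mu> (\<lambda>x. (u x)\<^sup>2)"
    proof (rule Bochner_Integration.integrable_bound[OF iG])
      show "AE x in \<mu>. norm ((u x)\<^sup>2) \<le> norm (G x)"
        using ae by eventually_elim (auto intro: order_trans[OF _ abs_ge_self])
    qed simp
  qed
  have int_eq: "(\<integral>x. G x \<partial>\<mu>) = (\<Sum>b<2 ^ (2 * J). 4 * cap * D b * measure \<mu> (E (2 ^ (2 * J)) b))
     + (\<Sum>k\<le>J. \<Sum>a<2 ^ (J + k). 20 * cap / 2 ^ J * (25/16) ^ k * r k a * measure \<mu> (E (2 ^ (J + k)) a))"
  proof -
    have I: "(\<integral>x. (\<Sum>a<m. g a * F m a x) \<partial>\<mu>) = (\<Sum>a<m. g a * measure \<mu> (E m a))" for g m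
      by (subst Bochner_Integration.integral_sum) (simp_all add: iE intE)
    have i1: "integrable \<mu> (\<lambda>x. \<Sum>a<m. g a * F m a x)" for g m
      by (intro Bochner_Integration.integrable_sum integrable_mult_right iE)
    have i2: "integrable \<mu> (\<lambda>x. \<Sum>k\<le>J. \<Sum>a<2 ^ (J + k). 20 * cap / 2 ^ J * (25/16) ^ k * r k a * F (2 ^ (J + k)) a x)"
      by (intro Bochner_Integration.integrable_sum integrable_mult_right iE)
    show ?thesis unfolding G_def Bochner_Integration.integral_add[OF i1 i2]
      by (subst Bochner_Integration.integral_sum[OF i1]) (simp only: I)
  qed
  have T1: "(\<Sum>b<2 ^ (2 * J). 4 * cap * D b * measure \<mu> (E (2 ^ (2 * J)) b)) \<le> 24 * (cap\<^sup>2 * s / 2 ^ J)"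
  proof -
    have "(\<Sum>b<2 ^ (2 * J). 4 * cap * D b * measure \<mu> (E (2 ^ (2 * J)) b)) \<le> (\<Sum>b<2 ^ (2 * J). 4 * cap * (s / 2 ^ J) * D b)"
    proof (rule sum_mono)
      fix b :: nat assume "b \<in> {..<2 ^ (2 * J)}"
      then have "measure \<mu> (E (2 ^ (2 * J)) b) \<le> s / 2 ^ J"
        using mass[of J b] by (simp add: E_def mult_2)
      then have "4 * cap * D b * measure \<mu> (E (2 ^ (2 * J)) b) \<le> 4 * cap * D b * (s / 2 ^ J)"
        by (rule mult_left_mono) (use K D(1) in simp)
      then show "4 * cap * D b * measure \<mu> (E (2 ^ (2 * J)) b) \<le> 4 * cap * (s / 2 ^ J) * D b"
        by (simp only: mult_ac)
    qed
    also have "\<dots> \<le> 4 * cap * (s / 2 ^ J) * (6 * cap)"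
      unfolding sum_distrib_left[symmetric] by (rule mult_left_mono[OF D(3)]) (use K s in simp)
    also have "\<dots> = 24 * (cap\<^sup>2 * s / 2 ^ J)" by (simp add: power2_eq_square)
    finally show ?thesis .
  qed
  have T2: "(\<Sum>k\<le>J. \<Sum>a<2 ^ (J + k). 20 * cap / 2 ^ J * (25/16) ^ k * r k a * measure \<mu> (E (2 ^ (J + k)) a))
      \<le> 200 * (cap\<^sup>2 * s / 2 ^ J)"
  proof -
    have "(\<Sum>k\<le>J. \<Sum>a<2 ^ (J + k). 20 * cap / 2 ^ J * (25/16) ^ k * r k a * measure \<mu> (E (2 ^ (J + k)) a))
        \<le> (\<Sum>k\<le>J. 40 * (cap\<^sup>2 * s / 2 ^ J) * (25/32) ^ k)"
    proof (rule sum_mono)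
      fix k assume "k \<in> {..J}"
      then have k: "k \<le> J" by simp
      define q where "q = 20 * cap / 2 ^ J * (25/16) ^ k"
      have q: "q \<ge> 0" using K by (simp add: q_def)
      have "(\<Sum>a<2 ^ (J + k). q * r k a * measure \<mu> (E (2 ^ (J + k)) a)) \<le> (\<Sum>a<2 ^ (J + k). q * (s / 2 ^ k) * r k a)"
      proof (rule sum_mono)
        fix a :: nat assume "a \<in> {..<2 ^ (J + k)}"
        then have "measure \<mu> (E (2 ^ (J + k)) a) \<le> s / 2 ^ k"
          using mass[OF k, of a] by (simp add: E_def)
        then have "q * r k a * measure \<mu> (E (2 ^ (J + k)) a) \<le> q * r k a * (s / 2 ^ k)"
          by (rule mult_left_mono) (use q r(1) in simp)
        then show "q * r k a * measure \<mu> (E (2 ^ (J + k)) a) \<le> q * (s / 2 ^ k) * r k a"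
          by (simp only: mult_ac)
      qed
      also have "\<dots> \<le> q * (s / 2 ^ k) * (2 * cap)"
        unfolding sum_distrib_left[symmetric] by (rule mult_left_mono[OF r(3)[OF k]]) (use q s in simp)
      also have "\<dots> = 40 * (cap\<^sup>2 * s / 2 ^ J) * ((25/16) ^ k / 2 ^ k)"
        by (simp add: power2_eq_square q_def)
      also have "(25/16 :: real) ^ k / 2 ^ k = (25/32) ^ k" by (simp flip: power_divide)
      finally show "(\<Sum>a<2 ^ (J + k). 20 * cap / 2 ^ J * (25/16) ^ k * r k a * measure \<mu> (E (2 ^ (J + k)) a))
          \<le> 40 * (cap\<^sup>2 * s / 2 ^ J) * (25/32) ^ k" unfolding q_def .
    qed
    also have "\<dots> \<le> 40 * (cap\<^sup>2 * s / 2 ^ J) * 5"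
      unfolding sum_distrib_left[symmetric] using geometric_sum_le[of "25/32" J] s
      by (intro mult_left_mono) auto
    finally show ?thesis by simp
  qed
  from int_le int_eq T1 T2 show ?thesis by (simp only: times_divide_eq_right mult.assoc)
qed

section \<open>Deterministic error bound on the regular event\<close>

definition "risk_const = 31 / tilt + 2 * noise_const + 224 * cap\<^sup>2 * (17 * c + 1)"

lemma integrable_bounded_on_XX:
  fixes f :: "real ^ 'd \<Rightarrow> real"
  assumes "f \<in> borel_measurable borel" "\<And>x. x \<in> XX \<Longrightarrow> \<bar>f x\<bar> \<le> B"
  shows "integrable Q f"
  using AE_XX assms by (intro Q.integrable_const_bound[of _ B]) (auto elim: eventually_mono)

lemma integrable_square_bounded_on_XX:
  fixes f :: "real ^ 'd \<Rightarrow> real"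
  assumes "f \<in> borel_measurable borel" "\<And>x. x \<in> XX \<Longrightarrow> \<bar>f x\<bar> \<le> B"
  shows "integrable Q (\<lambda>x. (f x)\<^sup>2)"
proof (rule integrable_bounded_on_XX[of _ "B\<^sup>2"])
  show "\<bar>(f x)\<^sup>2\<bar> \<le> B\<^sup>2" if "x \<in> XX" for x
    using power_mono[OF assms(2)[OF that] abs_ge_zero, of 2] by (simp only: power2_abs abs_power2)
qed (use assms(1) in measurable)

lemma measurable_ridge[measurable (raw)]:
  "mono \<psi> \<Longrightarrow> (\<lambda>x. \<psi> (\<alpha> \<bullet> x)) \<in> borel_measurable borel" for \<psi> :: "real \<Rightarrow> real"
proof -
  assume "mono \<psi>"
  then have "\<psi> \<in> borel_measurable borel" by (rule borel_measurable_mono)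
  moreover have "(\<lambda>x. \<alpha> \<bullet> x) \<in> borel_measurable borel"
    by (intro borel_measurable_continuous_onI continuous_intros)
  ultimately show ?thesis by (rule measurable_compose[rotated])
qed

text \<open>
  With \<open>f = w + h\<close>, where \<open>h\<close> belongs to the finite net and \<open>w\<close> is the approximation error, the inequality for \<open>h\<close>
  has the term \<open>(h x)\<^sup>2 / 2\<close> instead of \<open>(h x)\<^sup>2\<close>; the difference pays for the passage from \<open>h\<close> to \<open>f\<close> in the empirical
  norm, and the drift is transferred from \<open>h\<close> to \<open>f\<close> in the norm of \<open>Q\<close>.
\<close>

lemma bounded_ridge_inequality:
  assumes reg: "regular S J n \<omega>" and S: "S \<subseteq> sphere 0 1"
    and net: "\<beta> \<in> S" "norm (\<alpha> - \<beta>) \<le> 2 / 8 ^ J" and \<alpha>: "\<alpha> \<in> sphere 0 1"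
    and \<psi>: "mono \<psi>" "\<And>t. \<bar>\<psi> t\<bar> \<le> cap" and n: "real n \<le> 8 * 8 ^ J"
  defines "f \<equiv> \<lambda>x. \<psi> (\<alpha> \<bullet> x) - g0 x"
  shows "(\<Sum>i=1..n. 2 * res i \<omega> * f (Xs i \<omega>) - (f (Xs i \<omega>))\<^sup>2) + real n / 16 * (\<integral>x. (f x)\<^sup>2 \<partial>Q) \<le> risk_const * 2 ^ J"
proof -
  have \<beta>: "\<beta> \<in> sphere 0 1" using net S by blast
  have K: "cap > 0" by (rule cap)
  have e84: "(8::real) ^ J = 2 ^ J * 4 ^ J" by (simp flip: power_mult_distrib)
  have e42: "(4::real) ^ J = 2 ^ J * 2 ^ J" by (simp flip: power_mult_distrib)
  obtain m r D where m: "m \<in> codes J"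
    and r: "\<And>k a. 0 \<le> r k a" "\<And>k a. r k a \<le> mesh cap J k"
      "\<And>k. k \<le> J \<Longrightarrow> (\<Sum>a<2 ^ (J + k). r k a) \<le> 2 * cap"
    and D: "\<And>b. 0 \<le> D b" "\<And>b. D b \<le> 2 * cap" "(\<Sum>b<2 ^ (2 * J). D b) \<le> 6 * cap"
    and u: "\<And>x. x \<in> XX \<Longrightarrow> 0 \<le> \<psi> (\<alpha> \<bullet> x) - approx J \<beta> m x - (\<Sum>k\<le>J. r k (cell R \<beta> (2 ^ (J + k)) x))"
      "\<And>x. x \<in> XX \<Longrightarrow> \<psi> (\<alpha> \<bullet> x) - approx J \<beta> m x - (\<Sum>k\<le>J. r k (cell R \<beta> (2 ^ (J + k)) x)) \<le> D (cell R \<beta> (2 ^ (2 * J)) x)"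
    by (rule ridge_decomposition[OF \<alpha> \<beta> net(2) \<psi>]) (rule that)
  define w where "w x = \<psi> (\<alpha> \<bullet> x) - approx J \<beta> m x" for x
  define h where "h x = approx J \<beta> m x - g0 x" for x
  note u = u[folded w_def]
  have [measurable]: "w \<in> borel_measurable borel" "h \<in> borel_measurable borel" "f \<in> borel_measurable borel"
    unfolding w_def[abs_def] h_def[abs_def] f_def using \<psi>(1) by measurable
  have X: "Xs i \<omega> \<in> XX" if "i \<in> {1..n}" for i using reg that by (auto simp: regular_def)
  have fwh: "f x = w x + h x" for x by (simp add: f_def w_def h_def)
  have sq: "(f x)\<^sup>2 \<ge> (h x)\<^sup>2 / 2 - (w x)\<^sup>2" "(f x)\<^sup>2 \<le> 2 * (h x)\<^sup>2 + 2 * (w x)\<^sup>2" for x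
    unfolding fwh using zero_le_power2[of "h x + 2 * w x"] zero_le_power2[of "h x - w x"]
    by (simp_all add: power2_eq_square algebra_simps)
  have e1: "(\<Sum>i=1..n. res i \<omega> * w (Xs i \<omega>)) \<le> noise_const * 2 ^ J"
    by (rule regular_residual_error[OF reg net(1) \<beta> r D(1,3) u])
  have e2: "(\<Sum>i=1..n. (w (Xs i \<omega>))\<^sup>2) \<le> 224 * cap\<^sup>2 * (16 * c + 1) * 2 ^ J"
  proof -
    (* the empirical measure, with total mass n *)
    define \<mu> where "\<mu> = distr (count_space {1..n}) borel (\<lambda>i. Xs i \<omega>)"
    have fin: "finite_measure \<mu>"
      unfolding \<mu>_def by (intro finite_measure.finite_measure_distr finite_measure_count_space) auto
    have mass: "measure \<mu> E = (\<Sum>i=1..n. indicator E (Xs i \<omega>))" if [measurable]: "E \<in> sets borel" for E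
    proof -
      have "measure \<mu> E = (\<integral>x. indicator E x \<partial>\<mu>)" by (simp add: \<mu>_def)
      also have "\<dots> = (\<Sum>i=1..n. indicator E (Xs i \<omega>))"
        unfolding \<mu>_def by (subst integral_distr) (auto simp: lebesgue_integral_count_space_finite)
      finally show ?thesis .
    qed
    have "(\<Sum>i=1..n. (w (Xs i \<omega>))\<^sup>2) = (\<integral>x. (w x)\<^sup>2 \<partial>\<mu>)"
      unfolding \<mu>_def by (subst integral_distr) (auto simp: lebesgue_integral_count_space_finite)
    also have "\<dots> \<le> 224 * cap\<^sup>2 * ((16 * c + 1) * 4 ^ J) / 2 ^ J"
    proof (rule integral_square_error_le[OF fin _ _ \<beta> _ _ r D u])
      show "AE x in \<mu>. x \<in> XX" unfolding \<mu>_def using X by (subst AE_distr_iff) (auto simp: AE_count_space)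
      show "measure \<mu> {x. cell R \<beta> (2 ^ (J + k)) x = a} \<le> (16 * c + 1) * 4 ^ J / 2 ^ k" if "k \<le> J" "a < 2 ^ (J + k)" for k a
        using reg net(1) that unfolding regular_def by (subst mass) (auto intro: less_imp_le)
    qed (use constants in \<open>auto simp: \<mu>_def\<close>)
    finally show ?thesis by (simp add: e42 mult_ac)
  qed
  have e3: "(\<integral>x. (w x)\<^sup>2 \<partial>Q) \<le> 224 * cap\<^sup>2 * c / 4 ^ J"
  proof -
    have "(\<integral>x. (w x)\<^sup>2 \<partial>Q) \<le> 224 * cap\<^sup>2 * (c / 2 ^ J) / 2 ^ J"
    proof (rule integral_square_error_le[OF _ sets_Q AE_XX \<beta> _ _ r D u])
      show "measure Q {x. cell R \<beta> (2 ^ (J + k)) x = a} \<le> c / 2 ^ J / 2 ^ k" for k a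
        using measure_cell_le[OF \<beta>, of "2 ^ (J + k)" a] by (simp add: power_add)
    qed (use constants in auto, unfold_locales)
    then show ?thesis by (simp add: e42)
  qed
  have e4: "(\<Sum>i=1..n. 2 * res i \<omega> * h (Xs i \<omega>) - (h (Xs i \<omega>))\<^sup>2 / 2) \<le> - (real n / 8 * (\<integral>x. (h x)\<^sup>2 \<partial>Q)) + 31 / tilt * 2 ^ J"
  proof -
    have "(\<Sum>i=1..n. tilt * (2 * res i \<omega> * h (Xs i \<omega>) - (h (Xs i \<omega>))\<^sup>2 / 2))
        < - (real n * (tilt / 8) * (\<integral>x. (h x)\<^sup>2 \<partial>Q)) + 31 * 2 ^ J"
      using reg net(1) m unfolding regular_def h_def by blast
    moreover have "tilt * (- (real n / 8 * (\<integral>x. (h x)\<^sup>2 \<partial>Q)) + 31 / tilt * 2 ^ J)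
        = - (real n * (tilt / 8) * (\<integral>x. (h x)\<^sup>2 \<partial>Q)) + 31 * 2 ^ J"
      using tilt(1) by (simp add: field_simps)
    ultimately have "tilt * (\<Sum>i=1..n. 2 * res i \<omega> * h (Xs i \<omega>) - (h (Xs i \<omega>))\<^sup>2 / 2)
        < tilt * (- (real n / 8 * (\<integral>x. (h x)\<^sup>2 \<partial>Q)) + 31 / tilt * 2 ^ J)"
      unfolding sum_distrib_left[symmetric] by (simp only:)
    then show ?thesis unfolding mult_less_cancel_left_pos[OF tilt(1)] by (rule less_imp_le)
  qed
  have wb: "\<bar>w x\<bar> \<le> 2 * cap" "\<bar>h x\<bar> \<le> cap + K0" if "x \<in> XX" for x
    using \<psi>(2)[of "\<alpha> \<bullet> x"] approx_bound[of J \<beta> m x] g0_bound[OF that] by (auto simp: w_def h_def)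
  have ib: "integrable Q (\<lambda>x. (w x)\<^sup>2)" "integrable Q (\<lambda>x. (h x)\<^sup>2)"
  proof -
    show "integrable Q (\<lambda>x. (w x)\<^sup>2)" using wb(1) by (intro integrable_square_bounded_on_XX) auto
    show "integrable Q (\<lambda>x. (h x)\<^sup>2)" using wb(2) by (intro integrable_square_bounded_on_XX) auto
  qed
  have e5: "(\<integral>x. (f x)\<^sup>2 \<partial>Q) \<le> 2 * (\<integral>x. (h x)\<^sup>2 \<partial>Q) + 2 * (\<integral>x. (w x)\<^sup>2 \<partial>Q)"
  proof -
    have "(\<integral>x. (f x)\<^sup>2 \<partial>Q) \<le> (\<integral>x. 2 * (h x)\<^sup>2 + 2 * (w x)\<^sup>2 \<partial>Q)"
    proof (rule integral_mono)
      show i: "integrable Q (\<lambda>x. 2 * (h x)\<^sup>2 + 2 * (w x)\<^sup>2)" using ib by simp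
      show "integrable Q (\<lambda>x. (f x)\<^sup>2)"
        by (rule Bochner_Integration.integrable_bound[OF i]) (use sq(2) in \<open>auto intro!: AE_I2\<close>)
    qed (rule sq)
    then show ?thesis using ib by simp
  qed
  have e6: "real n / 8 * (\<integral>x. (w x)\<^sup>2 \<partial>Q) \<le> 224 * cap\<^sup>2 * c * 2 ^ J"
  proof -
    have "real n / 8 * (\<integral>x. (w x)\<^sup>2 \<partial>Q) \<le> 8 ^ J * (224 * cap\<^sup>2 * c / 4 ^ J)"
      using n by (intro mult_mono e3 integral_nonneg_AE) auto
    then show ?thesis by (simp add: e84 mult_ac)
  qed
  have "(\<Sum>i=1..n. 2 * res i \<omega> * f (Xs i \<omega>) - (f (Xs i \<omega>))\<^sup>2)
      \<le> (\<Sum>i=1..n. (2 * res i \<omega> * h (Xs i \<omega>) - (h (Xs i \<omega>))\<^sup>2 / 2) + 2 * (res i \<omega> * w (Xs i \<omega>)) + (w (Xs i \<omega>))\<^sup>2)"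
  proof (rule sum_mono)
    fix i
    show "2 * res i \<omega> * f (Xs i \<omega>) - (f (Xs i \<omega>))\<^sup>2 \<le> (2 * res i \<omega> * h (Xs i \<omega>) - (h (Xs i \<omega>))\<^sup>2 / 2) + 2 * (res i \<omega> * w (Xs i \<omega>)) + (w (Xs i \<omega>))\<^sup>2"
      using sq(1)[of "Xs i \<omega>"] unfolding fwh by (simp add: algebra_simps)
  qed
  also have "\<dots> = (\<Sum>i=1..n. 2 * res i \<omega> * h (Xs i \<omega>) - (h (Xs i \<omega>))\<^sup>2 / 2) + 2 * (\<Sum>i=1..n. res i \<omega> * w (Xs i \<omega>)) + (\<Sum>i=1..n. (w (Xs i \<omega>))\<^sup>2)"
    by (simp add: sum.distrib sum_distrib_left)
  finally have s: "(\<Sum>i=1..n. 2 * res i \<omega> * f (Xs i \<omega>) - (f (Xs i \<omega>))\<^sup>2)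
      \<le> - (real n / 8 * (\<integral>x. (h x)\<^sup>2 \<partial>Q)) + 31 / tilt * 2 ^ J + 2 * (noise_const * 2 ^ J) + 224 * cap\<^sup>2 * (16 * c + 1) * 2 ^ J"
    using e1 e2 e4 by linarith
  have "real n / 16 * (\<integral>x. (f x)\<^sup>2 \<partial>Q) \<le> real n / 16 * (2 * (\<integral>x. (h x)\<^sup>2 \<partial>Q) + 2 * (\<integral>x. (w x)\<^sup>2 \<partial>Q))"
    by (intro mult_left_mono e5) auto
  also have "\<dots> = real n / 8 * (\<integral>x. (h x)\<^sup>2 \<partial>Q) + real n / 8 * (\<integral>x. (w x)\<^sup>2 \<partial>Q)" by (simp add: field_simps)
  finally have "(\<Sum>i=1..n. 2 * res i \<omega> * f (Xs i \<omega>) - (f (Xs i \<omega>))\<^sup>2) + real n / 16 * (\<integral>x. (f x)\<^sup>2 \<partial>Q)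
      \<le> 31 / tilt * 2 ^ J + 2 * (noise_const * 2 ^ J) + 224 * cap\<^sup>2 * (16 * c + 1) * 2 ^ J + 224 * cap\<^sup>2 * c * 2 ^ J"
    using s e6 by linarith
  also have "\<dots> = risk_const * 2 ^ J" by (simp add: risk_const_def algebra_simps)
  finally show ?thesis .
qed

text \<open>
  The index \<open>j\<close> is the first grid point inside the up-set \<open>U\<close>. It may also be \<open>8 ^ J + 1\<close>, beyond the range of all
  positions, if \<open>U\<close> contains no grid point.
\<close>

lemma halfspace_bracket:
  assumes \<alpha>: "\<alpha> \<in> sphere 0 1" and \<beta>: "\<beta> \<in> sphere 0 1" "norm (\<alpha> - \<beta>) \<le> 2 / 8 ^ J"
    and U: "\<And>s t. s \<in> U \<Longrightarrow> s \<le> t \<Longrightarrow> t \<in> U"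
  obtains j where "j \<le> 8 ^ J + 1" "\<And>x. x \<in> XX \<Longrightarrow> x \<in> halfspace J \<beta> j \<Longrightarrow> \<alpha> \<bullet> x \<in> U"
    "\<And>x. x \<in> XX \<Longrightarrow> \<alpha> \<bullet> x \<in> U \<Longrightarrow> x \<in> halfspace J \<beta> j \<union> shell J \<beta> j"
proof -
  define \<phi> where "\<phi> t = 2 * R * (t / 8 ^ J) - R" for t :: real
  have \<phi>: "\<phi> s \<le> \<phi> t" if "s \<le> t" for s t
    unfolding \<phi>_def using constants that by (intro diff_right_mono mult_left_mono divide_right_mono) auto
  define p where "p j \<longleftrightarrow> \<phi> (real j) \<in> U \<or> j = 8 ^ J + 1" for j :: nat
  define j where "j = (LEAST j. p j)"
  have pl: "p (8 ^ J + 1)" by (simp add: p_def)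
  have j: "p j" "j \<le> 8 ^ J + 1" unfolding j_def by (rule LeastI, rule pl) (rule Least_le, rule pl)
  have nj: "\<not> p i" if "i < j" for i using that unfolding j_def by (rule not_less_Least)
  show ?thesis
  proof (rule that[of j])
    fix x assume x: "x \<in> XX"
    define t where "t = 8 ^ J * pos R \<alpha> x"
    have ax: "\<alpha> \<bullet> x = \<phi> t" using constants by (simp add: t_def \<phi>_def pos_def)
    have t: "0 < t" "t < 8 ^ J" using pos_in_unit[OF \<alpha> x] by (auto simp: t_def)
    have cl: "\<bar>t - 8 ^ J * pos R \<beta> x\<bar> \<le> 1" unfolding t_def by (rule pos_net[OF \<alpha> x \<beta>(2)])
    show "\<alpha> \<bullet> x \<in> U" if "x \<in> halfspace J \<beta> j"
    proof -
      have "real j \<le> t" using that cl by (simp add: halfspace_def)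
      then have "j \<noteq> 8 ^ J + 1" using t by auto
      then have "\<phi> (real j) \<in> U" using j(1) by (simp add: p_def)
      then show ?thesis unfolding ax using U \<phi>[OF \<open>real j \<le> t\<close>] by blast
    qed
    show "x \<in> halfspace J \<beta> j \<union> shell J \<beta> j" if a: "\<alpha> \<bullet> x \<in> U"
    proof -
      have "real j - 1 < t"
      proof (cases j)
        case 0
        then show ?thesis using t by simp
      next
        case (Suc i)
        then have "\<phi> (real i) \<notin> U" using nj[of i] by (simp add: p_def)
        then have "\<not> t \<le> real i" using a U \<phi> unfolding ax by blast
        then show ?thesis using Suc by simp
      qed
      then show ?thesis using cl by (auto simp: halfspace_def shell_def)
    qed
  qed (rule j)
qed

definition excess_slack :: "nat \<Rightarrow> real" where
  "excess_slack J = 2 / l * (24 * \<gamma> * c + (real J)\<^sup>2)"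

lemma halfspace_residuals_le:
  assumes reg: "regular S J n \<omega>" and S: "S \<subseteq> sphere 0 1"
    and net: "\<beta> \<in> S" "norm (\<alpha> - \<beta>) \<le> 2 / 8 ^ J" and \<alpha>: "\<alpha> \<in> sphere 0 1"
    and U: "\<And>s t. s \<in> U \<Longrightarrow> s \<le> t \<Longrightarrow> t \<in> U" and s: "s = 1 \<or> s = - 1"
  shows "(\<Sum>i\<in>{i\<in>{1..n}. \<alpha> \<bullet> Xs i \<omega> \<in> U}. s * res i \<omega> - \<gamma> * l / 2) \<le> excess_slack J"
proof -
  have \<beta>: "\<beta> \<in> sphere 0 1" using net S by blast
  have X: "Xs i \<omega> \<in> XX" if "i \<in> {1..n}" for i using reg that by (auto simp: regular_def)
  obtain j where j: "j \<le> 8 ^ J + 1" "\<And>x. x \<in> XX \<Longrightarrow> x \<in> halfspace J \<beta> j \<Longrightarrow> \<alpha> \<bullet> x \<in> U"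
    "\<And>x. x \<in> XX \<Longrightarrow> \<alpha> \<bullet> x \<in> U \<Longrightarrow> x \<in> halfspace J \<beta> j \<union> shell J \<beta> j"
    by (rule halfspace_bracket[OF \<alpha> \<beta> net(2) U]) (assumption | rule that)+
  have "(\<Sum>i\<in>{i\<in>{1..n}. \<alpha> \<bullet> Xs i \<omega> \<in> U}. s * res i \<omega> - \<gamma> * l / 2)
      = (\<Sum>i=1..n. if \<alpha> \<bullet> Xs i \<omega> \<in> U then s * res i \<omega> - \<gamma> * l / 2 else 0)"
    by (rule sum.inter_filter) simp
  also have "\<dots> \<le> (\<Sum>i=1..n. (s * res i \<omega> - \<gamma> * l / 2) * indicator (halfspace J \<beta> j) (Xs i \<omega>)
          + \<bar>res i \<omega>\<bar> * indicator (shell J \<beta> j) (Xs i \<omega>))"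
  proof (rule sum_mono)
    fix i assume i: "i \<in> {1..n}"
    note x = j(2,3)[OF X[OF i]]
    have "0 \<le> \<gamma> * l" using constants by simp
    then have "s * res i \<omega> - \<gamma> * l / 2 \<le> \<bar>res i \<omega>\<bar>" using s by auto
    moreover have "x \<in> halfspace J \<beta> j \<Longrightarrow> x \<notin> shell J \<beta> j" for x by (auto simp: halfspace_def shell_def)
    ultimately show "(if \<alpha> \<bullet> Xs i \<omega> \<in> U then s * res i \<omega> - \<gamma> * l / 2 else 0)
        \<le> (s * res i \<omega> - \<gamma> * l / 2) * indicator (halfspace J \<beta> j) (Xs i \<omega>) + \<bar>res i \<omega>\<bar> * indicator (shell J \<beta> j) (Xs i \<omega>)"
      using x by (cases "Xs i \<omega> \<in> halfspace J \<beta> j"; cases "Xs i \<omega> \<in> shell J \<beta> j") auto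
  qed
  also have "\<dots> \<le> excess_slack J"
  proof -
    have "(\<Sum>i=1..n. l / 2 * ((s * res i \<omega> - \<gamma> * l / 2) * indicator (halfspace J \<beta> j) (Xs i \<omega>)
          + \<bar>res i \<omega>\<bar> * indicator (shell J \<beta> j) (Xs i \<omega>))) < 24 * \<gamma> * c + (real J)\<^sup>2"
      using reg net(1) j(1) s unfolding regular_def by blast
    then have "l / 2 * (\<Sum>i=1..n. (s * res i \<omega> - \<gamma> * l / 2) * indicator (halfspace J \<beta> j) (Xs i \<omega>)
          + \<bar>res i \<omega>\<bar> * indicator (shell J \<beta> j) (Xs i \<omega>)) < l / 2 * excess_slack J"
      unfolding sum_distrib_left[symmetric] excess_slack_def using constants by simp
    then show ?thesis using constants by simp
  qed
  finally show ?thesis .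
qed

lemma halfspace_mass_le:
  assumes reg: "regular S J n \<omega>" and S: "S \<subseteq> sphere 0 1"
    and net: "\<beta> \<in> S" "norm (\<alpha> - \<beta>) \<le> 2 / 8 ^ J" and \<alpha>: "\<alpha> \<in> sphere 0 1"
    and U: "\<And>s t. s \<in> U \<Longrightarrow> s \<le> t \<Longrightarrow> t \<in> U" and n: "real n \<le> 8 * 8 ^ J"
    and H[measurable]: "{x. \<alpha> \<bullet> x \<in> U} \<in> sets borel"
  shows "real n * measure Q {x. \<alpha> \<bullet> x \<in> U} \<le> 2 * real (card {i\<in>{1..n}. \<alpha> \<bullet> Xs i \<omega> \<in> U}) + (2 * (real J)\<^sup>2 + 24 * c)"
proof -
  have \<beta>: "\<beta> \<in> sphere 0 1" using net S by blast
  have X: "Xs i \<omega> \<in> XX" if "i \<in> {1..n}" for i using reg that by (auto simp: regular_def)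
  obtain j where j: "j \<le> 8 ^ J + 1" "\<And>x. x \<in> XX \<Longrightarrow> x \<in> halfspace J \<beta> j \<Longrightarrow> \<alpha> \<bullet> x \<in> U"
    "\<And>x. x \<in> XX \<Longrightarrow> \<alpha> \<bullet> x \<in> U \<Longrightarrow> x \<in> halfspace J \<beta> j \<union> shell J \<beta> j"
    by (rule halfspace_bracket[OF \<alpha> \<beta> net(2) U]) (assumption | rule that)+
  have "measure Q {x. \<alpha> \<bullet> x \<in> U} \<le> measure Q (halfspace J \<beta> j \<union> shell J \<beta> j)"
    by (intro Q.finite_measure_mono_AE) (use AE_XX j(3) in \<open>auto elim!: eventually_mono\<close>)
  also have "\<dots> \<le> measure Q (halfspace J \<beta> j) + measure Q (shell J \<beta> j)"
    by (rule measure_Un_le) auto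
  also have "measure Q (shell J \<beta> j) \<le> 3 * c / 8 ^ J" by (rule measure_shell_le[OF \<beta>])
  finally have "real n * measure Q {x. \<alpha> \<bullet> x \<in> U} \<le> real n * (measure Q (halfspace J \<beta> j) + 3 * c / 8 ^ J)"
    by (intro mult_left_mono) auto
  also have "\<dots> = real n * measure Q (halfspace J \<beta> j) + real n * (3 * c / 8 ^ J)" by (simp add: distrib_left)
  also have "real n * (3 * c / 8 ^ J) \<le> 8 * 8 ^ J * (3 * c / 8 ^ J)" using n constants by (intro mult_right_mono) auto
  also have "8 * 8 ^ J * (3 * c / 8 ^ J) = 24 * c" by simp
  finally have 1: "real n * measure Q {x. \<alpha> \<bullet> x \<in> U} \<le> real n * measure Q (halfspace J \<beta> j) + 24 * c" by simp
  have "real n * measure Q (halfspace J \<beta> j) / 2 - (real J)\<^sup>2 < (\<Sum>i=1..n. indicator (halfspace J \<beta> j) (Xs i \<omega>))"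
    using reg net(1) j(1) unfolding regular_def by blast
  also have "\<dots> \<le> (\<Sum>i=1..n. if \<alpha> \<bullet> Xs i \<omega> \<in> U then 1 else 0)"
    using j(2) X by (intro sum_mono) (auto split: split_indicator)
  also have "\<dots> = real (card {i\<in>{1..n}. \<alpha> \<bullet> Xs i \<omega> \<in> U})" by (simp add: sum.If_cases Int_def)
  finally show ?thesis using 1 by linarith
qed

text \<open>
  The superlevel sets of a monotone ridge function are halfspaces, so the bounds for halfspaces integrate to
  bounds for the part of the function above the truncation level.
\<close>

lemma tail_excess_bounds:
  assumes reg: "regular S J n \<omega>" and S: "S \<subseteq> sphere 0 1"
    and net: "\<beta> \<in> S" "norm (\<alpha> - \<beta>) \<le> 2 / 8 ^ J" and \<alpha>: "\<alpha> \<in> sphere 0 1"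
    and \<psi>: "mono \<psi>" "\<And>t. \<bar>\<psi> t\<bar> \<le> W" and n: "real n \<le> 8 * 8 ^ J" "0 < n"
  defines "h \<equiv> \<lambda>x. max 0 (\<psi> (\<alpha> \<bullet> x) - cap)"
  shows "s = 1 \<or> s = - 1 \<Longrightarrow> (\<Sum>i=1..n. (s * res i \<omega> - \<gamma> * l / 2) * h (Xs i \<omega>)) \<le> excess_slack J * W"
    and "real n * (\<integral>x. (h x)\<^sup>2 \<partial>Q) \<le> 2 * (\<Sum>i=1..n. (h (Xs i \<omega>))\<^sup>2) + (2 * (real J)\<^sup>2 + 24 * c) * W\<^sup>2"
proof -
  have K: "cap > 0" by (rule cap)
  have W: "0 \<le> W" using \<psi>(2)[of 0] by linarith
  have h: "0 \<le> h x" "h x \<le> W" for x using \<psi>(2)[of "\<alpha> \<bullet> x"] K W by (auto simp: h_def)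
  have [measurable]: "h \<in> borel_measurable borel" unfolding h_def using \<psi>(1) by measurable
  show "(\<Sum>i=1..n. (s * res i \<omega> - \<gamma> * l / 2) * h (Xs i \<omega>)) \<le> excess_slack J * W" if s: "s = 1 \<or> s = - 1"
  proof (rule layer_cake_sum_le)
    fix v :: real assume "0 \<le> v"
    define U where "U = {t. v < max 0 (\<psi> t - cap)}"
    have U: "t \<in> U" if "s \<in> U" "s \<le> t" for s t using that monoD[OF \<psi>(1) that(2)] by (auto simp: U_def)
    have "(\<Sum>i\<in>{i\<in>{1..n}. \<alpha> \<bullet> Xs i \<omega> \<in> U}. s * res i \<omega> - \<gamma> * l / 2) \<le> excess_slack J"
      by (rule halfspace_residuals_le[OF reg S net \<alpha> U s])
    then show "(\<Sum>i\<in>{i\<in>{1..n}. v < h (Xs i \<omega>)}. s * res i \<omega> - \<gamma> * l / 2) \<le> excess_slack J"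
      by (simp add: U_def h_def)
  qed (use h W in auto)
  define \<nu> where "\<nu> = point_measure {1..n} (\<lambda>i. ennreal (2 / real n))"
  define q where "q = (2 * (real J)\<^sup>2 + 24 * c) / real n"
  have q: "0 \<le> q" using constants by (simp add: q_def)
  have fin\<nu>: "finite_measure \<nu>"
    unfolding \<nu>_def by (rule finite_measureI) (simp add: emeasure_point_measure_finite space_point_measure ennreal_mult_eq_top_iff)
  have "(\<integral>\<^sup>+x. ennreal ((h x)\<^sup>2) \<partial>Q) \<le> (\<integral>\<^sup>+i. ennreal ((h (Xs i \<omega>))\<^sup>2) \<partial>\<nu>) + ennreal (q * W\<^sup>2)"
  proof (rule layer_cake_nn_integral_le)
    show "sigma_finite_measure Q" by unfold_locales
    show "sigma_finite_measure \<nu>" using fin\<nu> by (simp add: finite_measure_def)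
    show "(h x)\<^sup>2 \<le> W\<^sup>2" for x using h[of x] by (intro power_mono) auto
    fix v :: real assume v: "0 \<le> v"
    define U where "U = {t. v < (max 0 (\<psi> t - cap))\<^sup>2}"
    have U: "t \<in> U" if "s \<in> U" "s \<le> t" for s t
    proof -
      have "(max 0 (\<psi> s - cap))\<^sup>2 \<le> (max 0 (\<psi> t - cap))\<^sup>2"
        using monoD[OF \<psi>(1) that(2)] by (intro power_mono) auto
      then show ?thesis using that(1) unfolding U_def mem_Collect_eq by linarith
    qed
    have eqU: "{x. \<alpha> \<bullet> x \<in> U} = {x. v < (h x)\<^sup>2}" by (simp add: U_def h_def)
    define k where "k = card {i\<in>{1..n}. v < (h (Xs i \<omega>))\<^sup>2}"
    have "real n * measure Q {x. \<alpha> \<bullet> x \<in> U} \<le> 2 * real (card {i\<in>{1..n}. \<alpha> \<bullet> Xs i \<omega> \<in> U}) + (2 * (real J)\<^sup>2 + 24 * c)"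
    proof (rule halfspace_mass_le[OF reg S net \<alpha> U n(1)])
      show "{x. \<alpha> \<bullet> x \<in> U} \<in> sets borel" unfolding eqU by measurable
    qed
    then have "real n * measure Q {x. v < (h x)\<^sup>2} \<le> 2 * real k + (2 * (real J)\<^sup>2 + 24 * c)"
      unfolding eqU k_def by (simp add: U_def h_def)
    then have "measure Q {x. v < (h x)\<^sup>2} \<le> 2 / real n * real k + q"
      using n(2) by (simp add: q_def field_simps)
    then have "emeasure Q {x. v < (h x)\<^sup>2} \<le> ennreal (2 / real n * real k + q)"
      by (simp add: Q.emeasure_eq_measure ennreal_leI)
    also have "\<dots> = ennreal (2 / real n) * of_nat k + ennreal q"
      using q by (simp add: ennreal_of_nat_eq_real_of_nat flip: ennreal_mult')
    also have "ennreal (2 / real n) * of_nat k = emeasure \<nu> {i\<in>space \<nu>. v < (h (Xs i \<omega>))\<^sup>2}"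
      unfolding \<nu>_def by (subst emeasure_point_measure_finite) (auto simp: space_point_measure k_def mult.commute)
    finally show "emeasure Q {x\<in>space Q. v < (h x)\<^sup>2} \<le> emeasure \<nu> {i\<in>space \<nu>. v < (h (Xs i \<omega>))\<^sup>2} + ennreal q"
      by simp
  qed (auto simp: \<nu>_def measurable_point_measure_eq1)
  also have "(\<integral>\<^sup>+i. ennreal ((h (Xs i \<omega>))\<^sup>2) \<partial>\<nu>) = ennreal (2 / real n * (\<Sum>i=1..n. (h (Xs i \<omega>))\<^sup>2))"
    unfolding \<nu>_def by (subst nn_integral_point_measure_finite)
      (auto simp: sum_ennreal ennreal_mult'[symmetric] sum_distrib_left sum_divide_distrib mult.commute)
  finally have "(\<integral>\<^sup>+x. ennreal ((h x)\<^sup>2) \<partial>Q) \<le> ennreal (2 / real n * (\<Sum>i=1..n. (h (Xs i \<omega>))\<^sup>2) + q * W\<^sup>2)"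
    using q by (simp add: sum_nonneg)
  then have "(\<integral>x. (h x)\<^sup>2 \<partial>Q) \<le> 2 / real n * (\<Sum>i=1..n. (h (Xs i \<omega>))\<^sup>2) + q * W\<^sup>2"
  proof (subst integral_eq_nn_integral)
    have "0 \<le> 2 / real n * (\<Sum>i=1..n. (h (Xs i \<omega>))\<^sup>2)" by (intro mult_nonneg_nonneg sum_nonneg) auto
    moreover assume "(\<integral>\<^sup>+x. ennreal ((h x)\<^sup>2) \<partial>Q) \<le> ennreal (2 / real n * (\<Sum>i=1..n. (h (Xs i \<omega>))\<^sup>2) + q * W\<^sup>2)"
    ultimately show "enn2real (\<integral>\<^sup>+x. ennreal ((h x)\<^sup>2) \<partial>Q) \<le> 2 / real n * (\<Sum>i=1..n. (h (Xs i \<omega>))\<^sup>2) + q * W\<^sup>2"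
      using q by (intro enn2real_leI) auto
  qed auto
  then have "real n * (\<integral>x. (h x)\<^sup>2 \<partial>Q) \<le> real n * (2 / real n * (\<Sum>i=1..n. (h (Xs i \<omega>))\<^sup>2) + q * W\<^sup>2)"
    by (intro mult_left_mono) auto
  also have "\<dots> = 2 * (\<Sum>i=1..n. (h (Xs i \<omega>))\<^sup>2) + (2 * (real J)\<^sup>2 + 24 * c) * W\<^sup>2"
    using n(2) by (simp add: q_def distrib_left)
  finally show "real n * (\<integral>x. (h x)\<^sup>2 \<partial>Q) \<le> 2 * (\<Sum>i=1..n. (h (Xs i \<omega>))\<^sup>2) + (2 * (real J)\<^sup>2 + 24 * c) * W\<^sup>2" .
qed


text \<open>
  Decompose \<open>f = d + hp - hm\<close> into the truncated error and the excesses on both sides. Where \<open>hp\<close> is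
  positive, \<open>d\<close> equals \<open>cap - g0 x\<close> and is at least \<open>\<gamma> * l / 2\<close>; so the cross term \<open>- 2 * d * hp\<close> of the square
  subtracts this constant from the noise, as the bound for the noise in halfspaces requires. The lower excess is the
  upper excess of the function \<open>- \<psi> (- t)\<close> in the direction \<open>- \<alpha>\<close>.
\<close>

lemma least_squares_error_bound:
  assumes reg: "regular S J n \<omega>" and S: "S \<subseteq> sphere 0 1"
    and net: "\<And>\<alpha>. \<alpha> \<in> sphere 0 1 \<Longrightarrow> \<exists>\<beta>\<in>S. norm (\<alpha> - \<beta>) \<le> 2 / 8 ^ J"
    and \<alpha>: "\<alpha> \<in> sphere 0 1" and \<psi>: "mono \<psi>" "\<And>t. \<bar>\<psi> t\<bar> \<le> W"
    and n: "real n \<le> 8 * 8 ^ J" "0 < n"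
  defines "f \<equiv> \<lambda>x. \<psi> (\<alpha> \<bullet> x) - g0 x"
  assumes basic: "0 \<le> (\<Sum>i=1..n. 2 * res i \<omega> * f (Xs i \<omega>) - (f (Xs i \<omega>))\<^sup>2)"
  shows "real n * (\<integral>x. (f x)\<^sup>2 \<partial>Q) \<le> 54 * (risk_const * 2 ^ J + 4 * (excess_slack J * W)) + 6 * ((2 * (real J)\<^sup>2 + 24 * c) * W\<^sup>2)"
proof -
  have K: "cap > 0" "K0 \<le> cap" "cap - K0 = \<gamma> * l / 2" by (rule cap)+
  have X: "Xs i \<omega> \<in> XX" if "i \<in> {1..n}" for i using reg that by (auto simp: regular_def)
  obtain \<beta> where \<beta>: "\<beta> \<in> S" "norm (\<alpha> - \<beta>) \<le> 2 / 8 ^ J" using net \<alpha> by blast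
  have \<alpha>': "- \<alpha> \<in> sphere 0 1" using \<alpha> by simp
  obtain \<beta>' where \<beta>': "\<beta>' \<in> S" "norm (- \<alpha> - \<beta>') \<le> 2 / 8 ^ J" using net \<alpha>' by blast
  define \<psi>c where "\<psi>c t = max (- cap) (min cap (\<psi> t))" for t
  define \<psi>m where "\<psi>m t = - \<psi> (- t)" for t
  have mc: "mono \<psi>c" "mono \<psi>m"
    using monoD[OF \<psi>(1)] unfolding \<psi>c_def[abs_def] \<psi>m_def[abs_def]
    by (intro monoI max.mono min.mono order.refl; simp)+
  have bc: "\<bar>\<psi>c t\<bar> \<le> cap" for t using K by (auto simp: \<psi>c_def)
  have bm: "\<bar>\<psi>m t\<bar> \<le> W" for t using \<psi>(2) by (simp add: \<psi>m_def)
  define d where "d x = \<psi>c (\<alpha> \<bullet> x) - g0 x" for x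
  define hp where "hp x = max 0 (\<psi> (\<alpha> \<bullet> x) - cap)" for x
  define hm where "hm x = max 0 (\<psi>m ((- \<alpha>) \<bullet> x) - cap)" for x
  define T where "T = excess_slack J * W"
  have core: "(\<Sum>i=1..n. 2 * res i \<omega> * d (Xs i \<omega>) - (d (Xs i \<omega>))\<^sup>2) + real n / 16 * (\<integral>x. (d x)\<^sup>2 \<partial>Q) \<le> risk_const * 2 ^ J"
    unfolding d_def by (rule bounded_ridge_inequality[OF reg S \<beta> \<alpha> mc(1) bc n(1)])
  note tp = tail_excess_bounds[OF reg S \<beta> \<alpha> \<psi> n, folded hp_def T_def]
  note tm = tail_excess_bounds[OF reg S \<beta>' \<alpha>' mc(2) bm n, folded hm_def T_def]
  have p1: "(\<Sum>i=1..n. (1 * res i \<omega> - \<gamma> * l / 2) * hp (Xs i \<omega>)) \<le> T"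
    and p2: "real n * (\<integral>x. (hp x)\<^sup>2 \<partial>Q) \<le> 2 * (\<Sum>i=1..n. (hp (Xs i \<omega>))\<^sup>2) + (2 * (real J)\<^sup>2 + 24 * c) * W\<^sup>2"
    using tp(1)[of 1] tp(2) by simp_all
  have m1: "(\<Sum>i=1..n. (- 1 * res i \<omega> - \<gamma> * l / 2) * hm (Xs i \<omega>)) \<le> T"
    and m2: "real n * (\<integral>x. (hm x)\<^sup>2 \<partial>Q) \<le> 2 * (\<Sum>i=1..n. (hm (Xs i \<omega>))\<^sup>2) + (2 * (real J)\<^sup>2 + 24 * c) * W\<^sup>2"
    using tm(1)[of "- 1"] tm(2) by simp_all
  have dec: "f x = d x + hp x - hm x" for x
    using K by (auto simp: f_def d_def hp_def hm_def \<psi>c_def \<psi>m_def)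
  have pt: "2 * e * f x - (f x)\<^sup>2 \<le> (2 * e * d x - (d x)\<^sup>2) + 2 * ((1 * e - \<gamma> * l / 2) * hp x)
      + 2 * ((- 1 * e - \<gamma> * l / 2) * hm x) - (hp x)\<^sup>2 - (hm x)\<^sup>2" if x: "x \<in> XX" for x e
  proof -
    have g: "\<bar>g0 x\<bar> \<le> K0" by (rule g0_bound[OF x])
    have m: "(- \<alpha>) \<bullet> x = - (\<alpha> \<bullet> x)" by simp
    consider "\<psi> (\<alpha> \<bullet> x) > cap" | "\<psi> (\<alpha> \<bullet> x) < - cap" | "\<bar>\<psi> (\<alpha> \<bullet> x)\<bar> \<le> cap" by linarith
    then consider "hp x = 0" "hm x = 0" | "hm x = 0" "hp x > 0" "d x \<ge> \<gamma> * l / 2" | "hp x = 0" "hm x > 0" "d x \<le> - (\<gamma> * l / 2)"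
    proof cases
      case 1
      then have "hm x = 0" "hp x > 0" "d x = cap - g0 x"
        using K unfolding hp_def hm_def d_def \<psi>c_def \<psi>m_def m by auto
      then show ?thesis using that(2) g K by linarith
    next
      case 2
      then have "hp x = 0" "hm x > 0" "d x = - cap - g0 x"
        using K unfolding hp_def hm_def d_def \<psi>c_def \<psi>m_def m by auto
      then show ?thesis using that(3) g K by linarith
    next
      case 3
      then have "hp x = 0" "hm x = 0"
        using K unfolding hp_def hm_def \<psi>m_def m by auto
      then show ?thesis by (rule that(1))
    qed
    then show ?thesis
    proof cases
      case 1
      then show ?thesis by (simp add: dec)
    next
      case 2
      have "(\<gamma> * l / 2) * hp x \<le> d x * hp x" using 2 by (intro mult_right_mono) auto
      then show ?thesis using 2 by (simp add: dec power2_eq_square algebra_simps)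
    next
      case 3
      have "(\<gamma> * l / 2) * hm x \<le> - d x * hm x" using 3 by (intro mult_right_mono) auto
      then show ?thesis using 3 by (simp add: dec power2_eq_square algebra_simps)
    qed
  qed
  have "(\<Sum>i=1..n. 2 * res i \<omega> * f (Xs i \<omega>) - (f (Xs i \<omega>))\<^sup>2)
      \<le> (\<Sum>i=1..n. (2 * res i \<omega> * d (Xs i \<omega>) - (d (Xs i \<omega>))\<^sup>2) + 2 * ((1 * res i \<omega> - \<gamma> * l / 2) * hp (Xs i \<omega>))
      + 2 * ((- 1 * res i \<omega> - \<gamma> * l / 2) * hm (Xs i \<omega>)) - (hp (Xs i \<omega>))\<^sup>2 - (hm (Xs i \<omega>))\<^sup>2)"
    by (rule sum_mono) (rule pt[OF X])
  also have "\<dots> = (\<Sum>i=1..n. 2 * res i \<omega> * d (Xs i \<omega>) - (d (Xs i \<omega>))\<^sup>2)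
      + 2 * (\<Sum>i=1..n. (1 * res i \<omega> - \<gamma> * l / 2) * hp (Xs i \<omega>)) + 2 * (\<Sum>i=1..n. (- 1 * res i \<omega> - \<gamma> * l / 2) * hm (Xs i \<omega>))
      - (\<Sum>i=1..n. (hp (Xs i \<omega>))\<^sup>2) - (\<Sum>i=1..n. (hm (Xs i \<omega>))\<^sup>2)"
    by (simp only: sum.distrib sum_subtractf sum_distrib_left)
  finally have b: "real n / 16 * (\<integral>x. (d x)\<^sup>2 \<partial>Q) + (\<Sum>i=1..n. (hp (Xs i \<omega>))\<^sup>2) + (\<Sum>i=1..n. (hm (Xs i \<omega>))\<^sup>2) \<le> risk_const * 2 ^ J + 4 * T"
    using basic core p1 m1 by linarith
  have nn: "0 \<le> (\<Sum>i=1..n. (hp (Xs i \<omega>))\<^sup>2)" "0 \<le> (\<Sum>i=1..n. (hm (Xs i \<omega>))\<^sup>2)" "0 \<le> real n / 16 * (\<integral>x. (d x)\<^sup>2 \<partial>Q)"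
    by (auto intro!: sum_nonneg mult_nonneg_nonneg)
  have [measurable]: "d \<in> borel_measurable borel" "hp \<in> borel_measurable borel" "hm \<in> borel_measurable borel" "f \<in> borel_measurable borel"
    unfolding d_def[abs_def] hp_def[abs_def] hm_def[abs_def] f_def using mc \<psi>(1) by measurable
  have W: "0 \<le> W" using \<psi>(2)[of 0] by linarith
  have ib: "integrable Q (\<lambda>x. (d x)\<^sup>2)" "integrable Q (\<lambda>x. (hp x)\<^sup>2)" "integrable Q (\<lambda>x. (hm x)\<^sup>2)"
  proof -
    have "\<bar>d x\<bar> \<le> cap + K0" if "x \<in> XX" for x using bc[of "\<alpha> \<bullet> x"] g0_bound[OF that] by (auto simp: d_def)
    then show "integrable Q (\<lambda>x. (d x)\<^sup>2)"
      by (intro integrable_square_bounded_on_XX) auto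
    have "\<bar>hp x\<bar> \<le> W" "\<bar>hm x\<bar> \<le> W" for x
      using \<psi>(2)[of "\<alpha> \<bullet> x"] bm[of "(- \<alpha>) \<bullet> x"] K W by (auto simp: hp_def hm_def)
    then show "integrable Q (\<lambda>x. (hp x)\<^sup>2)" "integrable Q (\<lambda>x. (hm x)\<^sup>2)"
      by (auto intro!: integrable_square_bounded_on_XX[of _ W])
  qed
  have "(\<integral>x. (f x)\<^sup>2 \<partial>Q) \<le> (\<integral>x. 3 * (d x)\<^sup>2 + 3 * (hp x)\<^sup>2 + 3 * (hm x)\<^sup>2 \<partial>Q)"
  proof (rule integral_mono)
    show i: "integrable Q (\<lambda>x. 3 * (d x)\<^sup>2 + 3 * (hp x)\<^sup>2 + 3 * (hm x)\<^sup>2)" using ib by simp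
    show le: "(f x)\<^sup>2 \<le> 3 * (d x)\<^sup>2 + 3 * (hp x)\<^sup>2 + 3 * (hm x)\<^sup>2" for x
      using zero_le_power2[of "d x - hp x"] zero_le_power2[of "d x + hm x"] zero_le_power2[of "hp x + hm x"]
      unfolding dec by (simp add: power2_eq_square algebra_simps)
    show "integrable Q (\<lambda>x. (f x)\<^sup>2)"
      by (rule Bochner_Integration.integrable_bound[OF i]) (use le in \<open>auto intro!: AE_I2\<close>)
  qed
  also have "\<dots> = 3 * (\<integral>x. (d x)\<^sup>2 \<partial>Q) + 3 * (\<integral>x. (hp x)\<^sup>2 \<partial>Q) + 3 * (\<integral>x. (hm x)\<^sup>2 \<partial>Q)"
    using ib by simp
  finally have "real n * (\<integral>x. (f x)\<^sup>2 \<partial>Q) \<le> real n * (3 * (\<integral>x. (d x)\<^sup>2 \<partial>Q) + 3 * (\<integral>x. (hp x)\<^sup>2 \<partial>Q) + 3 * (\<integral>x. (hm x)\<^sup>2 \<partial>Q))"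
    by (rule mult_left_mono) simp
  also have "\<dots> = 48 * (real n / 16 * (\<integral>x. (d x)\<^sup>2 \<partial>Q)) + 3 * (real n * (\<integral>x. (hp x)\<^sup>2 \<partial>Q)) + 3 * (real n * (\<integral>x. (hm x)\<^sup>2 \<partial>Q))"
    by (simp add: algebra_simps)
  finally have F: "real n * (\<integral>x. (f x)\<^sup>2 \<partial>Q) \<le> 48 * (real n / 16 * (\<integral>x. (d x)\<^sup>2 \<partial>Q)) + 3 * (real n * (\<integral>x. (hp x)\<^sup>2 \<partial>Q)) + 3 * (real n * (\<integral>x. (hm x)\<^sup>2 \<partial>Q))" .
  (* 48 = 3 * 16 for the truncated error, and 3 * 2 more for the two excesses *)
  have lin: "F \<le> 54 * z + 6 * y" if "F \<le> 48 * x + 3 * p + 3 * q" "x + a + b \<le> z" "0 \<le> a" "0 \<le> b" "0 \<le> x"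
    "p \<le> 2 * a + y" "q \<le> 2 * b + y" for F x p q a b y z :: real
    using that by linarith
  show ?thesis using lin[OF F b nn p2 m2] unfolding T_def .
qed

section \<open>Probability of the regular event\<close>

lemma emeasure_finite_Union_le:
  assumes "finite I" "\<And>i. i \<in> I \<Longrightarrow> A i \<in> sets M" "\<And>i. i \<in> I \<Longrightarrow> emeasure M (A i) \<le> ennreal e" "0 \<le> e"
    "real (card I) \<le> k"
  shows "emeasure M (\<Union>i\<in>I. A i) \<le> ennreal (k * e)"
proof -
  have "emeasure M (\<Union>i\<in>I. A i) \<le> (\<Sum>i\<in>I. emeasure M (A i))"
    using assms by (intro emeasure_subadditive_finite) auto
  also have "\<dots> \<le> (\<Sum>i\<in>I. ennreal e)" by (intro sum_mono assms)
  also have "\<dots> = ennreal (real (card I) * e)"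
    using assms by (simp add: ennreal_mult' ennreal_of_nat_eq_real_of_nat)
  also have "\<dots> \<le> ennreal (k * e)" using assms by (intro ennreal_leI mult_right_mono) auto
  finally show ?thesis .
qed

text \<open>
  A union bound. The \<open>exp (30 * 2 ^ J)\<close> codes are paid for by the slack \<open>31 * 2 ^ J\<close> in the definition of
  the regular event; all other families are of polynomial size in \<open>8 ^ J\<close>.
\<close>

lemma prob_not_regular:
  assumes S: "finite S" "S \<subseteq> sphere 0 1" and n: "real n \<le> 8 * 8 ^ J" and J: "2 * (3/4) ^ J \<le> l"
  obtains E where "E \<in> sets M" "{\<omega>\<in>space M. \<not> regular S J n \<omega>} \<subseteq> E"
    "emeasure M E \<le> ennreal (real n * (\<gamma> * exp (- (l * (real J)\<^sup>2)))
       + real (card S) * (1 + real (J + 1) + real (J + 1) * 4 ^ J + 4 ^ J) * exp (- (2 ^ J))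
       + real (card S) * (3 * (8 ^ J + 2)) * exp (- (real J)\<^sup>2))"
proof -
  have sph: "\<beta> \<in> sphere 0 1" if "\<beta> \<in> S" for \<beta> using S that by blast
  have e84: "(8::real) ^ J = 2 ^ J * 4 ^ J" by (simp flip: power_mult_distrib)
  have e42: "(4::real) ^ J = 2 ^ J * 2 ^ J" by (simp flip: power_mult_distrib)
  have e42n: "(4::nat) ^ J = 2 ^ J * 2 ^ J" by (simp flip: power_mult_distrib)
  define s where "s = real (card S)"
  define C where "C \<beta> m a = {x. cell R \<beta> m x = a}" for \<beta> :: "real ^ 'd" and m a
  have C[measurable]: "C \<beta> m a \<in> sets borel" for \<beta> m a unfolding C_def by (rule measurable_cell_eq)
  define E1 where "E1 i = {\<omega>\<in>space M. Xs i \<omega> \<notin> XX}" for i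
  define E2 where "E2 i = {\<omega>\<in>space M. (real J)\<^sup>2 \<le> \<bar>res i \<omega>\<bar>}" for i
  define f where "f \<beta> m x = approx J \<beta> m x - g0 x" for \<beta> m x
  have [measurable]: "f \<beta> m \<in> borel_measurable borel" for \<beta> m unfolding f_def[abs_def] by measurable
  define E3 where "E3 = (\<lambda>(\<beta>, m). {\<omega>\<in>space M. - (real n * (tilt / 8) * (\<integral>x. (f \<beta> m x)\<^sup>2 \<partial>Q)) + 31 * 2 ^ J
      \<le> (\<Sum>i=1..n. tilt * (2 * res i \<omega> * f \<beta> m (Xs i \<omega>) - (f \<beta> m (Xs i \<omega>))\<^sup>2 / 2))})"
  define E4 where "E4 = (\<lambda>(\<beta>, k). {\<omega>\<in>space M. 3 * 2 ^ J \<le> (3/2) ^ k / 2 ^ J * (\<Sum>a<2 ^ (J + k). max 0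
        (\<bar>\<Sum>i=1..n. indicator (C \<beta> (2 ^ (J + k)) a) (Xs i \<omega>) * res i \<omega>\<bar> - threshold J k))})"
  define E5 where "E5 = (\<lambda>(\<beta>, k, a). {\<omega>\<in>space M. (16 * c + 1) * 4 ^ J / 2 ^ k \<le> (\<Sum>i=1..n. indicator (C \<beta> (2 ^ (J + k)) a) (Xs i \<omega>))})"
  define E6 where "E6 = (\<lambda>(\<beta>, a). {\<omega>\<in>space M. (8 * \<gamma> * c + 1) * 2 ^ J
        \<le> (\<Sum>i=1..n. l * (\<bar>res i \<omega>\<bar> * indicator (C \<beta> (2 ^ (2 * J)) a) (Xs i \<omega>)))})"
  define E7 where "E7 = (\<lambda>(\<beta>, j, t). {\<omega>\<in>space M. 24 * \<gamma> * c + (real J)\<^sup>2 \<le>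
        (\<Sum>i=1..n. l / 2 * ((t * res i \<omega> - \<gamma> * l / 2) * indicator (halfspace J \<beta> j) (Xs i \<omega>)
          + \<bar>res i \<omega>\<bar> * indicator (shell J \<beta> j) (Xs i \<omega>)))})"
  define E8 where "E8 = (\<lambda>(\<beta>, j). {\<omega>\<in>space M. real n * (- measure Q (halfspace J \<beta> j) / 2) + (real J)\<^sup>2
        \<le> (\<Sum>i=1..n. - indicator (halfspace J \<beta> j) (Xs i \<omega>))})"
  define T1 where "T1 = {1..n}"
  define T3 where "T3 = S \<times> codes J"
  define T4 where "T4 = S \<times> {..J}"
  define T5 where "T5 = S \<times> {..J} \<times> {..<(4::nat) ^ J}"
  define T6 where "T6 = S \<times> {..<(4::nat) ^ J}"
  define T7 where "T7 = S \<times> {..(8::nat) ^ J + 1} \<times> {-1, 1 :: real}"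
  define T8 where "T8 = S \<times> {..(8::nat) ^ J + 1}"
  have fin: "finite T1" "finite T3" "finite T4" "finite T5" "finite T6" "finite T7" "finite T8"
    using S finite_codes by (auto simp: T1_def T3_def T4_def T5_def T6_def T7_def T8_def)
  have meas12: "E1 i \<in> sets M" "E2 i \<in> sets M" if "i \<in> T1" for i
  proof -
    have [measurable]: "Xs i \<in> borel_measurable M" "res i \<in> borel_measurable M"
      using Xs_Ys_measurable[of i] res_measurable[of i] that by (auto simp: T1_def)
    show "E1 i \<in> sets M" "E2 i \<in> sets M" unfolding E1_def E2_def by measurable
  qed
  have meas3: "E3 p \<in> sets M" for p unfolding E3_def by (cases p, simp only: prod.case) measurable
  have meas4: "E4 p \<in> sets M" for p unfolding E4_def by (cases p, simp only: prod.case) measurable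
  have meas5: "E5 p \<in> sets M" for p unfolding E5_def by (cases p, simp only: prod.case) measurable
  have meas6: "E6 p \<in> sets M" for p unfolding E6_def by (cases p, simp only: prod.case) measurable
  have meas7: "E7 p \<in> sets M" for p unfolding E7_def by (cases p, simp only: prod.case) measurable
  have meas8: "E8 p \<in> sets M" for p unfolding E8_def by (cases p, simp only: prod.case) measurable
  note meas = meas3 meas4 meas5 meas6 meas7 meas8
  have b1: "emeasure M (\<Union>i\<in>T1. E1 i) \<le> ennreal (real n * 0)"
    using meas12(1) by (intro emeasure_finite_Union_le fin) (auto simp: T1_def E1_def Xs_outside)
  have b2: "emeasure M (\<Union>i\<in>T1. E2 i) \<le> ennreal (real n * (\<gamma> * exp (- (l * (real J)\<^sup>2))))"
    using meas12(2) constants by (intro emeasure_finite_Union_le fin) (auto simp: T1_def E2_def intro!: residual_tail)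
  have b3: "emeasure M (\<Union>p\<in>T3. E3 p) \<le> ennreal (s * exp (30 * 2 ^ J) * exp (- (31 * 2 ^ J)))"
  proof (rule emeasure_finite_Union_le[OF fin(2) meas3])
    fix p assume "p \<in> T3"
    then obtain \<beta> m where p: "p = (\<beta>, m)" by (cases p)
    show "emeasure M (E3 p) \<le> ennreal (exp (- (31 * 2 ^ J)))"
      unfolding E3_def p prod.case
    proof (rule Chernoff_regression[OF _ _ tilt])
      show "\<bar>f \<beta> m x\<bar> \<le> cap + K0" if "x \<in> XX" for x
        using approx_bound[of J \<beta> m x] g0_bound[OF that] unfolding f_def by linarith
    qed simp
  next
    show "real (card T3) \<le> s * exp (30 * 2 ^ J)"
      using card_codes_le[of J] by (simp add: T3_def s_def card_cartesian_product mult_left_mono)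
  qed simp
  have b4: "emeasure M (\<Union>p\<in>T4. E4 p) \<le> ennreal (s * real (J + 1) * exp (- (2 ^ J)))"
  proof (rule emeasure_finite_Union_le[OF fin(3) meas4])
    fix p assume "p \<in> T4"
    then obtain \<beta> k where p: "p = (\<beta>, k)" and k: "k \<le> J" and \<beta>: "\<beta> \<in> sphere 0 1"
      using sph by (auto simp: T4_def)
    define r where "r = (3/2) ^ k / (2 :: real) ^ J"
    have eq: "2 * (1/2) ^ k * real (card {..<(2::nat) ^ (J + k)}) + 2 ^ J = (3 * 2 ^ J :: real)"
      by (simp add: power_add power_one_over)
    have "emeasure M {\<omega>\<in>space M. 2 * (1/2) ^ k * real (card {..<(2::nat) ^ (J + k)}) + 2 ^ J \<le>
      r * (\<Sum>a<2 ^ (J + k). max 0 (\<bar>\<Sum>i=1..n. indicator (C \<beta> (2 ^ (J + k)) a) (Xs i \<omega>) * res i \<omega>\<bar> - threshold J k))} \<le> ennreal (exp (- (2 ^ J)))"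
    proof (rule Chernoff_excess)
      show "disjoint_family_on (C \<beta> (2 ^ (J + k))) {..<2 ^ (J + k)}" by (auto simp: disjoint_family_on_def C_def)
      show "measure Q (C \<beta> (2 ^ (J + k)) a) \<le> c / 2 ^ (J + k)" for a
        using measure_cell_le[OF \<beta>, of "2 ^ (J + k)" a] by (simp add: C_def)
      show r0: "0 < r" by (simp add: r_def)
      have "(3/2 :: real) ^ k \<le> (3/2) ^ J" using k by (intro power_increasing) auto
      then have "r \<le> (3/2) ^ J / 2 ^ J" unfolding r_def by (intro divide_right_mono) auto
      also have "\<dots> = (3/4) ^ J" by (simp flip: power_divide)
      finally show "2 * r \<le> l" using J by simp
      have rr: "r\<^sup>2 * (c / 2 ^ (J + k)) * 8 ^ J = c * (9/8) ^ k"
      proof -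
        have "(3/2 :: real) ^ k * (3/2) ^ k / 2 ^ k = (9/8) ^ k" by (simp flip: power_divide power_mult_distrib)
        then show ?thesis by (simp add: r_def e84 e42 power2_eq_square power_add field_simps)
      qed
      have "real n * \<gamma> * r\<^sup>2 * (c / 2 ^ (J + k)) = \<gamma> * (r\<^sup>2 * (c / 2 ^ (J + k))) * real n" by simp
      also have "\<dots> \<le> \<gamma> * (r\<^sup>2 * (c / 2 ^ (J + k))) * (8 * 8 ^ J)"
        using n constants by (intro mult_left_mono) auto
      also have "\<dots> = 8 * \<gamma> * (r\<^sup>2 * (c / 2 ^ (J + k)) * 8 ^ J)" by simp
      also have "\<dots> = 8 * c * \<gamma> * (9/8) ^ k" unfolding rr by simp
      finally have v: "real n * \<gamma> * r\<^sup>2 * (c / 2 ^ (J + k)) \<le> 8 * c * \<gamma> * (9/8) ^ k" .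
      have "r * threshold J k = (8 * c * \<gamma> + 8) * ((3/2) ^ k * (3/4) ^ k)" by (simp add: r_def threshold_def)
      also have "(3/2 :: real) ^ k * (3/4) ^ k = (9/8) ^ k" by (simp flip: power_mult_distrib)
      finally have "r * threshold J k = 8 * c * \<gamma> * (9/8) ^ k + 8 * (9/8) ^ k" by (simp add: algebra_simps)
      with v have "real n * \<gamma> * r\<^sup>2 * (c / 2 ^ (J + k)) - r * threshold J k \<le> - (8 * (9/8) ^ k)" by linarith
      also have "\<dots> \<le> - real k"
        using Bernoulli_inequality[of "1/8 :: real" k] by simp
      finally have "exp (real n * \<gamma> * r\<^sup>2 * (c / 2 ^ (J + k)) - r * threshold J k) \<le> exp (- real k)" by simp
      also have "\<dots> = exp (- 1) ^ k" by (simp flip: exp_of_nat_mult)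
      (* this offsets the factor 2 ^ k in the number of cells of the level *)
      also have "\<dots> \<le> (1/2) ^ k" using exp_minus_le_half[of 1] by (intro power_mono) auto
      finally show "exp (real n * \<gamma> * r\<^sup>2 * (c / 2 ^ (J + k)) - r * threshold J k) \<le> (1/2) ^ k" .
    qed simp_all
    then show "emeasure M (E4 p) \<le> ennreal (exp (- (2 ^ J)))"
      unfolding eq E4_def p prod.case r_def .
  qed (auto simp: T4_def s_def card_cartesian_product algebra_simps)
  have b5: "emeasure M (\<Union>p\<in>T5. E5 p) \<le> ennreal (s * (real (J + 1) * 4 ^ J) * exp (- (2 ^ J)))"
  proof (rule emeasure_finite_Union_le[OF fin(4) meas5])
    fix p assume "p \<in> T5"
    then obtain \<beta> k a where p: "p = (\<beta>, k, a)" and k: "k \<le> J" and \<beta>: "\<beta> \<in> sphere 0 1"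
      using sph by (auto simp: T5_def)
    have "emeasure M (E5 p) \<le> emeasure M {\<omega>\<in>space M. real n * (2 * (c / 2 ^ (J + k))) + 2 ^ J \<le> (\<Sum>i=1..n. indicator (C \<beta> (2 ^ (J + k)) a) (Xs i \<omega>))}"
    proof (rule emeasure_mono)
      have "real n * (2 * (c / 2 ^ (J + k))) \<le> 8 * 8 ^ J * (2 * (c / 2 ^ (J + k)))"
        using n constants by (intro mult_right_mono) auto
      also have "\<dots> = 16 * c * 4 ^ J / 2 ^ k" by (simp add: e84 power_add)
      finally have 1: "real n * (2 * (c / 2 ^ (J + k))) \<le> 16 * c * 4 ^ J / 2 ^ k" .
      have "(2::real) ^ J * 2 ^ k \<le> 4 ^ J" unfolding e42 using k by (intro mult_left_mono power_increasing) auto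
      then have "(2::real) ^ J \<le> 4 ^ J / 2 ^ k" by (simp add: pos_le_divide_eq)
      with 1 have "real n * (2 * (c / 2 ^ (J + k))) + 2 ^ J \<le> (16 * c + 1) * 4 ^ J / 2 ^ k"
        by (simp add: distrib_right add_divide_distrib)
      then show "E5 p \<subseteq> {\<omega>\<in>space M. real n * (2 * (c / 2 ^ (J + k))) + 2 ^ J \<le> (\<Sum>i=1..n. indicator (C \<beta> (2 ^ (J + k)) a) (Xs i \<omega>))}"
        unfolding E5_def p by auto
    qed measurable
    also have "\<dots> \<le> ennreal (exp (- (2 ^ J)))"
      using measure_cell_le[OF \<beta>, of "2 ^ (J + k)" a] by (intro Chernoff_count C) (simp add: C_def)
    finally show "emeasure M (E5 p) \<le> ennreal (exp (- (2 ^ J)))" .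
  qed (auto simp: T5_def s_def card_cartesian_product algebra_simps)
  have b6: "emeasure M (\<Union>p\<in>T6. E6 p) \<le> ennreal (s * 4 ^ J * exp (- (2 ^ J)))"
  proof (rule emeasure_finite_Union_le[OF fin(5) meas6])
    fix p assume "p \<in> T6"
    then obtain \<beta> a where p: "p = (\<beta>, a)" and \<beta>: "\<beta> \<in> sphere 0 1"
      using sph by (auto simp: T6_def)
    have e: "real (2 ^ (2 * J)) = 4 ^ J" by (simp add: power_mult)
    have "emeasure M (E6 p) \<le> emeasure M {\<omega>\<in>space M. real n * (\<gamma> * (c / 4 ^ J)) + 2 ^ J \<le>
        (\<Sum>i=1..n. l * (\<bar>res i \<omega>\<bar> * indicator (C \<beta> (2 ^ (2 * J)) a) (Xs i \<omega>)))}"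
    proof (rule emeasure_mono)
      have "real n * (\<gamma> * (c / 4 ^ J)) \<le> 8 * 8 ^ J * (\<gamma> * (c / 4 ^ J))"
        using n constants by (intro mult_right_mono) auto
      then have "real n * (\<gamma> * (c / 4 ^ J)) + 2 ^ J \<le> (8 * \<gamma> * c + 1) * 2 ^ J" by (simp add: e84 algebra_simps)
      then show "E6 p \<subseteq> {\<omega>\<in>space M. real n * (\<gamma> * (c / 4 ^ J)) + 2 ^ J \<le>
        (\<Sum>i=1..n. l * (\<bar>res i \<omega>\<bar> * indicator (C \<beta> (2 ^ (2 * J)) a) (Xs i \<omega>)))}"
        unfolding E6_def p by auto
    qed measurable
    also have "\<dots> \<le> ennreal (exp (- (2 ^ J)))"
      using measure_cell_le[OF \<beta>, of "2 ^ (2 * J)" a] unfolding e by (intro Chernoff_absolute_residuals C) (simp add: C_def)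
    finally show "emeasure M (E6 p) \<le> ennreal (exp (- (2 ^ J)))" .
  qed (auto simp: T6_def s_def card_cartesian_product)
  have b7: "emeasure M (\<Union>p\<in>T7. E7 p) \<le> ennreal (s * (2 * (8 ^ J + 2)) * exp (- (real J)\<^sup>2))"
  proof (rule emeasure_finite_Union_le[OF fin(6) meas7])
    fix p assume "p \<in> T7"
    then obtain \<beta> j t where p: "p = (\<beta>, j, t)" and t: "\<bar>t\<bar> = 1" and \<beta>: "\<beta> \<in> sphere 0 1"
      using sph by (auto simp: T7_def)
    have "emeasure M (E7 p) \<le> emeasure M {\<omega>\<in>space M. real n * (\<gamma> * (3 * c / 8 ^ J)) + (real J)\<^sup>2 \<le>
        (\<Sum>i=1..n. l / 2 * ((t * res i \<omega> - \<gamma> * l / 2) * indicator (halfspace J \<beta> j) (Xs i \<omega>)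
          + \<bar>res i \<omega>\<bar> * indicator (shell J \<beta> j) (Xs i \<omega>)))}"
    proof (rule emeasure_mono)
      have "real n * (\<gamma> * (3 * c / 8 ^ J)) \<le> 8 * 8 ^ J * (\<gamma> * (3 * c / 8 ^ J))"
        using n constants by (intro mult_right_mono) auto
      then have "real n * (\<gamma> * (3 * c / 8 ^ J)) + (real J)\<^sup>2 \<le> 24 * \<gamma> * c + (real J)\<^sup>2" by simp
      then show "E7 p \<subseteq> {\<omega>\<in>space M. real n * (\<gamma> * (3 * c / 8 ^ J)) + (real J)\<^sup>2 \<le>
        (\<Sum>i=1..n. l / 2 * ((t * res i \<omega> - \<gamma> * l / 2) * indicator (halfspace J \<beta> j) (Xs i \<omega>)
          + \<bar>res i \<omega>\<bar> * indicator (shell J \<beta> j) (Xs i \<omega>)))}"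
        unfolding E7_def p by auto
    qed measurable
    also have "\<dots> \<le> ennreal (exp (- (real J)\<^sup>2))"
    proof (rule Chernoff_halfspace_residuals[OF _ _ _ measure_shell_le[OF \<beta>] t])
      show "halfspace J \<beta> j \<inter> shell J \<beta> j = {}" by (auto simp: halfspace_def shell_def)
    qed simp_all
    finally show "emeasure M (E7 p) \<le> ennreal (exp (- (real J)\<^sup>2))" .
  qed (auto simp: T7_def s_def card_cartesian_product algebra_simps)
  have b8: "emeasure M (\<Union>p\<in>T8. E8 p) \<le> ennreal (s * (8 ^ J + 2) * exp (- (real J)\<^sup>2))"
  proof (rule emeasure_finite_Union_le[OF fin(7) meas8])
    fix p assume "p \<in> T8"
    obtain \<beta> j where p: "p = (\<beta>, j)" by (cases p)
    show "emeasure M (E8 p) \<le> ennreal (exp (- (real J)\<^sup>2))"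
      unfolding E8_def p prod.case by (rule Chernoff_count_lower) simp
  qed (auto simp: T8_def s_def card_cartesian_product algebra_simps)
  define E where "E = (\<Union>i\<in>T1. E1 i) \<union> (\<Union>i\<in>T1. E2 i) \<union> (\<Union>p\<in>T3. E3 p) \<union> (\<Union>p\<in>T4. E4 p)
    \<union> (\<Union>p\<in>T5. E5 p) \<union> (\<Union>p\<in>T6. E6 p) \<union> (\<Union>p\<in>T7. E7 p) \<union> (\<Union>p\<in>T8. E8 p)"
  have U: "(\<Union>i\<in>T1. E1 i) \<in> sets M" "(\<Union>i\<in>T1. E2 i) \<in> sets M" "(\<Union>p\<in>T3. E3 p) \<in> sets M" "(\<Union>p\<in>T4. E4 p) \<in> sets M"
    "(\<Union>p\<in>T5. E5 p) \<in> sets M" "(\<Union>p\<in>T6. E6 p) \<in> sets M" "(\<Union>p\<in>T7. E7 p) \<in> sets M" "(\<Union>p\<in>T8. E8 p) \<in> sets M"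
    using fin meas12 meas by (auto intro!: sets.finite_UN)
  show ?thesis
  proof (rule that[of E])
    show "E \<in> sets M" unfolding E_def by (intro sets.Un U)
    show "{\<omega>\<in>space M. \<not> regular S J n \<omega>} \<subseteq> E"
    proof (rule subsetI, rule ccontr)
      fix \<omega> assume "\<omega> \<in> {\<omega>\<in>space M. \<not> regular S J n \<omega>}" and nE: "\<omega> \<notin> E"
      then have \<omega>: "\<omega> \<in> space M" and nr: "\<not> regular S J n \<omega>" by auto
      have nU: "\<omega> \<notin> (\<Union>i\<in>T1. E1 i)" "\<omega> \<notin> (\<Union>i\<in>T1. E2 i)" "\<omega> \<notin> (\<Union>p\<in>T3. E3 p)"
        "\<omega> \<notin> (\<Union>p\<in>T4. E4 p)" "\<omega> \<notin> (\<Union>p\<in>T5. E5 p)" "\<omega> \<notin> (\<Union>p\<in>T6. E6 p)"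
        "\<omega> \<notin> (\<Union>p\<in>T7. E7 p)" "\<omega> \<notin> (\<Union>p\<in>T8. E8 p)"
        using nE unfolding E_def Un_iff de_Morgan_disj by (simp_all only: simp_thms)
      have "regular S J n \<omega>"
        unfolding regular_def
      proof (intro conjI ballI allI impI)
        fix i assume "i \<in> {1..n}"
        then show "Xs i \<omega> \<in> XX" "\<bar>res i \<omega>\<bar> < (real J)\<^sup>2"
          using nU(1,2) \<omega> by (auto simp: T1_def E1_def E2_def not_le)
      next
        fix \<beta> m assume "\<beta> \<in> S" "m \<in> codes J"
        then have "(\<beta>, m) \<in> T3" by (simp add: T3_def)
        then have "\<omega> \<notin> E3 (\<beta>, m)" using nU(3) by (simp only: UN_iff) blast
        then show "(\<Sum>i=1..n. tilt * (2 * res i \<omega> * (approx J \<beta> m (Xs i \<omega>) - g0 (Xs i \<omega>))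
          - (approx J \<beta> m (Xs i \<omega>) - g0 (Xs i \<omega>))\<^sup>2 / 2))
          < - (real n * (tilt / 8) * (\<integral>x. (approx J \<beta> m x - g0 x)\<^sup>2 \<partial>Q)) + 31 * 2 ^ J"
          using \<omega> unfolding E3_def f_def prod.case by (simp only: mem_Collect_eq not_le simp_thms)
      next
        fix \<beta> k assume "\<beta> \<in> S" "k \<le> J"
        then have "(\<beta>, k) \<in> T4" by (simp add: T4_def)
        then have "\<omega> \<notin> E4 (\<beta>, k)" using nU(4) by (simp only: UN_iff) blast
        then show "(3/2) ^ k / 2 ^ J * (\<Sum>a<2 ^ (J + k). max 0
          (\<bar>\<Sum>i=1..n. indicator {x. cell R \<beta> (2 ^ (J + k)) x = a} (Xs i \<omega>) * res i \<omega>\<bar> - threshold J k)) < 3 * 2 ^ J"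
          using \<omega> unfolding E4_def C_def prod.case by (simp only: mem_Collect_eq not_le simp_thms)
      next
        fix \<beta> k and a :: nat assume "\<beta> \<in> S" "k \<le> J" "a < 2 ^ (J + k)"
        moreover have "(2::nat) ^ (J + k) \<le> 4 ^ J"
          unfolding e42n power_add using \<open>k \<le> J\<close> by (intro mult_left_mono power_increasing) auto
        ultimately have "(\<beta>, k, a) \<in> T5" by (simp add: T5_def)
        then have "\<omega> \<notin> E5 (\<beta>, k, a)" using nU(5) by (simp only: UN_iff) blast
        then show "(\<Sum>i=1..n. indicator {x. cell R \<beta> (2 ^ (J + k)) x = a} (Xs i \<omega>)) < (16 * c + 1) * 4 ^ J / 2 ^ k"
          using \<omega> unfolding E5_def C_def prod.case by (simp only: mem_Collect_eq not_le simp_thms)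
      next
        fix \<beta> and a :: nat assume "\<beta> \<in> S" "a < 2 ^ (2 * J)"
        then have "(\<beta>, a) \<in> T6" by (simp add: T6_def power_mult)
        then have "\<omega> \<notin> E6 (\<beta>, a)" using nU(6) by (simp only: UN_iff) blast
        then show "(\<Sum>i=1..n. l * (\<bar>res i \<omega>\<bar> * indicator {x. cell R \<beta> (2 ^ (2 * J)) x = a} (Xs i \<omega>))) < (8 * \<gamma> * c + 1) * 2 ^ J"
          using \<omega> unfolding E6_def C_def prod.case by (simp only: mem_Collect_eq not_le simp_thms)
      next
        fix \<beta> and j :: nat and t :: real assume "\<beta> \<in> S" "j \<le> 8 ^ J + 1" "t \<in> {-1, 1}"
        then have "(\<beta>, j, t) \<in> T7" by (simp add: T7_def)
        then have "\<omega> \<notin> E7 (\<beta>, j, t)" using nU(7) by (simp only: UN_iff) blast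
        then show "(\<Sum>i=1..n. l / 2 * ((t * res i \<omega> - \<gamma> * l / 2) * indicator (halfspace J \<beta> j) (Xs i \<omega>)
          + \<bar>res i \<omega>\<bar> * indicator (shell J \<beta> j) (Xs i \<omega>))) < 24 * \<gamma> * c + (real J)\<^sup>2"
          using \<omega> unfolding E7_def prod.case by (simp only: mem_Collect_eq not_le simp_thms)
      next
        fix \<beta> and j :: nat assume "\<beta> \<in> S" "j \<le> 8 ^ J + 1"
        then have "(\<beta>, j) \<in> T8" by (simp add: T8_def)
        then have "\<omega> \<notin> E8 (\<beta>, j)" using nU(8) by (simp only: UN_iff) blast
        then have "(\<Sum>i=1..n. - indicat_real (halfspace J \<beta> j) (Xs i \<omega>)) < real n * (- measure Q (halfspace J \<beta> j) / 2) + (real J)\<^sup>2"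
          using \<omega> unfolding E8_def prod.case by (simp only: mem_Collect_eq not_le simp_thms)
        then show "real n * measure Q (halfspace J \<beta> j) / 2 - (real J)\<^sup>2 < (\<Sum>i=1..n. indicator (halfspace J \<beta> j) (Xs i \<omega>))"
          by (simp add: sum_negf)
      qed
      with nr show False by blast
    qed
    have add: "emeasure M (A \<union> B) \<le> ennreal (a + b)"
      if "A \<in> sets M" "B \<in> sets M" "emeasure M A \<le> ennreal a" "emeasure M B \<le> ennreal b" "0 \<le> a" "0 \<le> b" for A B a b
    proof -
      have "emeasure M (A \<union> B) \<le> emeasure M A + emeasure M B" using that by (intro emeasure_subadditive)
      also have "\<dots> \<le> ennreal a + ennreal b" using that by (intro add_mono)
      finally show ?thesis using that by simp
    qed
    have s: "0 \<le> s" by (simp add: s_def)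
    have eq3: "exp (30 * 2 ^ J) * exp (- (31 * 2 ^ J)) = exp (- (2 ^ J) :: real)" by (simp flip: exp_add)
    have "emeasure M E \<le> ennreal (real n * 0 + real n * (\<gamma> * exp (- (l * (real J)\<^sup>2)))
       + s * exp (30 * 2 ^ J) * exp (- (31 * 2 ^ J)) + s * real (J + 1) * exp (- (2 ^ J))
       + s * (real (J + 1) * 4 ^ J) * exp (- (2 ^ J)) + s * 4 ^ J * exp (- (2 ^ J))
       + s * (2 * (8 ^ J + 2)) * exp (- (real J)\<^sup>2) + s * (8 ^ J + 2) * exp (- (real J)\<^sup>2))"
      unfolding E_def by (intro add sets.Un U b1 b2 b3 b4 b5 b6 b7 b8) (use s constants in auto)
    also have "real n * 0 + real n * (\<gamma> * exp (- (l * (real J)\<^sup>2)))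
       + s * exp (30 * 2 ^ J) * exp (- (31 * 2 ^ J)) + s * real (J + 1) * exp (- (2 ^ J))
       + s * (real (J + 1) * 4 ^ J) * exp (- (2 ^ J)) + s * 4 ^ J * exp (- (2 ^ J))
       + s * (2 * (8 ^ J + 2)) * exp (- (real J)\<^sup>2) + s * (8 ^ J + 2) * exp (- (real J)\<^sup>2)
      = real n * (\<gamma> * exp (- (l * (real J)\<^sup>2)))
       + s * (1 + real (J + 1) + real (J + 1) * 4 ^ J + 4 ^ J) * exp (- (2 ^ J))
       + s * (3 * (8 ^ J + 2)) * exp (- (real J)\<^sup>2)"
      unfolding mult.assoc[of s "exp (30 * 2 ^ J)"] eq3 by (simp add: algebra_simps)
    finally show "emeasure M E \<le> ennreal (real n * (\<gamma> * exp (- (l * (real J)\<^sup>2)))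
       + real (card S) * (1 + real (J + 1) + real (J + 1) * 4 ^ J + 4 ^ J) * exp (- (2 ^ J))
       + real (card S) * (3 * (8 ^ J + 2)) * exp (- (real J)\<^sup>2))"
      unfolding s_def .
  qed
qed

end

section \<open>Rate of the least squares estimator\<close>

lemma slack_eventually:
  fixes c g l K :: real assumes "0 < l" "0 < c" "0 < g" "0 < K"
  shows "\<forall>\<^sub>F J::nat in sequentially. 54 * (4 * (2 / l * (24 * g * c + (real J)\<^sup>2) * ((real J)\<^sup>2 + K))) + 6 * ((2 * (real J)\<^sup>2 + 24 * c) * ((real J)\<^sup>2 + K)\<^sup>2) \<le> 2 ^ J"
  using assms by real_asymp
lemma outlier_probability_vanishes: fixes g l :: real assumes "0 < l" "0 < g" shows "(\<lambda>J::nat. 8 * 8 ^ J * (g * exp (- (l * (real J)\<^sup>2)))) \<longlonglongrightarrow> 0"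
  using assms by real_asymp
lemma cell_event_probability_vanishes: fixes a :: real assumes "1 < a" shows "(\<lambda>J::nat. a ^ J * (1 + real (J + 1) + real (J + 1) * 4 ^ J + 4 ^ J) * exp (- (2 ^ J))) \<longlonglongrightarrow> 0"
  using assms by real_asymp
lemma halfspace_event_probability_vanishes: fixes a :: real assumes "1 < a" shows "(\<lambda>J::nat. a ^ J * (3 * (8 ^ J + 2)) * exp (- (real J)\<^sup>2)) \<longlonglongrightarrow> 0"
  using assms by real_asymp
lemma tilt_range_vanishes: "(\<lambda>J::nat. 2 * (3/4 :: real) ^ J) \<longlonglongrightarrow> 0"
  by real_asymp
lemma level_tends_to_infinity: "filterlim (\<lambda>n. nat \<lfloor>log 8 (real n)\<rfloor>) at_top sequentially"
  by real_asymp

text \<open>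
  The profile criterion at the estimated direction is at most the one at \<open>\<alpha>\<^sub>0\<close>, which in turn is at most the
  criterion at \<open>\<Psi>\<^sub>0\<close>.
\<close>

lemma least_squares_basic_inequality:
  assumes lse: "is_lse n x y \<Psi> \<alpha>" and "\<alpha>\<^sub>0 \<in> sphere 0 1" "mono \<Psi>\<^sub>0"
  shows "mono \<Psi>" "\<alpha> \<in> sphere 0 1"
    "(\<Sum>i=1..n. (y i - \<Psi> (\<alpha> \<bullet> x i))\<^sup>2) \<le> (\<Sum>i=1..n. (y i - \<Psi>\<^sub>0 (\<alpha>\<^sub>0 \<bullet> x i))\<^sup>2)"
proof -
  show mono: "mono \<Psi>" and "\<alpha> \<in> sphere 0 1"
    using lse by (auto simp: is_lse_def is_arg_min_def)
  have nn: "0 \<le> ls_crit n x y \<Phi> \<beta>" for \<Phi> \<beta> by (simp add: ls_crit_def sum_nonneg)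
  have "ls_crit n x y \<Psi> \<alpha> \<le> profile_crit n x y \<alpha>"
    unfolding profile_crit_def
  proof (rule cINF_greatest)
    show "{\<Psi> :: real \<Rightarrow> real. mono \<Psi>} \<noteq> {}" using mono by blast
    show "ls_crit n x y \<Psi> \<alpha> \<le> ls_crit n x y \<Phi> \<alpha>" if "\<Phi> \<in> {\<Psi>. mono \<Psi>}" for \<Phi>
      using lse that by (auto simp: is_lse_def is_arg_min_def not_less)
  qed
  also have "\<dots> \<le> profile_crit n x y \<alpha>\<^sub>0"
    using lse assms(2) by (auto simp: is_lse_def is_arg_min_def not_less simp del: mem_sphere mem_sphere_0)
  also have "\<dots> \<le> ls_crit n x y \<Psi>\<^sub>0 \<alpha>\<^sub>0"
    unfolding profile_crit_def using assms(3) nn by (intro cINF_lower bdd_belowI[of _ 0]) auto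
  finally show "(\<Sum>i=1..n. (y i - \<Psi> (\<alpha> \<bullet> x i))\<^sup>2) \<le> (\<Sum>i=1..n. (y i - \<Psi>\<^sub>0 (\<alpha>\<^sub>0 \<bullet> x i))\<^sup>2)"
    by (simp add: ls_crit_def single_index_def)
qed

text \<open>
  Truncating \<open>\<Psi>\<close> at \<open>B\<close> keeps it monotone and would strictly decrease the criterion if a fitted value exceeded
  \<open>B\<close>. Beyond the observed projections \<open>\<Psi>\<close> is constant, so the bound for the fitted values holds everywhere.
\<close>

lemma least_squares_range:
  assumes lse: "is_lse n x y \<Psi> \<alpha>" and n: "n \<ge> 1" and y: "\<And>i. i \<in> {1..n} \<Longrightarrow> \<bar>y i\<bar> \<le> B"
  shows "\<bar>\<Psi> t\<bar> \<le> B"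
proof -
  have mono: "mono \<Psi>" and min: "\<And>\<Phi>. mono \<Phi> \<Longrightarrow> ls_crit n x y \<Psi> \<alpha> \<le> ls_crit n x y \<Phi> \<alpha>"
    and step: "left_cont_step n (\<lambda>i. \<alpha> \<bullet> x i) \<Psi>"
    using lse by (auto simp: is_lse_def is_arg_min_def not_less)
  have B: "0 \<le> B" using y[of 1] n by auto
  define \<Phi> where "\<Phi> t = max (- B) (min B (\<Psi> t))" for t
  have "mono \<Phi>"
    unfolding \<Phi>_def[abs_def] by (intro monoI max.mono min.mono order.refl monoD[OF mono])
  have le: "(y i - \<Phi> (\<alpha> \<bullet> x i))\<^sup>2 \<le> (y i - \<Psi> (\<alpha> \<bullet> x i))\<^sup>2" if "i \<in> {1..n}" for i
    using y[OF that] by (intro abs_le_square_iff[THEN iffD1]) (auto simp: \<Phi>_def max_def min_def)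
  have data: "\<bar>\<Psi> (\<alpha> \<bullet> x i)\<bar> \<le> B" if i: "i \<in> {1..n}" for i
  proof (rule ccontr)
    assume nb: "\<not> \<bar>\<Psi> (\<alpha> \<bullet> x i)\<bar> \<le> B"
    have "(y i - \<Phi> (\<alpha> \<bullet> x i))\<^sup>2 < (y i - \<Psi> (\<alpha> \<bullet> x i))\<^sup>2"
    proof -
      have "\<bar>y i - \<Phi> (\<alpha> \<bullet> x i)\<bar> < \<bar>y i - \<Psi> (\<alpha> \<bullet> x i)\<bar>"
        using nb y[OF i] B by (auto simp: \<Phi>_def max_def min_def)
      then show ?thesis using power_strict_mono[of "\<bar>y i - \<Phi> (\<alpha> \<bullet> x i)\<bar>" "\<bar>y i - \<Psi> (\<alpha> \<bullet> x i)\<bar>" 2] by simp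
    qed
    then have "(\<Sum>i=1..n. (y i - \<Phi> (\<alpha> \<bullet> x i))\<^sup>2) < (\<Sum>i=1..n. (y i - \<Psi> (\<alpha> \<bullet> x i))\<^sup>2)"
      using i le by (intro sum_strict_mono_ex1) auto
    with min[OF \<open>mono \<Phi>\<close>] show False by (simp add: ls_crit_def single_index_def)
  qed
  define z where "z = (\<lambda>i. \<alpha> \<bullet> x i)"
  have fin: "finite (z ` {1..n})" "z ` {1..n} \<noteq> {}" using n by auto
  obtain u where u: "u \<in> {1..n}" "Max (z ` {1..n}) = z u" using Max_in[OF fin] by auto
  obtain v where v: "v \<in> {1..n}" "Min (z ` {1..n}) = z v" using Min_in[OF fin] by auto
  have um: "z i \<le> z u" and vm: "z v \<le> z i" if "i \<in> {1..n}" for i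
    using that fin(1) unfolding u(2)[symmetric] v(2)[symmetric] by auto
  have "\<Psi> t \<le> \<Psi> (z u)"
  proof (cases "t \<le> z u")
    case False
    then have "\<Psi> (z u) = \<Psi> t" using step um by (auto simp: left_cont_step_def z_def)
    then show ?thesis by simp
  qed (use monoD[OF mono] in blast)
  moreover have "\<Psi> (z v) \<le> \<Psi> t"
  proof (cases "z v \<le> t")
    case False
    then have "\<Psi> t = \<Psi> (z v)" using step vm by (auto simp: left_cont_step_def z_def)
    then show ?thesis by simp
  qed (use monoD[OF mono] in blast)
  ultimately show ?thesis using data[OF u(1)] data[OF v(1)] unfolding z_def by linarith
qed

text \<open>
  At this resolution the normalized position of every point of the support changes by at most \<open>1 / 8 ^ J\<close> when
  a direction is replaced by its neighbour in the net.
\<close>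

lemma direction_net:
  obtains S :: "nat \<Rightarrow> (real ^ 'd) set" where "\<And>J. finite (S J)" "\<And>J. S J \<subseteq> sphere 0 1"
    "\<And>J. card (S J) \<le> (2 * (CARD('d) * 8 ^ J) + 1) ^ CARD('d)"
    "\<And>J \<alpha>. \<alpha> \<in> sphere 0 1 \<Longrightarrow> \<exists>\<beta>\<in>S J. norm (\<alpha> - \<beta>) \<le> 2 / 8 ^ J"
proof -
  have "\<exists>S :: (real ^ 'd) set. finite S \<and> S \<subseteq> sphere 0 1 \<and> card S \<le> (2 * (CARD('d) * 8 ^ J) + 1) ^ CARD('d) \<and>
    (\<forall>\<alpha>\<in>sphere 0 1. \<exists>\<beta>\<in>S. norm (\<alpha> - \<beta>) \<le> 2 / 8 ^ J)" for J :: nat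
  proof -
    have "0 < CARD('d) * 8 ^ J" by simp
    then obtain S :: "(real ^ 'd) set" where S: "finite S" "S \<subseteq> sphere 0 1" "card S \<le> (2 * (CARD('d) * 8 ^ J) + 1) ^ CARD('d)"
      "\<And>\<alpha>. \<alpha> \<in> sphere 0 1 \<Longrightarrow> \<exists>\<beta>\<in>S. norm (\<alpha> - \<beta>) \<le> real CARD('d) / real (CARD('d) * 8 ^ J)"
      by (rule sphere_net[OF refl]) (rule that)
    have "real CARD('d) / real (CARD('d) * 8 ^ J) \<le> 2 / 8 ^ J" by (simp add: divide_right_mono)
    then show ?thesis using S by (meson order_trans)
  qed
  then show ?thesis using that by metis
qed

context index_sample
begin

text \<open>
  The level \<open>J\<close> is the integer part of the logarithm of \<open>n\<close> to base \<open>8\<close>. On the regular event all observations are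
  bounded by \<open>J\<^sup>2 + K0\<close>, hence so is the estimator, and the contribution of its excess is polynomial in \<open>J\<close> and
  negligible compared with \<open>2 ^ J\<close>.
\<close>

lemma least_squares_rate:
  assumes lse: "\<And>n \<omega>. n \<ge> 1 \<Longrightarrow> \<omega> \<in> space M \<Longrightarrow> is_lse n (\<lambda>i. Xs i \<omega>) (\<lambda>i. Ys i \<omega>) (\<Psi>h n \<omega>) (\<alpha>h n \<omega>)"
    and g0_eq: "g0 = (\<lambda>x. \<Psi>\<^sub>0 (\<alpha>\<^sub>0 \<bullet> x))" and \<alpha>\<^sub>0: "\<alpha>\<^sub>0 \<in> sphere 0 1" and \<Psi>\<^sub>0: "mono \<Psi>\<^sub>0"
  shows "bigo_prob M (\<lambda>n \<omega>. sqrt (\<integral>x. (\<Psi>h n \<omega> (\<alpha>h n \<omega> \<bullet> x) - g0 x)\<^sup>2 \<partial>Q)) (\<lambda>n. real n powr (- 1 / 3))"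
proof -
  obtain S :: "nat \<Rightarrow> (real ^ 'd) set" where S: "\<And>J. finite (S J)" "\<And>J. S J \<subseteq> sphere 0 1"
    "\<And>J. card (S J) \<le> (2 * (CARD('d) * 8 ^ J) + 1) ^ CARD('d)"
    and net: "\<And>J \<alpha>. \<alpha> \<in> sphere 0 1 \<Longrightarrow> \<exists>\<beta>\<in>S J. norm (\<alpha> - \<beta>) \<le> 2 / 8 ^ J"
    using direction_net by blast
  define lev where "lev n = nat \<lfloor>log 8 (real n)\<rfloor>" for n :: nat
  have lev_top: "filterlim lev at_top sequentially" unfolding lev_def by (rule level_tends_to_infinity)
  have lev: "8 ^ lev n \<le> real n" "real n \<le> 8 * 8 ^ lev n" if "n \<ge> 1" for n
  proof -
    have "0 \<le> log 8 (real n)" using that by simp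
    then have "real (lev n) \<le> log 8 (real n)" "log 8 (real n) \<le> 1 + real (lev n)" unfolding lev_def by linarith+
    then have "8 powr real (lev n) \<le> real n" "real n \<le> 8 powr (1 + real (lev n))"
      using that by (simp_all add: le_log_iff log_le_iff)
    then show "8 ^ lev n \<le> real n" "real n \<le> 8 * 8 ^ lev n" by (simp_all add: powr_add powr_realpow)
  qed
  define W where "W J = (real J)\<^sup>2 + K0" for J :: nat
  (* the added 1 leaves room for the excess over the truncation level, eventually at most 2 ^ J *)
  define A where "A = 54 * \<bar>risk_const\<bar> + 1"
  define rn where "rn n = real n powr (- 1 / 3)" for n :: nat
  have good: "sqrt (\<integral>x. (\<Psi>h n \<omega> (\<alpha>h n \<omega> \<bullet> x) - g0 x)\<^sup>2 \<partial>Q) \<le> sqrt A * rn n"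
    if n: "n \<ge> 1" and \<omega>: "\<omega> \<in> space M" and reg: "regular (S (lev n)) (lev n) n \<omega>"
      and slack: "54 * (4 * (2 / l * (24 * \<gamma> * c + (real (lev n))\<^sup>2) * ((real (lev n))\<^sup>2 + K0)))
        + 6 * ((2 * (real (lev n))\<^sup>2 + 24 * c) * ((real (lev n))\<^sup>2 + K0)\<^sup>2) \<le> 2 ^ lev n" for n \<omega>
  proof -
    define J where "J = lev n"
    define f where "f x = \<Psi>h n \<omega> (\<alpha>h n \<omega> \<bullet> x) - g0 x" for x
    note L = lse[OF n \<omega>]
    note basic = least_squares_basic_inequality[OF L \<alpha>\<^sub>0 \<Psi>\<^sub>0]
    have "\<bar>Ys i \<omega>\<bar> \<le> W J" if "i \<in> {1..n}" for i
    proof -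
      have "Xs i \<omega> \<in> XX" "\<bar>res i \<omega>\<bar> < (real J)\<^sup>2" using reg that unfolding regular_def J_def by blast+
      then show ?thesis using g0_bound[of "Xs i \<omega>"] unfolding res_def W_def by linarith
    qed
    then have range: "\<bar>\<Psi>h n \<omega> t\<bar> \<le> W J" for t by (rule least_squares_range[OF L n])
    have "0 \<le> (\<Sum>i=1..n. 2 * res i \<omega> * f (Xs i \<omega>) - (f (Xs i \<omega>))\<^sup>2)"
    proof -
      have "(\<Sum>i=1..n. 2 * res i \<omega> * f (Xs i \<omega>) - (f (Xs i \<omega>))\<^sup>2)
          = (\<Sum>i=1..n. (Ys i \<omega> - g0 (Xs i \<omega>))\<^sup>2 - (Ys i \<omega> - \<Psi>h n \<omega> (\<alpha>h n \<omega> \<bullet> Xs i \<omega>))\<^sup>2)"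
        by (intro sum.cong refl) (simp add: res_def f_def power2_eq_square algebra_simps)
      then show ?thesis using basic(3) by (simp add: sum_subtractf g0_eq)
    qed
    then have "real n * (\<integral>x. (f x)\<^sup>2 \<partial>Q) \<le> 54 * (risk_const * 2 ^ J + 4 * (excess_slack J * W J)) + 6 * ((2 * (real J)\<^sup>2 + 24 * c) * (W J)\<^sup>2)"
      unfolding f_def J_def using n lev[OF n]
      by (intro least_squares_error_bound[OF reg S(2) net basic(2,1) range[unfolded J_def]]) auto
    also have "\<dots> = 54 * risk_const * 2 ^ J + (54 * (4 * (excess_slack J * W J)) + 6 * ((2 * (real J)\<^sup>2 + 24 * c) * (W J)\<^sup>2))"
      by (simp add: distrib_left)
    also have "\<dots> \<le> 54 * \<bar>risk_const\<bar> * 2 ^ J + 2 ^ J"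
      using slack unfolding excess_slack_def W_def J_def by (intro add_mono mult_right_mono) auto
    also have "\<dots> = A * 2 ^ J" by (simp add: A_def distrib_right)
    finally have b: "real n * (\<integral>x. (f x)\<^sup>2 \<partial>Q) \<le> A * 2 ^ J" .
    have "2 ^ J \<le> real n powr (1 / 3)"
    proof -
      have "(2::real) ^ J = (8 ^ J) powr (1 / 3)"
      proof -
        have "(2 ^ J) ^ 3 = ((2::real) ^ 3) ^ J" by (simp only: power_mult[symmetric] mult.commute)
        then have eq: "(8::real) ^ J = (2 ^ J) powr 3" by simp
        show ?thesis unfolding eq powr_powr by simp
      qed
      also have "\<dots> \<le> real n powr (1 / 3)" using lev(1)[OF n] by (intro powr_mono2) (auto simp: J_def)
      finally show ?thesis .
    qed
    then have "real n * (\<integral>x. (f x)\<^sup>2 \<partial>Q) \<le> A * real n powr (1 / 3)"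
      using b mult_left_mono[of "2 ^ J" "real n powr (1 / 3)" A] by (simp add: A_def)
    also have "real n powr (1 / 3) = real n * (rn n)\<^sup>2"
    proof -
      have "real n * (rn n)\<^sup>2 = real n powr 1 * (real n powr (- 1 / 3) * real n powr (- 1 / 3))"
        using n by (simp add: rn_def power2_eq_square)
      also have "\<dots> = real n powr (1 / 3)" unfolding powr_add[symmetric] by simp
      finally show ?thesis ..
    qed
    finally have "real n * (\<integral>x. (f x)\<^sup>2 \<partial>Q) \<le> real n * (A * (rn n)\<^sup>2)" by (simp only: mult_ac)
    then have "(\<integral>x. (f x)\<^sup>2 \<partial>Q) \<le> A * (rn n)\<^sup>2" using n by simp
    then have "sqrt (\<integral>x. (f x)\<^sup>2 \<partial>Q) \<le> sqrt (A * (rn n)\<^sup>2)" by simp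
    also have "\<dots> = sqrt A * rn n" by (simp add: real_sqrt_mult rn_def)
    finally show ?thesis unfolding f_def .
  qed
  define a where "a = real (8 ^ CARD('d))"
  define D where "D = real ((3 * CARD('d)) ^ CARD('d))"
  have a: "1 < a" unfolding a_def using one_less_power[of "8::nat" "CARD('d)"] by simp
  have D: "0 \<le> D" by (simp add: D_def)
  have cardS: "real (card (S J)) \<le> D * a ^ J" for J
  proof -
    have "card (S J) \<le> (2 * (CARD('d) * 8 ^ J) + 1) ^ CARD('d)" by (rule S)
    also have "\<dots> \<le> (3 * CARD('d) * 8 ^ J) ^ CARD('d)" by (intro power_mono) (auto simp: Suc_le_eq)
    also have "\<dots> = (3 * CARD('d)) ^ CARD('d) * (8 ^ CARD('d)) ^ J"
      by (simp add: power_mult_distrib mult.commute flip: power_mult)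
    finally have "real (card (S J)) \<le> real ((3 * CARD('d)) ^ CARD('d) * (8 ^ CARD('d)) ^ J)" by (simp only: of_nat_le_iff)
    then show ?thesis unfolding D_def a_def by (simp only: of_nat_mult of_nat_power)
  qed
  define err where "err J = 8 * 8 ^ J * (\<gamma> * exp (- (l * (real J)\<^sup>2)))
       + D * (a ^ J * (1 + real (J + 1) + real (J + 1) * 4 ^ J + 4 ^ J) * exp (- (2 ^ J)))
       + D * (a ^ J * (3 * (8 ^ J + 2)) * exp (- (real J)\<^sup>2))" for J :: nat
  have err0: "err \<longlonglongrightarrow> 0"
  proof -
    have "err \<longlonglongrightarrow> 0 + D * 0 + D * 0"
      unfolding err_def using constants a by (intro tendsto_intros outlier_probability_vanishes cell_event_probability_vanishes
        halfspace_event_probability_vanishes) auto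
    then show ?thesis by simp
  qed
  show ?thesis
    unfolding bigo_prob_def
  proof (intro allI impI)
    fix \<epsilon> :: real assume \<epsilon>: "0 < \<epsilon>"
    have e1: "\<forall>\<^sub>F n in sequentially. err (lev n) < \<epsilon>"
      using order_tendstoD(2)[OF filterlim_compose[OF err0 lev_top] \<epsilon>] .
    have e2: "\<forall>\<^sub>F n in sequentially. 2 * (3/4) ^ lev n < l"
      using order_tendstoD(2)[OF filterlim_compose[OF tilt_range_vanishes lev_top], of l] constants by simp
    have e3: "\<forall>\<^sub>F n in sequentially. 54 * (4 * (2 / l * (24 * \<gamma> * c + (real (lev n))\<^sup>2) * ((real (lev n))\<^sup>2 + K0)))
        + 6 * ((2 * (real (lev n))\<^sup>2 + 24 * c) * ((real (lev n))\<^sup>2 + K0)\<^sup>2) \<le> 2 ^ lev n"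
      using constants by (intro eventually_compose_filterlim[OF slack_eventually lev_top]) auto
    have "\<forall>\<^sub>F n in sequentially. outer_measure_of M {\<omega>\<in>space M. \<bar>sqrt (\<integral>x. (\<Psi>h n \<omega> (\<alpha>h n \<omega> \<bullet> x) - g0 x)\<^sup>2 \<partial>Q)\<bar> > sqrt A * rn n} \<le> ennreal \<epsilon>"
      using e1 e2 e3 eventually_ge_at_top[of 1]
    proof eventually_elim
      case (elim n)
      define J where "J = lev n"
      obtain E where E: "E \<in> sets M" "{\<omega>\<in>space M. \<not> regular (S J) J n \<omega>} \<subseteq> E"
        "emeasure M E \<le> ennreal (real n * (\<gamma> * exp (- (l * (real J)\<^sup>2)))
         + real (card (S J)) * (1 + real (J + 1) + real (J + 1) * 4 ^ J + 4 ^ J) * exp (- (2 ^ J))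
         + real (card (S J)) * (3 * (8 ^ J + 2)) * exp (- (real J)\<^sup>2))"
        using prob_not_regular[OF S(1) S(2), of n J J] lev(2)[OF elim(4)] elim(2) unfolding J_def by auto
      have "{\<omega>\<in>space M. \<bar>sqrt (\<integral>x. (\<Psi>h n \<omega> (\<alpha>h n \<omega> \<bullet> x) - g0 x)\<^sup>2 \<partial>Q)\<bar> > sqrt A * rn n} \<subseteq> E"
      proof
        fix \<omega> assume "\<omega> \<in> {\<omega>\<in>space M. \<bar>sqrt (\<integral>x. (\<Psi>h n \<omega> (\<alpha>h n \<omega> \<bullet> x) - g0 x)\<^sup>2 \<partial>Q)\<bar> > sqrt A * rn n}"
        then have \<omega>: "\<omega> \<in> space M" "\<not> sqrt (\<integral>x. (\<Psi>h n \<omega> (\<alpha>h n \<omega> \<bullet> x) - g0 x)\<^sup>2 \<partial>Q) \<le> sqrt A * rn n" by auto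
        then have "\<not> regular (S J) J n \<omega>" using good[OF elim(4) \<omega>(1) _ elim(3)] unfolding J_def by blast
        then show "\<omega> \<in> E" using E(2) \<omega>(1) by blast
      qed
      then have "outer_measure_of M {\<omega>\<in>space M. \<bar>sqrt (\<integral>x. (\<Psi>h n \<omega> (\<alpha>h n \<omega> \<bullet> x) - g0 x)\<^sup>2 \<partial>Q)\<bar> > sqrt A * rn n} \<le> outer_measure_of M E"
        by (rule outer_measure_of_mono)
      also have "\<dots> = emeasure M E" using E(1) by simp
      also have "\<dots> \<le> ennreal (err J)"
      proof (rule order_trans[OF E(3)], rule ennreal_leI)
        have "real n * (\<gamma> * exp (- (l * (real J)\<^sup>2))) \<le> 8 * 8 ^ J * (\<gamma> * exp (- (l * (real J)\<^sup>2)))"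
          using lev(2)[OF elim(4)] constants by (intro mult_right_mono) (auto simp: J_def)
        moreover have "real (card (S J)) * (1 + real (J + 1) + real (J + 1) * 4 ^ J + 4 ^ J) * exp (- (2 ^ J))
            \<le> D * a ^ J * (1 + real (J + 1) + real (J + 1) * 4 ^ J + 4 ^ J) * exp (- (2 ^ J))"
          by (intro mult_right_mono cardS) (auto intro!: add_nonneg_nonneg mult_nonneg_nonneg)
        moreover have "real (card (S J)) * (3 * (8 ^ J + 2)) * exp (- (real J)\<^sup>2)
            \<le> D * a ^ J * (3 * (8 ^ J + 2)) * exp (- (real J)\<^sup>2)"
          by (intro mult_right_mono cardS) (auto intro!: add_nonneg_nonneg mult_nonneg_nonneg)
        ultimately show "real n * (\<gamma> * exp (- (l * (real J)\<^sup>2)))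
         + real (card (S J)) * (1 + real (J + 1) + real (J + 1) * 4 ^ J + 4 ^ J) * exp (- (2 ^ J))
         + real (card (S J)) * (3 * (8 ^ J + 2)) * exp (- (real J)\<^sup>2) \<le> err J"
          unfolding err_def by (simp only: mult.assoc)
      qed
      also have "\<dots> \<le> ennreal \<epsilon>" using elim(1) by (intro ennreal_leI) (simp add: J_def)
      finally show ?case .
    qed
    moreover have "0 < sqrt A" by (simp add: A_def add_nonneg_pos)
    ultimately show "\<exists>C>0. \<forall>\<^sub>F n in sequentially. outer_measure_of M {\<omega>\<in>space M. \<bar>sqrt (\<integral>x. (\<Psi>h n \<omega> (\<alpha>h n \<omega> \<bullet> x) - g0 x)\<^sup>2 \<partial>Q)\<bar> > C * real n powr (- 1 / 3)} \<le> ennreal \<epsilon>"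
      unfolding rn_def by blast
  qed
qed

end

text \<open>
  The index \<open>0\<close> is excluded because nothing is known about the estimator without observations.
\<close>

lemma bigo_prob_cong:
  assumes "bigo_prob M Z r" "\<And>n \<omega>. n \<ge> 1 \<Longrightarrow> \<omega> \<in> space M \<Longrightarrow> Z' n \<omega> = Z n \<omega>"
  shows "bigo_prob M Z' r"
  unfolding bigo_prob_def
proof (intro allI impI)
  fix \<epsilon> :: real assume "0 < \<epsilon>"
  then obtain C where C: "C > 0" "\<forall>\<^sub>F n in sequentially. outer_measure_of M {\<omega>\<in>space M. \<bar>Z n \<omega>\<bar> > C * r n} \<le> ennreal \<epsilon>"
    using assms(1) unfolding bigo_prob_def by blast
  have "\<forall>\<^sub>F n in sequentially. outer_measure_of M {\<omega>\<in>space M. \<bar>Z' n \<omega>\<bar> > C * r n} \<le> ennreal \<epsilon>"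
    using C(2) eventually_ge_at_top[of 1]
  proof eventually_elim
    case (elim n)
    have "{\<omega>\<in>space M. \<bar>Z' n \<omega>\<bar> > C * r n} = {\<omega>\<in>space M. \<bar>Z n \<omega>\<bar> > C * r n}"
      using assms(2)[OF elim(2)] by auto
    then show ?case using elim(1) by (simp only:)
  qed
  then show "\<exists>C>0. \<forall>\<^sub>F n in sequentially. outer_measure_of M {\<omega>\<in>space M. \<bar>Z' n \<omega>\<bar> > C * r n} \<le> ennreal \<epsilon>"
    using C(1) by blast
qed

theorem theorem4p1:
  fixes M :: "'w measure"
    and X :: "'w \<Rightarrow> real ^ 'd" and Y :: "'w \<Rightarrow> real"
    and Xs :: "nat \<Rightarrow> 'w \<Rightarrow> real ^ 'd" and Ys :: "nat \<Rightarrow> 'w \<Rightarrow> real"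
    and Q :: "(real ^ 'd) measure" and \<X> :: "(real ^ 'd) set"
    and P :: "real ^ 'd \<Rightarrow> real measure"
    and \<Psi>\<^sub>0 :: "real \<Rightarrow> real" and \<alpha>\<^sub>0 :: "real ^ 'd" and g\<^sub>0 :: "real ^ 'd \<Rightarrow> real"
    and \<Psi>h :: "nat \<Rightarrow> 'w \<Rightarrow> real \<Rightarrow> real" and \<alpha>h :: "nat \<Rightarrow> 'w \<Rightarrow> real ^ 'd"
    and gh :: "nat \<Rightarrow> 'w \<Rightarrow> real ^ 'd \<Rightarrow> real"
  assumes prob: "prob_space M"
    and X_rv: "X \<in> borel_measurable M" and Y_rv: "Y \<in> borel_measurable M"
    and indep: "prob_space.indep_vars M (\<lambda>_. borel \<Otimes>\<^sub>M borel) (\<lambda>i \<omega>. (Xs i \<omega>, Ys i \<omega>)) {1..}"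
    and ident: "\<And>i. i \<ge> 1 \<Longrightarrow>
        distr M (borel \<Otimes>\<^sub>M borel) (\<lambda>\<omega>. (Xs i \<omega>, Ys i \<omega>))
          = distr M (borel \<Otimes>\<^sub>M borel) (\<lambda>\<omega>. (X \<omega>, Y \<omega>))"
    and Q: "Q = distr M borel X" and Q_cont: "atomless Q"
    and supp: "\<X> = msupport Q"
    and P: "is_cond_distr M X Y P"
    and \<alpha>\<^sub>0: "\<alpha>\<^sub>0 \<in> sphere 0 1" and \<Psi>\<^sub>0: "mono \<Psi>\<^sub>0"
    and g\<^sub>0: "g\<^sub>0 = single_index \<Psi>\<^sub>0 \<alpha>\<^sub>0"
    and regression:
      "AE \<omega> in M. real_cond_exp M (vimage_algebra (space M) X borel) Y \<omega> = \<Psi>\<^sub>0 (\<alpha>\<^sub>0 \<bullet> X \<omega>)"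
    and lse: "\<And>n \<omega>. n \<ge> 1 \<Longrightarrow> \<omega> \<in> space M \<Longrightarrow>
        is_lse n (\<lambda>i. Xs i \<omega>) (\<lambda>i. Ys i \<omega>) (\<Psi>h n \<omega>) (\<alpha>h n \<omega>)"
    and gh: "\<And>n \<omega>. gh n \<omega> = single_index (\<Psi>h n \<omega>) (\<alpha>h n \<omega>)"
    and A1: "bounded \<X> \<and> convex \<X>"
    and A2: "\<exists>K\<^sub>0>0. \<forall>x\<in>\<X>. \<bar>g\<^sub>0 x\<bar> \<le> K\<^sub>0"
    and A3: "\<exists>a\<^sub>0>0. \<exists>M\<^sub>0>0. \<forall>s\<ge>2. \<forall>x\<in>\<X>.
        (\<integral>\<^sup>+y. ennreal (\<bar>y\<bar> ^ s) \<partial>P x) \<le> ennreal (a\<^sub>0 * fact s * M\<^sub>0 ^ (s - 2))"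
    and A4: "\<exists>q_up>0. \<exists>q_lo>0. \<forall>\<alpha>\<in>sphere 0 1. \<exists>f :: real \<Rightarrow> real.
        distributed M lborel (\<lambda>\<omega>. \<alpha> \<bullet> X \<omega>) (\<lambda>t. ennreal (f t)) \<and>
        (\<forall>t\<in>(\<lambda>x. \<alpha> \<bullet> x) ` \<X>. q_lo \<le> f t \<and> f t \<le> q_up)"
  shows "bigo_prob M
           (\<lambda>n \<omega>. sqrt (LINT x:\<X>|Q. (gh n \<omega> x - g\<^sub>0 x)\<^sup>2))
           (\<lambda>n. real n powr (- 1 / 3))"
proof -
  interpret prob_space M by (rule prob)
  note [measurable] = X_rv Y_rv
  obtain K\<^sub>0 where K0: "K\<^sub>0 > 0" "\<And>x. x \<in> \<X> \<Longrightarrow> \<bar>g\<^sub>0 x\<bar> \<le> K\<^sub>0" using A2 by blast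
  obtain a\<^sub>0 M\<^sub>0 where a0: "a\<^sub>0 > 0" "M\<^sub>0 > 0"
    and mom: "\<And>s x. s \<ge> 2 \<Longrightarrow> x \<in> \<X> \<Longrightarrow> (\<integral>\<^sup>+y. ennreal (\<bar>y\<bar> ^ s) \<partial>P x) \<le> ennreal (a\<^sub>0 * fact s * M\<^sub>0 ^ (s - 2))"
    using A3 by blast
  obtain q_up q_lo where q: "q_up > 0" "q_lo > 0"
    and dens: "\<forall>\<alpha>\<in>sphere 0 1. \<exists>f :: real \<Rightarrow> real. distributed M lborel (\<lambda>\<omega>. \<alpha> \<bullet> X \<omega>) (\<lambda>t. ennreal (f t)) \<and>
        (\<forall>t\<in>(\<lambda>x. \<alpha> \<bullet> x) ` \<X>. q_lo \<le> f t \<and> f t \<le> q_up)"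
    using A4 by (elim exE conjE) (rule that)
  obtain b where b: "\<And>x. x \<in> \<X> \<Longrightarrow> norm x \<le> b" using A1 by (auto simp: bounded_iff)
  (* a strict bound, so that positions lie in the open unit interval *)
  define R where "R = \<bar>b\<bar> + 1"
  have R: "R > 0" "\<And>x. x \<in> \<X> \<Longrightarrow> norm x < R" using b by (force simp: R_def)+
  have sets_Q: "sets Q = sets borel" by (simp add: Q)
  have AE_Q: "AE x in Q. x \<in> \<X>" and closed: "closed \<X>"
    unfolding supp by (rule AE_mem_msupport[OF sets_Q])+
  have [measurable]: "\<X> \<in> sets borel" using closed by simp
  have AE_X: "AE \<omega> in M. X \<omega> \<in> \<X>" using AE_Q unfolding Q by (subst (asm) AE_distr_iff) auto
  have compact: "compact \<X>" using A1 closed by (simp add: compact_eq_bounded_closed)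
  have Pm: "P \<in> borel \<rightarrow>\<^sub>M prob_algebra borel" using P by (simp add: is_cond_distr_def)
  have Pp: "prob_space (P x)" "sets (P x) = sets borel" for x
    using measurable_space[OF Pm, of x] by (simp_all add: space_prob_algebra)
  have law: "(\<integral>\<^sup>+\<omega>. F (X \<omega>, Y \<omega>) \<partial>M) = (\<integral>\<^sup>+x. \<integral>\<^sup>+y. F (x, y) \<partial>P x \<partial>Q)"
    if "F \<in> borel_measurable (borel \<Otimes>\<^sub>M borel)" for F
    unfolding Q by (rule nn_integral_cond_distr[OF prob X_rv Y_rv P that])
  have g_eq: "g\<^sub>0 = (\<lambda>x. \<Psi>\<^sub>0 (\<alpha>\<^sub>0 \<bullet> x))" by (simp add: g\<^sub>0 single_index_def fun_eq_iff)
  have inner_measurable: "(\<lambda>x. \<alpha> \<bullet> x) \<in> borel_measurable borel" for \<alpha> :: "real ^ 'd"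
    by (intro borel_measurable_continuous_onI continuous_intros)
  have ridge_measurable: "(\<lambda>x. \<Psi> (\<alpha> \<bullet> x)) \<in> borel_measurable borel"
    if "mono \<Psi>" for \<Psi> :: "real \<Rightarrow> real" and \<alpha> :: "real ^ 'd"
    by (rule measurable_compose[OF inner_measurable borel_measurable_mono[OF that]])
  have [measurable]: "g\<^sub>0 \<in> borel_measurable borel" unfolding g_eq by (rule ridge_measurable[OF \<Psi>\<^sub>0])
  have intY: "integrable M Y"
  proof (rule square_integrable_imp_integrable)
    show "integrable M (\<lambda>\<omega>. (Y \<omega>)\<^sup>2)"
    proof (rule integrableI_nonneg)
      have "(\<integral>\<^sup>+\<omega>. ennreal ((Y \<omega>)\<^sup>2) \<partial>M) = (\<integral>\<^sup>+x. \<integral>\<^sup>+y. ennreal (\<bar>y\<bar> ^ 2) \<partial>P x \<partial>Q)"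
        using law[of "\<lambda>z. ennreal ((snd z)\<^sup>2)"] by simp
      also have "\<dots> \<le> (\<integral>\<^sup>+x. ennreal (a\<^sub>0 * fact 2 * M\<^sub>0 ^ (2 - 2)) \<partial>Q)"
      proof (rule nn_integral_mono_AE)
        show "AE x in Q. (\<integral>\<^sup>+y. ennreal (\<bar>y\<bar> ^ 2) \<partial>P x) \<le> ennreal (a\<^sub>0 * fact 2 * M\<^sub>0 ^ (2 - 2))"
          using AE_Q by eventually_elim (rule mom, auto)
      qed
      also have "\<dots> < \<infinity>"
        unfolding Q by (simp add: emeasure_distr emeasure_space_1 ennreal_mult_less_top)
      finally show "(\<integral>\<^sup>+\<omega>. ennreal ((Y \<omega>)\<^sup>2) \<partial>M) < \<infinity>" .
    qed auto
  qed simp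
  have mean: "AE x in Q. integrable (P x) (\<lambda>y. y) \<and> (\<integral>y. y \<partial>P x) = g\<^sub>0 x"
    unfolding Q g_eq using regression
    by (intro AE_cond_mean[OF prob X_rv Y_rv P intY] ridge_measurable \<Psi>\<^sub>0)
  define l where "l = 1 / (2 * M\<^sub>0)"
  define B where "B = 2 * (1 + 2 * l * (1 + 2 * a\<^sub>0) + 4 * a\<^sub>0 * l\<^sup>2)"
  define \<gamma> where "\<gamma> = (1 + 4 / l\<^sup>2) * (exp (l * K\<^sub>0) * B)"
  have l: "l > 0" using a0 by (simp add: l_def)
  have \<gamma>: "1 \<le> \<gamma>"
  proof -
    have "1 \<le> B" using a0 l by (simp add: B_def)
    moreover have "1 \<le> exp (l * K\<^sub>0)" using l K0 by simp
    ultimately have "1 * 1 \<le> exp (l * K\<^sub>0) * B" by (intro mult_mono) auto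
    then have "1 * 1 \<le> (1 + 4 / l\<^sup>2) * (exp (l * K\<^sub>0) * B)" by (intro mult_mono) auto
    then show ?thesis by (simp add: \<gamma>_def)
  qed
  interpret Q: prob_space Q unfolding Q by (rule prob_space_distr) simp
  interpret S: index_sample M Xs Ys Q P \<X> g\<^sub>0 R "2 * R * q_up" K\<^sub>0 l \<gamma>
  proof
    show "indep_vars (\<lambda>_. borel \<Otimes>\<^sub>M borel) (\<lambda>i \<omega>. (Xs i \<omega>, Ys i \<omega>)) {1..}" by (rule indep)
    show "(\<integral>\<^sup>+\<omega>. F (Xs i \<omega>, Ys i \<omega>) \<partial>M) = (\<integral>\<^sup>+x. \<integral>\<^sup>+y. F (x, y) \<partial>P x \<partial>Q)"
      if i: "i \<ge> 1" and F[measurable]: "F \<in> borel_measurable (borel \<Otimes>\<^sub>M borel)" for i F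
    proof -
      have [measurable]: "(\<lambda>\<omega>. (Xs i \<omega>, Ys i \<omega>)) \<in> M \<rightarrow>\<^sub>M borel \<Otimes>\<^sub>M borel"
        using indep i by (auto simp: indep_vars_def)
      have "(\<integral>\<^sup>+\<omega>. F (Xs i \<omega>, Ys i \<omega>) \<partial>M) = (\<integral>\<^sup>+z. F z \<partial>distr M (borel \<Otimes>\<^sub>M borel) (\<lambda>\<omega>. (Xs i \<omega>, Ys i \<omega>)))"
        by (simp add: nn_integral_distr)
      also have "\<dots> = (\<integral>\<^sup>+\<omega>. F (X \<omega>, Y \<omega>) \<partial>M)"
        unfolding ident[OF i] by (simp add: nn_integral_distr)
      finally show ?thesis using law[OF F] by simp
    qed
    show "AE x in Q. (\<integral>\<^sup>+y. ennreal (exp (l * \<bar>y - g\<^sub>0 x\<bar>)) \<partial>P x) \<le> ennreal \<gamma> \<and>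
      (\<forall>w. \<bar>w\<bar> \<le> l / 2 \<longrightarrow> (\<integral>\<^sup>+y. ennreal (exp (w * (y - g\<^sub>0 x))) \<partial>P x) \<le> ennreal (1 + \<gamma> * w\<^sup>2))"
      using mean AE_Q
    proof eventually_elim
      case (elim x)
      have "(\<integral>\<^sup>+y. ennreal (exp (l * \<bar>y\<bar>)) \<partial>P x) \<le> ennreal B"
        unfolding l_def B_def by (rule exp_moment_of_factorial_moments[OF Pp a0(2,1)]) (rule mom[OF _ elim(2)])
      note centred_exp_moments[OF Pp l this, of "g\<^sub>0 x" K\<^sub>0, folded \<gamma>_def]
      with elim K0(2) show ?case by blast
    qed
    show "measure Q {x. s \<le> pos R \<beta> x \<and> pos R \<beta> x \<le> t} \<le> 2 * R * q_up * (t - s)"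
      if \<beta>: "\<beta> \<in> sphere 0 1" and st: "s \<le> t" for \<beta> s t
    proof -
      obtain f where f: "distributed M lborel (\<lambda>\<omega>. \<beta> \<bullet> X \<omega>) (\<lambda>t. ennreal (f t))"
        "\<forall>t\<in>(\<lambda>x. \<beta> \<bullet> x) ` \<X>. q_lo \<le> f t \<and> f t \<le> q_up"
        using bspec[OF dens \<beta>] by (elim exE conjE) (rule that)
      have "compact ((\<lambda>x. \<beta> \<bullet> x) ` \<X>)" by (intro compact_continuous_image continuous_intros compact)
      then have im: "(\<lambda>x. \<beta> \<bullet> x) ` \<X> \<in> sets borel" by (simp add: borel_compact)
      have "measure Q {x. s \<le> pos R \<beta> x \<and> pos R \<beta> x \<le> t}
          = measure M {\<omega>\<in>space M. 2 * R * s - R \<le> \<beta> \<bullet> X \<omega> \<and> \<beta> \<bullet> X \<omega> \<le> 2 * R * t - R}"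
        unfolding Q using R(1)
        by (subst measure_distr) (auto intro!: arg_cong[where f = "measure M"] simp: pos_def field_simps)
      also have "\<dots> \<le> q_up * ((2 * R * t - R) - (2 * R * s - R))"
      proof (rule distributed_slab_measure_le[OF prob f(1) im])
        show "AE \<omega> in M. \<beta> \<bullet> X \<omega> \<in> (\<lambda>x. \<beta> \<bullet> x) ` \<X>" using AE_X by eventually_elim auto
        show "f t \<le> q_up" if "t \<in> (\<lambda>x. \<beta> \<bullet> x) ` \<X>" for t using bspec[OF f(2) that] by simp
      qed (use R(1) st q in auto)
      also have "\<dots> = 2 * R * q_up * (t - s)" by (simp add: algebra_simps)
      finally show ?thesis .
    qed
  qed (use sets_Q Pm AE_Q K0 R q l \<gamma> in auto)
  have "bigo_prob M (\<lambda>n \<omega>. sqrt (\<integral>x. (\<Psi>h n \<omega> (\<alpha>h n \<omega> \<bullet> x) - g\<^sub>0 x)\<^sup>2 \<partial>Q)) (\<lambda>n. real n powr (- 1 / 3))"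
    by (rule S.least_squares_rate[OF lse g_eq \<alpha>\<^sub>0 \<Psi>\<^sub>0])
  then show ?thesis
  proof (rule bigo_prob_cong)
    fix n :: nat and \<omega> assume n: "n \<ge> 1" and \<omega>: "\<omega> \<in> space M"
    have "mono (\<Psi>h n \<omega>)" by (rule least_squares_basic_inequality(1)[OF lse[OF n \<omega>] \<alpha>\<^sub>0 \<Psi>\<^sub>0])
    from ridge_measurable[OF this] have [measurable]: "(\<lambda>x. \<Psi>h n \<omega> (\<alpha>h n \<omega> \<bullet> x)) \<in> borel_measurable Q"
      by (simp add: Q)
    have [measurable]: "g\<^sub>0 \<in> borel_measurable Q" "\<X> \<in> sets Q" by (simp_all add: Q)
    have "(LINT x:\<X>|Q. (gh n \<omega> x - g\<^sub>0 x)\<^sup>2) = (\<integral>x. (\<Psi>h n \<omega> (\<alpha>h n \<omega> \<bullet> x) - g\<^sub>0 x)\<^sup>2 \<partial>Q)"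
      unfolding set_lebesgue_integral_def gh single_index_def
      using AE_Q by (intro integral_cong_AE) (auto elim: eventually_mono)
    then show "sqrt (LINT x:\<X>|Q. (gh n \<omega> x - g\<^sub>0 x)\<^sup>2) = sqrt (\<integral>x. (\<Psi>h n \<omega> (\<alpha>h n \<omega> \<bullet> x) - g\<^sub>0 x)\<^sup>2 \<partial>Q)" by simp
  qed
qed

end
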